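(* Suppose $\mathbb{P}\{S_0=\infty\}<1$. If $Z$ has almost surely continuous trajectories, then $\epsilon_0(Y)$ has a continuous distribution. Moreover, for all $\delta\ge 0$, $\mathcal{B}_Z^\delta(x)>0$ for all $x\ge0$ such that $\mathbb{P}\{\epsilon_\delta(Y)>x\}>0$.
   Context: Let $d\ge1$. $D$ is the space of generalised c\`adl\`ag functions $f:\mathbb{R}^d\to[0,\infty)$ (limits exist at every point within each of the $2^d$ quadrants, and $f(s)\to f(t)$ as $s\to t$ with $s\ge t$ componentwise), equipped with Skorohod's $J_1$-topology and the $\sigma$-field generated by the projections $f\mapsto f(t)$. The underlying probability space is complete and non-atomic. $Z(t),t\in\mathbb{R}^d$, is a random field with almost all sample paths in $D$ such that $\mathbb{E}\{Z(t)\}=1$ for all $t\in\mathbb{R}^d$, $\mathbb{E}\{\sup_{t\in[0,T]^d}Z(t)\}<\infty$ for all $T>0$, $\mathbb{P}\{\sup_{t\in\mathbb{R}^d}Z(t)>0\}=1$, and $Z$ is a spectral random field of a stationary max-stable random field $X$: the field $X(t)=\max_{i\ge1}\Gamma_i^{-1}Z^{(i)}(t)$, $t\in\mathbb{R}^d$, is stationary, where $\Gamma_i=\sum_{k=1}^i\mathcal{V}_k$, the $\mathcal{V}_k$ are i.i.d. unit exponential, independent of the i.i.d. copies $Z^{(i)}$ of $Z$. With $B^hZ(\cdot)=Z(\cdot-h)$, stationarity of $X$ is equivalent to $\mathbb{E}\{Z(h)F(Z)\}=\mathbb{E}\{Z(0)F(B^hZ)\}$ for all $h\in\mathbb{R}^d$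 and all measurable $F:D\to[0,\infty]$ with $F(cf)=F(f)$ for all $f\in D,c>0$. $\mathbb{I}$ denotes an indicator. $\lambda_0=\lambda$ is Lebesgue measure and $0\mathbb{Z}^d:=\mathbb{R}^d$; for $\delta>0$, $\lambda_\delta$ is $\delta^d$ times the counting measure on $\delta\mathbb{Z}^d$. Set $S_\delta=\int_{\delta\mathbb{Z}^d}Z(t)\,\lambda_\delta(dt)$. For the fixed $\delta\ge0$ under consideration $Z$ is chosen so that $S_\delta>0$ almost surely. The Berman function is, for $\delta,x\ge0$, $$\mathcal{B}_Z^\delta(x)=\lim_{T\to\infty}\frac1{T^d}\int_0^\infty\mathbb{P}\left\{\int_{[0,T]^d\cap\delta\mathbb{Z}^d}\mathbb{I}(Z(t)>s)\,\lambda_\delta(dt)>x\right\}ds .$$ $\Theta$ is a random field with sample paths in $D$ and law $\mu(A)=\mathbb{E}\{Z(0)\mathbb{I}\{Z/Z(0)\in A\}\}$ for measurable $A\subset D$. $Y(t)=R\,\Theta(t)$, where $R$ is independent of $\Theta$ with $\mathbb{P}\{R>r\}=1/r$, $r\ge1$, and $\epsilon_\delta(Y)=\int_{\delta\mathbb{Z}^d}\mathbb{I}\{Y(t)>1\}\,\lambda_\delta(dt)$.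
   Formalization: The positivity claim fails when ε_δ(Y) exceeds x only by being infinite, so it is stated if P{S_0=∞}=0 or P{x<ε_δ(Y)<∞}>0; "continuous distribution" means a distribution function continuous on the real line, since an atom of ε_0(Y) at ∞ is possible. *)

theory Defs
  imports "HOL-Probability.Probability"
begin

section \<open>Generalised cadlag functions\<close>

text \<open>
  The quadrants at \<open>t\<close> are indexed by the set \<open>J\<close> of coordinates in which \<open>t\<close> is approached
  from the right; the \<open>2 ^ d\<close> quadrants partition the space, and \<open>t\<close> lies in the one for \<open>UNIV\<close>.
\<close>

definition quadrant :: "'d set \<Rightarrow> real ^ 'd \<Rightarrow> (real ^ 'd) set" where
  "quadrant J t = {s. \<forall>i. if i \<in> J then t $ i \<le> s $ i else s $ i < t $ i}"

definition gcadlag :: "(real ^ 'd::finite \<Rightarrow> real) set" where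
  "gcadlag = {f. (\<forall>t. 0 \<le> f t) \<and>
     (\<forall>t J. \<exists>l. (f \<longlongrightarrow> l) (at t within quadrant J t)) \<and>
     (\<forall>t. (f \<longlongrightarrow> f t) (at t within {s. \<forall>i. t $ i \<le> s $ i}))}"

abbreviation path_space :: "('t \<Rightarrow> 'b::topological_space) measure" where
  "path_space \<equiv> PiM UNIV (\<lambda>_. borel)"

text \<open>
  The space \<open>D\<close> with the \<open>\<sigma>\<close>-field generated by the projections, as the trace of the product
  \<open>\<sigma>\<close>-field.
\<close>

definition D_space :: "(real ^ 'd::finite \<Rightarrow> real) measure" where
  "D_space = restrict_space path_space gcadlag"


section \<open>Random fields\<close>

definition nonatomic :: "'w measure \<Rightarrow> bool" where
  "nonatomic M \<longleftrightarrow> (\<forall>A\<in>sets M. 0 < emeasure M A \<longrightarrow>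
     (\<exists>B\<in>sets M. B \<subseteq> A \<and> 0 < emeasure M B \<and> emeasure M B < emeasure M A))"

text \<open>
  The library constant \<open>indep_var\<close> requires both random elements to have the same type of
  values, hence this version.
\<close>

definition indep_elements ::
  "'w measure \<Rightarrow> 'b measure \<Rightarrow> ('w \<Rightarrow> 'b) \<Rightarrow> 'c measure \<Rightarrow> ('w \<Rightarrow> 'c) \<Rightarrow> bool" where
  "indep_elements M S X T Y \<longleftrightarrow> X \<in> measurable M S \<and> Y \<in> measurable M T \<and>
     prob_space.indep_set M {X -` A \<inter> space M | A. A \<in> sets S} {Y -` B \<inter> space M | B. B \<in> sets T}"

definition cadlag_field :: "'w measure \<Rightarrow> ('w \<Rightarrow> real ^ 'd::finite \<Rightarrow> real) \<Rightarrow> bool" where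
  "cadlag_field M Z \<longleftrightarrow> (\<forall>t. (\<lambda>\<omega>. Z \<omega> t) \<in> borel_measurable M) \<and> (AE \<omega> in M. Z \<omega> \<in> gcadlag)"

definition stationary_field ::
  "'w measure \<Rightarrow> ('w \<Rightarrow> real ^ 'd::finite \<Rightarrow> 'b::topological_space) \<Rightarrow> bool" where
  "stationary_field M X \<longleftrightarrow>
     (\<forall>h. distr M path_space (\<lambda>\<omega> t. X \<omega> (t + h)) = distr M path_space X)"

text \<open>
  The max-stable field with unit exponential waiting times \<open>V k\<close> and spectral copies \<open>Zs i\<close>.
  Indices start at \<open>0\<close>, so the \<open>i\<close>-th arrival time is the sum of \<open>V 0, \<dots>, V i\<close>. The values
  are taken in \<open>ennreal\<close>, where the maximum over all \<open>i\<close> is the supremum.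
\<close>

definition max_stable ::
  "(nat \<Rightarrow> 'w \<Rightarrow> real) \<Rightarrow> (nat \<Rightarrow> 'w \<Rightarrow> 't \<Rightarrow> real) \<Rightarrow> 'w \<Rightarrow> 't \<Rightarrow> ennreal" where
  "max_stable V Zs \<omega> t = (SUP i. ennreal (inverse (\<Sum>k\<le>i. V k \<omega>) * Zs i \<omega> t))"

definition spectral_sequence ::
  "'w measure \<Rightarrow> ('w \<Rightarrow> real ^ 'd::finite \<Rightarrow> real) \<Rightarrow>
   (nat \<Rightarrow> 'w \<Rightarrow> real) \<Rightarrow> (nat \<Rightarrow> 'w \<Rightarrow> real ^ 'd \<Rightarrow> real) \<Rightarrow> bool" where
  "spectral_sequence M Z V Zs \<longleftrightarrow>
     (\<forall>k. distributed M lborel (V k) (exponential_density 1)) \<and>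
     prob_space.indep_vars M (\<lambda>_. borel) V UNIV \<and>
     (\<forall>i. cadlag_field M (Zs i) \<and> distr M path_space (Zs i) = distr M path_space Z) \<and>
     prob_space.indep_vars M (\<lambda>_. path_space) Zs UNIV \<and>
     indep_elements M (PiM UNIV (\<lambda>_. borel)) (\<lambda>\<omega> k. V k \<omega>)
                      (PiM UNIV (\<lambda>_. path_space)) (\<lambda>\<omega> i. Zs i \<omega>)"


section \<open>Lattice measures, sojourns and the Berman function\<close>

definition grid :: "real \<Rightarrow> (real ^ 'd) set" where
  "grid \<delta> = {t. \<forall>i. \<exists>k::int. t $ i = \<delta> * of_int k}"

text \<open>Only \<open>\<delta> \<ge> 0\<close> is meant; for \<open>\<delta> > 0\<close> the measure lives on the lattice itself.\<close>

definition lam :: "real \<Rightarrow> (real ^ 'd::finite) measure" where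
  "lam \<delta> = (if \<delta> = 0 then lborel
            else scale_measure (ennreal (\<delta> ^ CARD('d))) (count_space (grid \<delta>)))"

definition field_integral :: "real \<Rightarrow> (real ^ 'd::finite \<Rightarrow> real) \<Rightarrow> ennreal" where
  "field_integral \<delta> f = (\<integral>\<^sup>+ t. ennreal (f t) \<partial>lam \<delta>)"

definition sojourn ::
  "real \<Rightarrow> (real ^ 'd::finite) set \<Rightarrow> (real ^ 'd \<Rightarrow> real) \<Rightarrow> real \<Rightarrow> ennreal" where
  "sojourn \<delta> A f s = (\<integral>\<^sup>+ t\<in>A. indicator {t. f t > s} t \<partial>lam \<delta>)"

abbreviation epsilon :: "real \<Rightarrow> (real ^ 'd::finite \<Rightarrow> real) \<Rightarrow> ennreal" where
  "epsilon \<delta> f \<equiv> sojourn \<delta> UNIV f 1"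

text \<open>\<open>cbox 0 (vec T)\<close> is the cube with edge \<open>[0, T]\<close>.\<close>

definition berman ::
  "'w measure \<Rightarrow> ('w \<Rightarrow> real ^ 'd::finite \<Rightarrow> real) \<Rightarrow> real \<Rightarrow> real \<Rightarrow> ennreal" where
  "berman M Z \<delta> x = Lim at_top (\<lambda>T::real. ennreal (1 / T ^ CARD('d)) *
     (\<integral>\<^sup>+ s\<in>{0..}. emeasure M {\<omega> \<in> space M. sojourn \<delta> (cbox 0 (vec T)) (Z \<omega>) s > ennreal x}
        \<partial>lborel))"


section \<open>Continuity of a distribution\<close>

text \<open>
  A random variable with values in \<open>[0, \<infinity>]\<close> has a continuous distribution if its distribution
  function is continuous on the real line. An atom at \<open>\<infinity>\<close> is not excluded: for \<open>Z\<close>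
  identically \<open>1\<close> on an event of positive probability, \<open>epsilon 0 Y\<close> has such an atom.
\<close>

definition continuous_distribution :: "'w measure \<Rightarrow> ('w \<Rightarrow> ennreal) \<Rightarrow> bool" where
  "continuous_distribution M W \<longleftrightarrow>
     continuous_on UNIV (\<lambda>u::real. measure M {\<omega> \<in> space M. enn2ereal (W \<omega>) \<le> ereal u})"

end

theory Submission
  imports Defs
begin

text \<open>
  Let \<open>Y\<close> be the tail field. For every site \<open>h\<close> and every functional \<open>H\<close>,
  \<open>E H(Y) = E (\<integral> s \<in> (0, Z h). H (Z (\<cdot> + h) / s) ds)\<close>; this is \<open>nn_integral_Y\<close>. In words: the
  exceedances of \<open>Z\<close> over a level \<open>s\<close> spread according to \<open>ds\<close>, seen from a point \<open>h\<close> at which the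
  level is exceeded, look like the exceedances of \<open>Y\<close> over 1. Everything else is drawn from this
  identity.

  Its source is stationarity of the max-stable field \<open>X\<close>. As \<open>n\<close> grows, \<open>n\<close> times the probability
  that \<open>max (x t * X t)\<close> exceeds \<open>n\<close> converges to \<open>E (max (x t * Z t))\<close>: the union bound over the
  points \<open>\<Gamma> i\<close> gives one inequality, the first point alone the other. Hence the expected maxima are
  invariant under shifts of \<open>Z\<close> (\<open>expectation_peak_shift_le\<close>). The derivative of such an
  expectation in the weight of one site \<open>h\<close> is the probability of a rectangle for
  \<open>Z (\<cdot> + h) / Z h\<close> under the density \<open>Z h\<close>, so this law is the same for all \<open>h\<close>
  (\<open>tilted_shift\<close>); for \<open>h = 0\<close> it is the law of \<open>\<Theta>\<close>. Since \<open>1 / R\<close> is uniform on \<open>(0, 1)\<close>, the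
  identity for \<open>Y\<close> follows.

  For continuity, take \<open>h = 0\<close>: the probability that \<open>epsilon 0 Y\<close> equals \<open>u\<close> is the mean length of
  the set of levels \<open>s < Z 0\<close> with volume of \<open>{Z > s}\<close> equal to \<open>u\<close>. A continuous path that
  lies above both of two levels somewhere, but above the lower one only on a set of finite volume,
  takes values between them on a nonempty open set, so that the volumes differ
  (\<open>exceedance_volume_strict\<close>). Hence there is at most one such \<open>s\<close>, and the length is zero.

  For the Berman function, let \<open>U\<close> be the sojourn above \<open>s\<close> in the box of edge \<open>T\<close>. On \<open>U > x\<close>
  write 1 as the integral over the box of \<open>indicator (Z t > s) / U\<close>. By the identity the integrated
  probability becomes the integral over \<open>t\<close> in the box of \<open>E (indicator (V > x) / V)\<close>, where \<open>V\<close> is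
  the exceedance volume of \<open>Y\<close> in the box shifted by \<open>- t\<close>. For most \<open>t\<close> that window is large, and
  the limit per unit volume is \<open>E (indicator (epsilon Y > x) / epsilon Y)\<close>, with \<open>1 / \<infinity> = 0\<close>. The
  windows near the boundary of the box are controlled by comparison with one cell, whose
  contribution is at most \<open>E (sup Z)\<close> over the cell (\<open>cell_bound_finite\<close>); this covers \<open>x = 0\<close> too.

  The limit is positive as soon as \<open>x < epsilon Y < \<infinity>\<close> has positive probability. If the Lebesgue
  integral of \<open>Z\<close> is finite, then so are the sums of \<open>Z\<close> along almost every translate of the
  lattice; since the law of \<open>\<Theta>\<close> can be computed from any translate, the sum of \<open>\<Theta>\<close> is finite
  (\<open>\<Theta>_summable\<close>), hence \<open>epsilon Y < \<infinity>\<close>.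
\<close>

section \<open>Paths in the space of generalised cadlag functions\<close>

lemma gcadlag_nonneg: "f \<in> gcadlag \<Longrightarrow> 0 \<le> f t"
  by (simp add: gcadlag_def)

lemma gcadlag_scale:
  assumes "f \<in> gcadlag" "0 \<le> c"
  shows "(\<lambda>t. c * f t) \<in> gcadlag"
  using assms unfolding gcadlag_def
  by (auto intro!: tendsto_mult_left) (metis tendsto_mult_left)

lemma filterlim_shift_within:
  fixes f :: "'a::real_normed_vector \<Rightarrow> real"
  assumes "(f \<longlongrightarrow> l) (at (t + h) within S)"
  shows "((\<lambda>s. f (s + h)) \<longlongrightarrow> l) (at t within {s. s + h \<in> S})"
  unfolding tendsto_def
proof (intro allI impI)
  fix A assume A: "open A" "l \<in> A"
  have "eventually (\<lambda>x. f x \<in> A) (at (t + h) within S)"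
    using assms A by (simp add: tendsto_def)
  then obtain d where d: "d > 0" "\<And>x. x \<in> S \<Longrightarrow> x \<noteq> t + h \<Longrightarrow> dist x (t + h) < d \<Longrightarrow> f x \<in> A"
    unfolding eventually_at by blast
  show "eventually (\<lambda>s. f (s + h) \<in> A) (at t within {s. s + h \<in> S})"
    unfolding eventually_at
    by (rule exI[of _ d]) (use d in auto)
qed

lemma gcadlag_shift:
  assumes "f \<in> gcadlag"
  shows "(\<lambda>t. f (t + h)) \<in> gcadlag"
proof -
  have q: "{s. s + h \<in> quadrant J (t + h)} = quadrant J t" for t :: "real^'a" and J
    unfolding quadrant_def by (intro Collect_cong all_cong1) simp_all
  have r: "{s. s + h \<in> {s. \<forall>i. (t + h) $ i \<le> s $ i}} = {s. \<forall>i. t $ i \<le> s $ i}" for t :: "real^'a"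
    by auto
  from assms show ?thesis
    unfolding gcadlag_def
  proof (safe, goal_cases)
    case (2 t J)
    then obtain l where "(f \<longlongrightarrow> l) (at (t + h) within quadrant J (t + h))" by blast
    from filterlim_shift_within[OF this] show ?case by (auto simp: q)
  next
    case (3 t)
    then have "(f \<longlongrightarrow> f (t + h)) (at (t + h) within {s. \<forall>i. (t + h) $ i \<le> s $ i})" by blast
    from filterlim_shift_within[OF this] show ?case by (simp only: r)
  qed auto
qed

lemma gcadlag_zero: "(\<lambda>_. 0) \<in> gcadlag"
  by (auto simp: gcadlag_def)

lemma space_path: "space (path_space :: ('t \<Rightarrow> 'b::topological_space) measure) = UNIV"
  by (simp add: space_PiM)

lemma space_D: "space D_space = gcadlag"
  by (simp add: D_space_def space_restrict_space space_path)

text \<open>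
  The points of the lattice of mesh \<open>1 / (n + 1)\<close> that are reached from \<open>t\<close> by rounding strictly
  upwards in each coordinate; there a cadlag path is continuous from the right.
\<close>

definition lattice_above :: "nat \<Rightarrow> int ^ 'd \<Rightarrow> real ^ 'd" where
  "lattice_above n k = (\<chi> i. (of_int (k $ i) + 1) / real (Suc n))"

lemma gcadlag_lattice_above:
  assumes "f \<in> gcadlag"
  shows "(\<lambda>n. f (lattice_above n (\<chi> i. \<lfloor>real (Suc n) * t $ i\<rfloor>))) \<longlonglongrightarrow> f t"
proof -
  let ?u = "\<lambda>n. lattice_above n (\<chi> i. \<lfloor>real (Suc n) * t $ i\<rfloor>)"
  have b: "t $ i < ?u n $ i" "?u n $ i \<le> t $ i + inverse (real (Suc n))" for n i
    proof -
    let ?y = "real (Suc n) * t $ i"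
    have *: "?y < of_int \<lfloor>?y\<rfloor> + 1" "of_int \<lfloor>?y\<rfloor> + 1 \<le> ?y + 1" by linarith+
    have "?y / real (Suc n) < (of_int \<lfloor>?y\<rfloor> + 1) / real (Suc n)"
      using *(1) by (rule divide_strict_right_mono) simp
    then show "t $ i < ?u n $ i" by (simp add: lattice_above_def del: of_nat_Suc)
    have "(of_int \<lfloor>?y\<rfloor> + 1) / real (Suc n) \<le> (?y + 1) / real (Suc n)"
      using *(2) by (rule divide_right_mono) simp
    then show "?u n $ i \<le> t $ i + inverse (real (Suc n))"
      by (simp add: lattice_above_def add_divide_distrib[of ?y] inverse_eq_divide del: of_nat_Suc)
  qed
  have "(\<lambda>n. ?u n $ i) \<longlonglongrightarrow> t $ i" for i
  proof (rule tendsto_sandwich[where f = "\<lambda>_. t $ i" and h = "\<lambda>n. t $ i + inverse (real (Suc n))"])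
    show "(\<lambda>n. t $ i + inverse (real (Suc n))) \<longlonglongrightarrow> t $ i"
      using tendsto_add[OF tendsto_const LIMSEQ_inverse_real_of_nat, of "t $ i"] by simp
    show "\<forall>\<^sub>F n in sequentially. t $ i \<le> ?u n $ i" using b(1) by (auto intro!: always_eventually less_imp_le)
    show "\<forall>\<^sub>F n in sequentially. ?u n $ i \<le> t $ i + inverse (real (Suc n))" using b(2) by (auto intro!: always_eventually)
  qed auto
  then have "?u \<longlonglongrightarrow> t" by (rule vec_tendstoI)
  moreover have "?u n \<noteq> t" for n using b(1)[of _ n] by (metis less_irrefl)
  moreover have "?u n \<in> {s. \<forall>i. t $ i \<le> s $ i}" for n using b(1)[of _ n] by (auto simp: less_imp_le)
  ultimately have "filterlim ?u (at t within {s. \<forall>i. t $ i \<le> s $ i}) sequentially"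
    unfolding filterlim_at by auto
  moreover have "(f \<longlongrightarrow> f t) (at t within {s. \<forall>i. t $ i \<le> s $ i})"
    using assms by (simp add: gcadlag_def)
  ultimately show ?thesis by (rule filterlim_compose[rotated])
qed

lemma measurable_eval_D: "(\<lambda>f. f t) \<in> borel_measurable D_space"
  unfolding D_space_def by (rule measurable_restrict_space1) simp

text \<open>
  Joint measurability makes volumes and integrals of a random path random variables. It holds
  because a path is the limit of its values at the countably many lattice points above.
\<close>

lemma measurable_eval_pair:
  "(\<lambda>(f, t). f t) \<in> borel_measurable (D_space \<Otimes>\<^sub>M (borel :: (real ^ 'd::finite) measure))"
proof (rule borel_measurable_LIMSEQ_real)
  fix p :: "(real ^ 'd \<Rightarrow> real) \<times> (real ^ 'd)"
  assume "p \<in> space (D_space \<Otimes>\<^sub>M borel)"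
  then have "fst p \<in> gcadlag" by (auto simp: space_pair_measure space_D)
  from gcadlag_lattice_above[OF this, of "snd p"]
  show "(\<lambda>n. case p of (f, t) \<Rightarrow> f (lattice_above n (\<chi> i. \<lfloor>real (Suc n) * t $ i\<rfloor>))) \<longlonglongrightarrow> (case p of (f, t) \<Rightarrow> f t)"
    by (simp add: case_prod_beta)
next
  fix n
  have [measurable]: "(\<lambda>p. snd p $ i) \<in> borel_measurable (D_space \<Otimes>\<^sub>M (borel :: (real ^ 'd) measure))" for i
    by (rule measurable_compose[OF measurable_snd borel_measurable_continuous_onI]) (intro continuous_intros)
  have g: "(\<lambda>p. \<chi> i. \<lfloor>real (Suc n) * (snd p $ i :: real)\<rfloor>) \<in> measurable (D_space \<Otimes>\<^sub>M (borel :: (real ^ 'd) measure)) (count_space UNIV)"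
  proof (subst measurable_count_space_eq2_countable, intro conjI ballI)
    fix k :: "int ^ 'd"
    have "(\<lambda>p. \<chi> i. \<lfloor>real (Suc n) * (snd p $ i :: real)\<rfloor>) -` {k} \<inter> space (D_space \<Otimes>\<^sub>M borel)
      = {p \<in> space (D_space \<Otimes>\<^sub>M borel). \<forall>i. \<lfloor>real (Suc n) * (snd p $ i :: real)\<rfloor> = k $ i}"
      by (auto simp: vec_eq_iff)
    also have "\<dots> \<in> sets (D_space \<Otimes>\<^sub>M borel)"
      by measurable
    finally show "(\<lambda>p. \<chi> i. \<lfloor>real (Suc n) * (snd p $ i :: real)\<rfloor>) -` {k} \<inter> space (D_space \<Otimes>\<^sub>M borel) \<in> sets (D_space \<Otimes>\<^sub>M borel)" .
  qed auto
  have "(\<lambda>p. fst p (lattice_above n (\<chi> i. \<lfloor>real (Suc n) * snd p $ i\<rfloor>)))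
     \<in> borel_measurable (D_space \<Otimes>\<^sub>M (borel :: (real ^ 'd) measure))"
    by (rule measurable_compose_countable[OF _ g]) (rule measurable_compose[OF measurable_fst measurable_eval_D])
  then show "(\<lambda>p. case p of (f, t) \<Rightarrow> f (lattice_above n (\<chi> i. \<lfloor>real (Suc n) * t $ i\<rfloor>)))
     \<in> borel_measurable (D_space \<Otimes>\<^sub>M (borel :: (real ^ 'd) measure))"
    by (simp add: case_prod_beta)
qed

lemma measurable_gcadlag: "f \<in> gcadlag \<Longrightarrow> f \<in> borel_measurable borel"
  using measurable_compose[OF measurable_Pair1' measurable_eval_pair, of f] by (simp add: space_D)

lemma measurable_into_D:
  assumes "\<And>\<omega>. \<omega> \<in> space N \<Longrightarrow> X \<omega> \<in> gcadlag" "\<And>t. (\<lambda>\<omega>. X \<omega> t) \<in> borel_measurable N"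
  shows "X \<in> measurable N D_space"
  unfolding D_space_def
  by (rule measurable_restrict_space2) (use assms in \<open>auto intro!: measurable_PiM_single'\<close>)

lemma measurable_shift_D [measurable]: "(\<lambda>f t. f (t + h)) \<in> measurable D_space D_space"
  by (rule measurable_into_D) (auto simp: space_D gcadlag_shift intro: measurable_eval_D)

lemma measurable_scale_D:
  "(\<lambda>p t. \<bar>fst p\<bar> * snd p t) \<in> measurable (borel \<Otimes>\<^sub>M D_space) D_space"
  by (rule measurable_into_D) (auto simp: space_pair_measure space_D gcadlag_scale
      intro!: borel_measurable_times borel_measurable_abs measurable_compose[OF measurable_snd measurable_eval_D])

section \<open>Tail of the max-stable field\<close>

context prob_space begin

lemma indep_elements_nn_integral:
  assumes "indep_elements M S X T Y" and h: "h \<in> borel_measurable (S \<Otimes>\<^sub>M T)"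
  shows "(\<integral>\<^sup>+\<omega>. h (X \<omega>, Y \<omega>) \<partial>M) = (\<integral>\<^sup>+\<omega>'. (\<integral>\<^sup>+\<omega>. h (X \<omega>, Y \<omega>') \<partial>M) \<partial>M)"
proof -
  from assms have X [measurable]: "X \<in> measurable M S" and Y [measurable]: "Y \<in> measurable M T"
    and ind: "indep_set {X -` A \<inter> space M | A. A \<in> sets S} {Y -` B \<inter> space M | B. B \<in> sets T}"
    by (auto simp: indep_elements_def)
  interpret X: prob_space "distr M S X" by (rule prob_space_distr) measurable
  interpret Y: prob_space "distr M T Y" by (rule prob_space_distr) measurable
  interpret XY: pair_sigma_finite "distr M S X" "distr M T Y" ..
  have eq: "distr M S X \<Otimes>\<^sub>M distr M T Y = distr M (S \<Otimes>\<^sub>M T) (\<lambda>\<omega>. (X \<omega>, Y \<omega>))"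
  proof (rule pair_measure_eqI)
    show "sets (distr M S X \<Otimes>\<^sub>M distr M T Y) = sets (distr M (S \<Otimes>\<^sub>M T) (\<lambda>\<omega>. (X \<omega>, Y \<omega>)))"
      by (simp cong: sets_pair_measure_cong)
    fix A B assume AB: "A \<in> sets (distr M S X)" "B \<in> sets (distr M T Y)"
    have "prob ((X -` A \<inter> space M) \<inter> (Y -` B \<inter> space M)) = prob (X -` A \<inter> space M) * prob (Y -` B \<inter> space M)"
      by (rule indep_setD[OF ind]) (use AB in auto)
    then have "emeasure M (X -` A \<inter> space M) * emeasure M (Y -` B \<inter> space M)
        = emeasure M ((X -` A \<inter> space M) \<inter> (Y -` B \<inter> space M))"
      by (simp add: emeasure_eq_measure ennreal_mult[symmetric])
    also have "(X -` A \<inter> space M) \<inter> (Y -` B \<inter> space M) = (\<lambda>\<omega>. (X \<omega>, Y \<omega>)) -` (A \<times> B) \<inter> space M"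
      by auto
    finally show "emeasure (distr M S X) A * emeasure (distr M T Y) B
        = emeasure (distr M (S \<Otimes>\<^sub>M T) (\<lambda>\<omega>. (X \<omega>, Y \<omega>))) (A \<times> B)"
      using AB by (simp add: emeasure_distr)
  qed (rule X.sigma_finite_measure_axioms Y.sigma_finite_measure_axioms)+
  have h' [measurable]: "h \<in> borel_measurable (distr M S X \<Otimes>\<^sub>M distr M T Y)"
    using h by (simp cong: measurable_cong_sets sets_pair_measure_cong)
  have "(\<integral>\<^sup>+\<omega>. h (X \<omega>, Y \<omega>) \<partial>M) = (\<integral>\<^sup>+p. h p \<partial>(distr M S X \<Otimes>\<^sub>M distr M T Y))"
    unfolding eq using h by (simp add: nn_integral_distr)
  also have "\<dots> = (\<integral>\<^sup>+y. (\<integral>\<^sup>+x. h (x, y) \<partial>distr M S X) \<partial>distr M T Y)"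
    by (rule XY.nn_integral_snd[symmetric]) measurable
  also have "\<dots> = (\<integral>\<^sup>+\<omega>'. (\<integral>\<^sup>+x. h (x, Y \<omega>') \<partial>distr M S X) \<partial>M)"
    by (rule nn_integral_distr) (auto intro!: X.borel_measurable_nn_integral simp: h' split_beta' cong: measurable_cong_sets)
  also have "\<dots> = (\<integral>\<^sup>+\<omega>'. (\<integral>\<^sup>+\<omega>. h (X \<omega>, Y \<omega>') \<partial>M) \<partial>M)"
    using h by (intro nn_integral_cong nn_integral_distr X measurable_compose[OF _ h] measurable_Pair2')
       (auto intro: measurable_space[OF Y])
  finally show ?thesis .
qed

end

text \<open>
  The layer formula for an extended number; the two indicators make \<open>v\<close> range over \<open>[0, y)\<close>.
\<close>

lemma nn_integral_layer:
  "(\<integral>\<^sup>+v. indicator {0..} v * indicator {v. ennreal v < y} v \<partial>lborel) = y"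
proof (cases y)
  case (real r)
  then have "(\<integral>\<^sup>+v. indicator {0..} v * indicator {v. ennreal v < y} v \<partial>lborel) = (\<integral>\<^sup>+v. indicator {0..<r} v \<partial>lborel)"
    by (intro nn_integral_cong) (auto simp: indicator_def ennreal_less_iff)
  also have "\<dots> = y" using real by simp
  finally show ?thesis .
next
  case top
  then have "(\<integral>\<^sup>+v. indicator {0..} v * indicator {v. ennreal v < y} v \<partial>lborel) = (\<integral>\<^sup>+v. indicator {0::real..} v \<partial>lborel)"
    by (intro nn_integral_cong) (auto simp: indicator_def)
  also have "\<dots> = emeasure lborel {0::real..}" by simp
  also have "\<dots> = \<infinity>"
  proof (rule ccontr)
    assume "emeasure lborel {0::real..} \<noteq> \<infinity>"
    then obtain r where r: "emeasure lborel {0::real..} = ennreal r" "0 \<le> r"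
      by (cases "emeasure lborel {0::real..}") auto
    have "emeasure lborel {0..r + 1} \<le> emeasure lborel {0::real..}"
      by (rule emeasure_mono) auto
    with r show False by (simp add: ennreal_le_iff)
  qed
  finally show ?thesis using top by simp
qed

text \<open>
  The arrival times of a unit Poisson process have intensity one: the Erlang densities are the
  Poisson weights.
\<close>

lemma suminf_erlang_density:
  assumes "0 \<le> v" shows "(\<Sum>i. ennreal (erlang_density i 1 v)) = 1"
proof -
  have "(\<lambda>i. v ^ i /\<^sub>R fact i * exp (- v)) sums (exp v * exp (- v))"
    by (intro sums_mult2 exp_converges)
  then have "(\<lambda>i. erlang_density i 1 v) sums 1"
    using assms by (simp add: erlang_density_def exp_minus field_simps)
  then have "(\<Sum>i. ennreal (erlang_density i 1 v)) = ennreal 1"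
    by (rule suminf_ennreal_eq[rotated]) (rule erlang_density_nonneg[OF zero_le_one])
  then show ?thesis by (simp only: ennreal_1)
qed

text \<open>
  The weighted maximum of a path over finitely many sites, indexed by an arbitrary type so that a
  site may carry several weights.
\<close>

definition peak :: "'i set \<Rightarrow> ('i \<Rightarrow> real) \<Rightarrow> ('i \<Rightarrow> 't) \<Rightarrow> ('t \<Rightarrow> real) \<Rightarrow> ennreal" where
  "peak F x \<tau> f = (SUP t\<in>F. ennreal (x t * f (\<tau> t)))"

lemma measurable_peak:
  "finite F \<Longrightarrow> (\<And>t. t \<in> F \<Longrightarrow> (\<lambda>\<omega>. Z \<omega> (\<tau> t)) \<in> borel_measurable N) \<Longrightarrow> (\<lambda>\<omega>. peak F x \<tau> (Z \<omega>)) \<in> borel_measurable N"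
  unfolding peak_def by (intro borel_measurable_SUP countable_finite) measurable

lemma measurable_random_path:
  "(\<And>t. (\<lambda>\<omega>. Z \<omega> t) \<in> borel_measurable N) \<Longrightarrow> Z \<in> measurable N path_space"
  by (rule measurable_PiM_single') auto

context prob_space begin

text \<open>
  The contribution of the \<open>i\<close>-th point. The variable \<open>v\<close> stands for \<open>n\<close> times the arrival time, so
  that only the density, not the event, depends on \<open>n\<close>.
\<close>

lemma max_stable_arrival:
  assumes Z: "cadlag_field M Z" and S: "spectral_sequence M Z V Zs"
    and F: "finite F" and n: "0 < n"
  shows "ennreal n * emeasure M {\<omega> \<in> space M. ennreal (n * (\<Sum>k\<le>i. V k \<omega>)) < peak F x \<tau> (Zs i \<omega>)}
    = (\<integral>\<^sup>+\<omega>. (\<integral>\<^sup>+v. ennreal (erlang_density i 1 (v / n)) * indicator {v. ennreal v < peak F x \<tau> (Z \<omega>)} v \<partial>lborel) \<partial>M)"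
    (is "_ * emeasure M ?A = _")
proof -
  from S have V: "\<And>k. distributed M lborel (V k) (exponential_density 1)"
    and iV: "indep_vars (\<lambda>_. borel) V UNIV"
    and Zs: "\<And>i. cadlag_field M (Zs i)" "\<And>i. distr M path_space (Zs i) = distr M path_space Z"
    and ind: "indep_elements M (PiM UNIV (\<lambda>_. borel)) (\<lambda>\<omega> k. V k \<omega>)
                      (PiM UNIV (\<lambda>_. path_space)) (\<lambda>\<omega> i. Zs i \<omega>)"
    by (auto simp: spectral_sequence_def)
  have [measurable]: "V k \<in> borel_measurable M" for k
    using distributed_measurable[OF V[of k]] by simp
  have Zsm [measurable]: "Zs i \<in> measurable M path_space" for i
    using Zs(1) by (intro measurable_random_path) (auto simp: cadlag_field_def)
  have Zm [measurable]: "Z \<in> measurable M path_space"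
    using Z by (intro measurable_random_path) (auto simp: cadlag_field_def)
  have pk [measurable]: "peak F x \<tau> \<in> borel_measurable path_space"
    using F by (intro measurable_peak) auto
  let ?G = "\<lambda>\<omega>. \<Sum>k\<le>i. V k \<omega>"
  have "distributed M lborel ?G (erlang_density (card {..i} - 1) 1)"
    by (rule exponential_distributed_sum) (auto intro: V indep_vars_subset[OF iV])
  then have G: "distributed M lborel ?G (erlang_density i 1)" by simp
  have "emeasure M ?A = (\<integral>\<^sup>+\<omega>. indicator ?A \<omega> \<partial>M)"
    by (rule nn_integral_indicator[symmetric]) measurable
  also have "\<dots> = (\<integral>\<^sup>+\<omega>. indicator {v. ennreal (n * ?G \<omega>) < v} (peak F x \<tau> (Zs i \<omega>)) \<partial>M)"
    by (auto intro!: nn_integral_cong simp: indicator_def)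
  also have "\<dots> = (\<integral>\<^sup>+\<omega>. (case (\<lambda>k. V k \<omega>, \<lambda>i. Zs i \<omega>) of (v, z) \<Rightarrow> indicator {u. ennreal (n * (\<Sum>k\<le>i. v k)) < u} (peak F x \<tau> (z i))) \<partial>M)"
    by simp
  also have "\<dots> = (\<integral>\<^sup>+\<omega>'. (\<integral>\<^sup>+\<omega>. (case (\<lambda>k. V k \<omega>, \<lambda>i. Zs i \<omega>') of (v, z) \<Rightarrow> indicator {u. ennreal (n * (\<Sum>k\<le>i. v k)) < u} (peak F x \<tau> (z i))) \<partial>M) \<partial>M)"
  proof (rule indep_elements_nn_integral[OF ind])
    show "(\<lambda>(v, z). indicator {u. ennreal (n * (\<Sum>k\<le>i. v k)) < u} (peak F x \<tau> (z i)) :: ennreal)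
       \<in> borel_measurable (Pi\<^sub>M UNIV (\<lambda>_. borel) \<Otimes>\<^sub>M Pi\<^sub>M UNIV (\<lambda>_. path_space))"
      unfolding indicator_def by measurable
  qed
  also have "\<dots> = (\<integral>\<^sup>+\<omega>'. (\<integral>\<^sup>+\<omega>. indicator {v. ennreal (n * v) < peak F x \<tau> (Zs i \<omega>')} (?G \<omega>) \<partial>M) \<partial>M)"
    by (simp add: indicator_def)
  also have "\<dots> = (\<integral>\<^sup>+\<omega>'. (\<integral>\<^sup>+v. ennreal (erlang_density i 1 v) * indicator {v. ennreal (n * v) < peak F x \<tau> (Zs i \<omega>')} v \<partial>lborel) \<partial>M)"
    by (intro nn_integral_cong distributed_nn_integral[OF G, symmetric]) measurable
  also have "\<dots> = (\<integral>\<^sup>+f. (\<integral>\<^sup>+v. ennreal (erlang_density i 1 v) * indicator {v. ennreal (n * v) < peak F x \<tau> f} v \<partial>lborel) \<partial>distr M path_space (Zs i))"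
    by (subst nn_integral_distr) (auto simp: indicator_def)
  also have "\<dots> = (\<integral>\<^sup>+\<omega>. (\<integral>\<^sup>+v. ennreal (erlang_density i 1 v) * indicator {v. ennreal (n * v) < peak F x \<tau> (Z \<omega>)} v \<partial>lborel) \<partial>M)"
    unfolding Zs(2) by (subst nn_integral_distr) (auto simp: indicator_def)
  also have "ennreal n * \<dots> = (\<integral>\<^sup>+\<omega>. ennreal n * (\<integral>\<^sup>+v. ennreal (erlang_density i 1 v) * indicator {v. ennreal (n * v) < peak F x \<tau> (Z \<omega>)} v \<partial>lborel) \<partial>M)"
    by (subst nn_integral_cmult) (auto simp: indicator_def)
  also have "\<dots> = (\<integral>\<^sup>+\<omega>. (\<integral>\<^sup>+v. ennreal (erlang_density i 1 (v / n)) * indicator {v. ennreal v < peak F x \<tau> (Z \<omega>)} v \<partial>lborel) \<partial>M)"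
    using n by (subst (2) nn_integral_real_affine[where c = n and t = 0]) (auto simp: indicator_def)
  finally show ?thesis .
qed

text \<open>
  The upper bound is the union bound over all points; the densities of the arrival times add up to
  one, which leaves the layer formula for the peak of \<open>Z\<close>. The lower bound keeps the first point
  only and is asymptotically sharp, since its density tends to one as \<open>n\<close> grows.
\<close>

lemma max_stable_tail:
  fixes Z :: "'a \<Rightarrow> real ^ 'd::finite \<Rightarrow> real" and \<tau> :: "'i \<Rightarrow> real ^ 'd" and x :: "'i \<Rightarrow> real"
  assumes Z: "cadlag_field M Z" and S: "spectral_sequence M Z V Zs"
    and F: "finite F" and x: "\<And>t. 0 \<le> x t" and n: "0 < n"
  defines "A \<equiv> {\<omega> \<in> space M. \<exists>t\<in>F. ennreal n < ennreal (x t) * max_stable V Zs \<omega> (\<tau> t)}"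
  shows "ennreal n * emeasure M A \<le> (\<integral>\<^sup>+\<omega>. peak F x \<tau> (Z \<omega>) \<partial>M)"
    and "(\<integral>\<^sup>+\<omega>. (\<integral>\<^sup>+v. ennreal (exponential_density 1 (v / n)) * indicator {v. ennreal v < peak F x \<tau> (Z \<omega>)} v \<partial>lborel) \<partial>M)
      \<le> ennreal n * emeasure M A"
proof -
  from S have V: "\<And>k. distributed M lborel (V k) (exponential_density 1)"
    and iV: "indep_vars (\<lambda>_. borel) V UNIV"
    and Zs: "\<And>i. cadlag_field M (Zs i)"
    by (auto simp: spectral_sequence_def)
  have [measurable]: "V k \<in> borel_measurable M" for k
    using distributed_measurable[OF V[of k]] by simp
  have Zsm [measurable]: "Zs i \<in> measurable M path_space" for i
    using Zs(1) by (intro measurable_random_path) (auto simp: cadlag_field_def)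
  have Zst [measurable]: "(\<lambda>\<omega>. Zs i \<omega> t) \<in> borel_measurable M" for i t
    using Zs(1) by (auto simp: cadlag_field_def)
  have Zm [measurable]: "Z \<in> measurable M path_space"
    using Z by (intro measurable_random_path) (auto simp: cadlag_field_def)
  have pk [measurable]: "peak F x \<tau> \<in> borel_measurable path_space"
    using F by (intro measurable_peak) auto
  have Xm [measurable]: "(\<lambda>\<omega>. max_stable V Zs \<omega> t) \<in> borel_measurable M" for t
    unfolding max_stable_def by measurable
  have Am [measurable]: "A \<in> sets M" unfolding A_def using F by measurable
  define B where "B i = {\<omega> \<in> space M. ennreal (n * (\<Sum>k\<le>i. V k \<omega>)) < peak F x \<tau> (Zs i \<omega>)}" for i
  have Bm [measurable]: "B i \<in> sets M" for i unfolding B_def by measurable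
  have "AE \<omega> in M. 0 < V k \<omega>" for k
  proof (rule AE_I[where N = "{\<omega> \<in> space M. V k \<omega> \<le> 0}"])
    have "measure M {\<omega> \<in> space M. V k \<omega> \<le> 0} = 0"
      using erlang_distributed_le[OF V[of k], of 0] by (simp add: erlang_CDF_at0)
    then show "emeasure M {\<omega> \<in> space M. V k \<omega> \<le> 0} = 0" by (simp add: emeasure_eq_measure)
  qed (auto simp: not_less)
  then have "AE \<omega> in M. \<forall>k. 0 < V k \<omega>" by (subst AE_all_countable) blast
  then have AB: "AE \<omega> in M. \<omega> \<in> A \<longleftrightarrow> \<omega> \<in> (\<Union>i. B i)"
  proof (eventually_elim)
    case (elim \<omega>)
    then have G: "0 < (\<Sum>k\<le>i. V k \<omega>)" for i by (intro sum_pos) auto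
    have "ennreal n < ennreal (x t) * max_stable V Zs \<omega> (\<tau> t) \<longleftrightarrow>
      (\<exists>i. ennreal (n * (\<Sum>k\<le>i. V k \<omega>)) < ennreal (x t * Zs i \<omega> (\<tau> t)))" for t
    proof -
      have "ennreal (x t) * max_stable V Zs \<omega> (\<tau> t) = (SUP i. ennreal (x t * (inverse (\<Sum>k\<le>i. V k \<omega>) * Zs i \<omega> (\<tau> t))))"
        unfolding max_stable_def using x[of t] by (simp add: SUP_mult_left_ennreal ennreal_mult')
      then have "ennreal n < ennreal (x t) * max_stable V Zs \<omega> (\<tau> t) \<longleftrightarrow>
        (\<exists>i. ennreal n < ennreal (x t * (inverse (\<Sum>k\<le>i. V k \<omega>) * Zs i \<omega> (\<tau> t))))"
        by (simp add: less_SUP_iff)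
      also have "\<dots> \<longleftrightarrow> (\<exists>i. ennreal (n * (\<Sum>k\<le>i. V k \<omega>)) < ennreal (x t * Zs i \<omega> (\<tau> t)))"
        using n G by (simp add: ennreal_less_iff less_imp_le field_simps)
      finally show ?thesis .
    qed
    then show ?case unfolding A_def B_def peak_def by (auto simp: less_SUP_iff)
  qed
  have eq: "emeasure M A = emeasure M (\<Union>i. B i)"
    by (rule emeasure_eq_AE[OF AB]) measurable
  have "ennreal n * emeasure M A \<le> ennreal n * (\<Sum>i. emeasure M (B i))"
    unfolding eq by (intro mult_left_mono emeasure_subadditive_countably) auto
  also have "\<dots> = (\<Sum>i. ennreal n * emeasure M (B i))" by (rule ennreal_suminf_cmult[symmetric])
  also have "\<dots> = (\<Sum>i. \<integral>\<^sup>+\<omega>. (\<integral>\<^sup>+v. ennreal (erlang_density i 1 (v / n)) * indicator {v. ennreal v < peak F x \<tau> (Z \<omega>)} v \<partial>lborel) \<partial>M)"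
    unfolding B_def by (intro suminf_cong max_stable_arrival[OF Z S F n])
  also have "\<dots> = (\<integral>\<^sup>+\<omega>. (\<integral>\<^sup>+v. (\<Sum>i. ennreal (erlang_density i 1 (v / n)) * indicator {v. ennreal v < peak F x \<tau> (Z \<omega>)} v) \<partial>lborel) \<partial>M)"
  proof (subst nn_integral_suminf[symmetric])
    have m: "(\<lambda>v. ennreal (erlang_density i 1 (v / n)) * indicator {v. ennreal v < y} v) \<in> borel_measurable lborel" for i y
      unfolding indicator_def by measurable
    show "(\<integral>\<^sup>+\<omega>. (\<Sum>i. \<integral>\<^sup>+v. ennreal (erlang_density i 1 (v / n)) * indicator {v. ennreal v < peak F x \<tau> (Z \<omega>)} v \<partial>lborel) \<partial>M)
      = (\<integral>\<^sup>+\<omega>. (\<integral>\<^sup>+v. (\<Sum>i. ennreal (erlang_density i 1 (v / n)) * indicator {v. ennreal v < peak F x \<tau> (Z \<omega>)} v) \<partial>lborel) \<partial>M)"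
      by (intro nn_integral_cong nn_integral_suminf[symmetric] m)
  qed (simp add: indicator_def)
  also have "\<dots> = (\<integral>\<^sup>+\<omega>. (\<integral>\<^sup>+v. indicator {0..} v * indicator {v. ennreal v < peak F x \<tau> (Z \<omega>)} v \<partial>lborel) \<partial>M)"
  proof (intro nn_integral_cong)
    fix \<omega> v
    show "(\<Sum>i. ennreal (erlang_density i 1 (v / n)) * indicator {v. ennreal v < peak F x \<tau> (Z \<omega>)} v) = indicator {0..} v * indicator {v. ennreal v < peak F x \<tau> (Z \<omega>)} v"
    proof (cases "0 \<le> v")
      case True
      with n have "0 \<le> v / n" by simp
      then show ?thesis unfolding ennreal_suminf_multc using True by (subst suminf_erlang_density) simp_all
    next
      case False with n show ?thesis by (simp add: erlang_density_def divide_less_0_iff)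
    qed
  qed
  also have "\<dots> = (\<integral>\<^sup>+\<omega>. peak F x \<tau> (Z \<omega>) \<partial>M)" by (simp add: nn_integral_layer)
  finally show "ennreal n * emeasure M A \<le> (\<integral>\<^sup>+\<omega>. peak F x \<tau> (Z \<omega>) \<partial>M)" .
  have "emeasure M (B 0) \<le> emeasure M A" unfolding eq by (rule emeasure_mono) auto
  then show "(\<integral>\<^sup>+\<omega>. (\<integral>\<^sup>+v. ennreal (exponential_density 1 (v / n)) * indicator {v. ennreal v < peak F x \<tau> (Z \<omega>)} v \<partial>lborel) \<partial>M)
      \<le> ennreal n * emeasure M A"
    unfolding max_stable_arrival[OF Z S F n, of 0, symmetric] B_def by (rule mult_left_mono) auto
qed

text \<open>
  Both bounds of \<open>max_stable_tail\<close> concern the same tail probability, up to a shift that leaves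
  the law of the max-stable field unchanged. Monotone convergence in \<open>n\<close> turns the lower bound
  into the full expectation. Exchanging \<open>h\<close> and \<open>h'\<close> gives equality.
\<close>

lemma expectation_peak_shift_le:
  fixes Z :: "'a \<Rightarrow> real ^ 'd::finite \<Rightarrow> real" and \<tau> :: "'i \<Rightarrow> real ^ 'd"
  assumes Z: "cadlag_field M Z" and S: "spectral_sequence M Z V Zs"
    and stat: "stationary_field M (max_stable V Zs)"
    and F: "finite F" and x: "\<And>t. 0 \<le> x t"
  shows "(\<integral>\<^sup>+\<omega>. peak F x (\<lambda>t. \<tau> t + h) (Z \<omega>) \<partial>M) \<le> (\<integral>\<^sup>+\<omega>. peak F x (\<lambda>t. \<tau> t + h') (Z \<omega>) \<partial>M)"
proof -
  have Zm [measurable]: "Z \<in> measurable M path_space"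
    using Z by (intro measurable_random_path) (auto simp: cadlag_field_def)
  have pk [measurable]: "peak F x \<tau> \<in> borel_measurable path_space" for \<tau>
    using F by (intro measurable_peak) auto
  from S have V: "\<And>k. distributed M lborel (V k) (exponential_density 1)"
    and Zs: "\<And>i. cadlag_field M (Zs i)"
    by (auto simp: spectral_sequence_def)
  have [measurable]: "V k \<in> borel_measurable M" for k
    using distributed_measurable[OF V[of k]] by simp
  have Zst [measurable]: "(\<lambda>\<omega>. Zs i \<omega> t) \<in> borel_measurable M" for i t
    using Zs(1) by (auto simp: cadlag_field_def)
  have Xm [measurable]: "(\<lambda>\<omega>. max_stable V Zs \<omega> t) \<in> borel_measurable M" for t
    unfolding max_stable_def by measurable
  have Xp [measurable]: "(\<lambda>\<omega> t. max_stable V Zs \<omega> (t + h)) \<in> measurable M path_space" for h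
    by (rule measurable_PiM_single') auto
  let ?A = "\<lambda>h n. {\<omega> \<in> space M. \<exists>t\<in>F. ennreal n < ennreal (x t) * max_stable V Zs \<omega> (\<tau> t + h)}"
  have A: "emeasure M (?A h n) = emeasure (distr M path_space (max_stable V Zs)) {g \<in> space path_space. \<exists>t\<in>F. ennreal n < ennreal (x t) * g (\<tau> t)}" for h n
  proof -
    define C where "C = {g \<in> space path_space. \<exists>t\<in>F. ennreal n < ennreal (x t) * g (\<tau> t)}"
    have C [measurable]: "C \<in> sets path_space"
    proof -
      have "{g \<in> space path_space. ennreal n < ennreal (x t) * g (\<tau> t)} \<in> sets path_space" for t
        by measurable
      then have "(\<Union>t\<in>F. {g \<in> space path_space. ennreal n < ennreal (x t) * g (\<tau> t)}) \<in> sets path_space"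
        using F by (intro sets.finite_UN) auto
      moreover have "(\<Union>t\<in>F. {g \<in> space path_space. ennreal n < ennreal (x t) * g (\<tau> t)})
          = {g \<in> space path_space. \<exists>t\<in>F. ennreal n < ennreal (x t) * g (\<tau> t)}" by auto
      ultimately show ?thesis by (simp add: C_def)
    qed
    have "emeasure (distr M path_space (\<lambda>\<omega> t. max_stable V Zs \<omega> (t + h))) C
        = emeasure M ((\<lambda>\<omega> t. max_stable V Zs \<omega> (t + h)) -` C \<inter> space M)"
      by (rule emeasure_distr) measurable
    also have "(\<lambda>\<omega> t. max_stable V Zs \<omega> (t + h)) -` C \<inter> space M = ?A h n"
      by (auto simp: C_def space_path)
    finally show ?thesis using stat unfolding stationary_field_def C_def by metis
  qed
  let ?e = "\<lambda>n \<omega> v. ennreal (exponential_density 1 (v / real (Suc n))) * indicator {v. ennreal v < peak F x (\<lambda>t. \<tau> t + h) (Z \<omega>)} v"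
  have le: "(\<integral>\<^sup>+\<omega>. (\<integral>\<^sup>+v. ?e n \<omega> v \<partial>lborel) \<partial>M) \<le> (\<integral>\<^sup>+\<omega>. peak F x (\<lambda>t. \<tau> t + h') (Z \<omega>) \<partial>M)" for n
    using max_stable_tail(2)[where x = x, OF Z S F x, where n = "real (Suc n)" and \<tau> = "\<lambda>t. \<tau> t + h"]
      max_stable_tail(1)[where x = x, OF Z S F x, where n = "real (Suc n)" and \<tau> = "\<lambda>t. \<tau> t + h'"]
    unfolding A by (meson of_nat_0_less_iff order_trans zero_less_Suc)
  have inc: "incseq (\<lambda>n. ?e n \<omega> v)" for \<omega> v
    by (auto simp: incseq_def exponential_density_def divide_less_0_iff frac_le intro!: mult_right_mono ennreal_leI)
  have sup: "(SUP n. ?e n \<omega> v) = indicator {0..} v * indicator {v. ennreal v < peak F x (\<lambda>t. \<tau> t + h) (Z \<omega>)} v" for \<omega> v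
  proof (rule LIMSEQ_unique[OF LIMSEQ_SUP[OF inc]])
    have "(\<lambda>n. exp (- (v / real (Suc n)))) \<longlonglongrightarrow> exp (- 0)"
      by (intro tendsto_exp tendsto_minus LIMSEQ_Suc lim_const_over_n)
    then have "(\<lambda>n. exponential_density 1 (v / real (Suc n))) \<longlonglongrightarrow> indicator {0..} v"
      by (simp add: exponential_density_def divide_less_0_iff indicator_def not_less)
    then have "(\<lambda>n. ennreal (exponential_density 1 (v / real (Suc n)))) \<longlonglongrightarrow> ennreal (indicator {0..} v)"
      by (rule tendsto_ennrealI)
    then show "(\<lambda>n. ?e n \<omega> v) \<longlonglongrightarrow> indicator {0..} v * indicator {v. ennreal v < peak F x (\<lambda>t. \<tau> t + h) (Z \<omega>)} v"
      by (cases "ennreal v < peak F x (\<lambda>t. \<tau> t + h) (Z \<omega>)") (simp_all add: ennreal_indicator)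
  qed
  have "(\<integral>\<^sup>+\<omega>. peak F x (\<lambda>t. \<tau> t + h) (Z \<omega>) \<partial>M) = (\<integral>\<^sup>+\<omega>. (\<integral>\<^sup>+v. (SUP n. ?e n \<omega> v) \<partial>lborel) \<partial>M)"
    unfolding sup by (simp add: nn_integral_layer)
  also have "\<dots> = (\<integral>\<^sup>+\<omega>. (SUP n. \<integral>\<^sup>+v. ?e n \<omega> v \<partial>lborel) \<partial>M)"
    using inc by (intro nn_integral_cong nn_integral_monotone_convergence_SUP) (auto simp: incseq_def le_fun_def indicator_def)
  also have "\<dots> = (SUP n. \<integral>\<^sup>+\<omega>. (\<integral>\<^sup>+v. ?e n \<omega> v \<partial>lborel) \<partial>M)"
    using inc by (intro nn_integral_monotone_convergence_SUP) (auto simp: incseq_def le_fun_def indicator_def intro!: nn_integral_mono)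
  also have "\<dots> \<le> (\<integral>\<^sup>+\<omega>. peak F x (\<lambda>t. \<tau> t + h') (Z \<omega>) \<partial>M)"
    by (rule SUP_least) (rule le)
  finally show ?thesis .
qed

end

section \<open>Spectral tilting\<close>

text \<open>
  The right derivative of \<open>c \<mapsto> max (c * a) m\<close> at \<open>c = 1\<close>.
\<close>

lemma max_slope_tendsto:
  assumes "0 \<le> a" "m < top"
  shows "(\<lambda>n. ennreal (real (Suc n)) * (max (ennreal ((1 + 1 / real (Suc n)) * a)) m - max (ennreal a) m))
     \<longlonglongrightarrow> ennreal a * indicator {..ennreal a} m"
proof (cases "m \<le> ennreal a")
  case True
  have "ennreal (real (Suc n)) * (max (ennreal ((1 + 1 / real (Suc n)) * a)) m - max (ennreal a) m) = ennreal a" for n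
  proof -
    have "ennreal a \<le> ennreal ((1 + 1 / real (Suc n)) * a)"
      using assms(1) by (intro ennreal_leI) (simp add: distrib_right)
    then have "max (ennreal ((1 + 1 / real (Suc n)) * a)) m - max (ennreal a) m
        = ennreal ((1 + 1 / real (Suc n)) * a) - ennreal a"
      by (simp only: max_absorb1[OF True] max_absorb1[OF order_trans[OF True]])
    also have "\<dots> = ennreal (a / real (Suc n))"
      using assms(1) by (simp add: ennreal_minus distrib_right)
    finally show ?thesis using assms(1) by (simp add: ennreal_mult[symmetric] del: of_nat_Suc)
  qed
  then show ?thesis using True by simp
next
  case False
  obtain r where r: "m = ennreal r" "0 \<le> r" using assms(2) by (cases m) auto
  have "(\<lambda>n. (1 + 1 / real (Suc n)) * a) \<longlonglongrightarrow> (1 + 0) * a"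
    by (intro tendsto_intros LIMSEQ_Suc lim_const_over_n)
  moreover have "a < r" using False r by (auto simp: not_le ennreal_less_iff assms)
  ultimately have "\<forall>\<^sub>F n in sequentially. (1 + 1 / real (Suc n)) * a < r"
    by (intro order_tendstoD(2)) auto
  then have "\<forall>\<^sub>F n in sequentially. ennreal (real (Suc n)) * (max (ennreal ((1 + 1 / real (Suc n)) * a)) m - max (ennreal a) m) = 0"
  proof eventually_elim
    case (elim n)
    have "max (ennreal ((1 + 1 / real (Suc n)) * a)) m = m" "max (ennreal a) m = m"
      using elim \<open>a < r\<close> r by (auto intro!: max_absorb2 ennreal_leI)
    then show ?case using r by simp
  qed
  then have "(\<lambda>n. ennreal (real (Suc n)) * (max (ennreal ((1 + 1 / real (Suc n)) * a)) m - max (ennreal a) m)) \<longlonglongrightarrow> 0"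
    by (rule tendsto_eventually)
  then show ?thesis using False by simp
qed

lemma max_slope_le:
  assumes "0 \<le> a" "m < top"
  shows "ennreal (real (Suc n)) * (max (ennreal ((1 + 1 / real (Suc n)) * a)) m - max (ennreal a) m) \<le> ennreal a"
proof -
  have "max (ennreal ((1 + 1 / real (Suc n)) * a)) m \<le> ennreal (a / real (Suc n)) + max (ennreal a) m"
  proof (rule max.boundedI)
    have "ennreal ((1 + 1 / real (Suc n)) * a) = ennreal (a / real (Suc n)) + ennreal a"
      using assms by (simp add: ennreal_plus[symmetric] distrib_right del: ennreal_plus)
    also have "\<dots> \<le> ennreal (a / real (Suc n)) + max (ennreal a) m" by (intro add_left_mono) simp
    finally show "ennreal ((1 + 1 / real (Suc n)) * a) \<le> ennreal (a / real (Suc n)) + max (ennreal a) m" .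
    show "m \<le> ennreal (a / real (Suc n)) + max (ennreal a) m" by (simp add: add_increasing)
  qed
  then have "max (ennreal ((1 + 1 / real (Suc n)) * a)) m - max (ennreal a) m \<le> ennreal (a / real (Suc n))"
    using assms(2) by (auto simp: ennreal_minus_le_iff add.commute max_def)
  then have "ennreal (real (Suc n)) * (max (ennreal ((1 + 1 / real (Suc n)) * a)) m - max (ennreal a) m)
      \<le> ennreal (real (Suc n)) * ennreal (a / real (Suc n))"
    by (rule mult_left_mono) simp
  also have "\<dots> = ennreal a" using assms by (simp add: ennreal_mult[symmetric] del: of_nat_Suc)
  finally show ?thesis .
qed

text \<open>
  Paths are nonnegative, so the half-lines \<open>{..y}\<close> with \<open>y = 1 / x > 0\<close> suffice to generate
  the \<open>\<sigma>\<close>-field; the half-line \<open>{..0}\<close> is a countable intersection. The form \<open>x t * f t \<le> 1\<close>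
  is the one delivered by differentiating an expected maximum.
\<close>

lemma sets_D_space:
  fixes E :: "(real ^ 'd::finite \<Rightarrow> real) set set"
  defines "E \<equiv> {{f \<in> gcadlag. \<forall>t\<in>F. x t * f t \<le> 1} | F x. finite F \<and> (\<forall>t. 0 \<le> x t)}"
  shows "sets D_space = sigma_sets gcadlag E"
proof (rule antisym)
  let ?S = "sigma gcadlag E"
  have sp: "space ?S = gcadlag" and se: "sets ?S = sigma_sets gcadlag E"
    by (auto simp: E_def space_measure_of_conv sets_measure_of_conv)
  have "(\<lambda>f. f t) \<in> borel_measurable ?S" for t
  proof (rule borel_measurableI_le)
    fix a :: real
    have pos: "{f \<in> gcadlag. f t \<le> b} \<in> sigma_sets gcadlag E" if "0 < b" for b
      using that by (intro sigma_sets.Basic) (auto simp: E_def field_simps intro!: exI[of _ "{t}"] exI[of _ "\<lambda>_. 1 / b"])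
    consider "0 < a" | "a = 0" | "a < 0" by linarith
    then have "{f \<in> gcadlag. f t \<le> a} \<in> sigma_sets gcadlag E"
    proof cases
      case 2
      have "f t \<le> 0" if "\<And>n. f t \<le> inverse (real (Suc n))" for f :: "real ^ 'd \<Rightarrow> real"
        using that by (intro LIMSEQ_le_const[OF LIMSEQ_inverse_real_of_nat]) auto
      then have "{f \<in> gcadlag. f t \<le> a} = (\<Inter>n. {f \<in> gcadlag. f t \<le> inverse (real (Suc n))})"
        using 2 by (auto intro: order_trans[of _ 0])
      moreover have "(\<Inter>n. {f \<in> gcadlag. f t \<le> inverse (real (Suc n))}) \<in> sigma_sets gcadlag E"
        by (intro sigma_sets_INTER pos) (auto simp: E_def)
      ultimately show ?thesis by simp
    next
      case 3
      then have "{f \<in> gcadlag. f t \<le> a} = {}" by (auto dest: gcadlag_nonneg[of _ t])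
      then show ?thesis by (simp only: sigma_sets.Empty)
    qed (rule pos)
    then show "{f \<in> space ?S. f t \<le> a} \<in> sets ?S" by (simp add: sp se)
  qed
  then have "(\<lambda>f. f) \<in> measurable ?S D_space"
    by (intro measurable_into_D) (auto simp: sp)
  then have "A \<in> sets ?S" if "A \<in> sets D_space" for A
    using measurable_sets[of "\<lambda>f. f" ?S D_space A] that sets.sets_into_space[OF that]
    by (simp add: sp space_D Int_absorb2)
  then show "sets D_space \<subseteq> sigma_sets gcadlag E" by (auto simp: se)
next
  have "A \<in> sets D_space" if "A \<in> E" for A
  proof -
    from that obtain F x where A: "A = {f \<in> gcadlag. \<forall>t\<in>F. x t * f t \<le> 1}" and F: "finite F"
      by (auto simp: E_def)
    have "{f \<in> space D_space. x t * f t \<le> 1} \<in> sets D_space" for t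
      by (intro borel_measurable_le borel_measurable_times measurable_eval_D) auto
    then have "{f \<in> space D_space. \<forall>t\<in>F. x t * f t \<le> 1} \<in> sets D_space"
      using F by (intro sets.sets_Collect_finite_All) auto
    then show ?thesis by (simp add: A space_D)
  qed
  then have "E \<subseteq> sets D_space" by auto
  then show "sigma_sets gcadlag E \<subseteq> sets D_space"
    using sets.sigma_sets_subset[of E D_space] by (simp add: space_D)
qed

text \<open>
  A version of the spectral field with all paths in \<open>D\<close>. The index type of the peaks is an option
  type: \<open>None\<close> is for the site whose weight is varied, which may coincide with one of the others.
\<close>

locale spectral_field = prob_space M for M :: "'w measure" +
  fixes Z :: "'w \<Rightarrow> real ^ 'd::finite \<Rightarrow> real"
  assumes Z_measurable [measurable]: "Z \<in> measurable M D_space"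
    and Z_mean: "\<And>t. (\<integral>\<^sup>+\<omega>. ennreal (Z \<omega> t) \<partial>M) = 1"
    and peak_shift: "\<And>(F :: (real ^ 'd) option set) x \<tau> h h'. finite F \<Longrightarrow> (\<And>t. 0 \<le> x t) \<Longrightarrow>
       (\<integral>\<^sup>+\<omega>. peak F x (\<lambda>t. \<tau> t + h) (Z \<omega>) \<partial>M) = (\<integral>\<^sup>+\<omega>. peak F x (\<lambda>t. \<tau> t + h') (Z \<omega>) \<partial>M)"
begin

lemma Z_gcadlag: "\<omega> \<in> space M \<Longrightarrow> Z \<omega> \<in> gcadlag"
  using measurable_space[OF Z_measurable] by (simp add: space_D)

lemma Z_nonneg: "\<omega> \<in> space M \<Longrightarrow> 0 \<le> Z \<omega> t"
  by (rule gcadlag_nonneg[OF Z_gcadlag])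

lemma Z_eval [measurable]: "(\<lambda>\<omega>. Z \<omega> t) \<in> borel_measurable M"
  by (rule measurable_compose[OF Z_measurable measurable_eval_D])

lemma peak_Z_measurable [measurable]: "finite F \<Longrightarrow> (\<lambda>\<omega>. peak F x \<tau> (Z \<omega>)) \<in> borel_measurable M"
  by (intro measurable_peak) auto

text \<open>
  The two sides are the right derivatives, in the weight \<open>c\<close> of the site \<open>h\<close>, of two expected
  maxima that agree for all \<open>c\<close>. The difference quotients are dominated by \<open>Z h\<close>.
\<close>

lemma tilted_rectangle:
  fixes F :: "(real ^ 'd) set"
  assumes F: "finite F" and x: "\<And>t. 0 \<le> x t"
  shows "(\<integral>\<^sup>+\<omega>. ennreal (Z \<omega> h) * indicator {..ennreal (Z \<omega> h)} (peak F x (\<lambda>t. t + h) (Z \<omega>)) \<partial>M)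
    = (\<integral>\<^sup>+\<omega>. ennreal (Z \<omega> h') * indicator {..ennreal (Z \<omega> h')} (peak F x (\<lambda>t. t + h') (Z \<omega>)) \<partial>M)"
proof -
  let ?p = "\<lambda>h \<omega>. peak F x (\<lambda>t. t + h) (Z \<omega>)"
  have pfin: "(\<integral>\<^sup>+\<omega>. ?p h \<omega> \<partial>M) < top" for h
  proof -
    have "(\<integral>\<^sup>+\<omega>. ?p h \<omega> \<partial>M) \<le> (\<integral>\<^sup>+\<omega>. (\<Sum>t\<in>F. ennreal (x t) * ennreal (Z \<omega> (t + h))) \<partial>M)"
    proof (intro nn_integral_mono)
      fix \<omega>
      have "ennreal (x t * Z \<omega> (t + h)) \<le> (\<Sum>t\<in>F. ennreal (x t) * ennreal (Z \<omega> (t + h)))" if "t \<in> F" for t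
        using F that x by (subst ennreal_mult') (auto intro: member_le_sum)
      then show "?p h \<omega> \<le> (\<Sum>t\<in>F. ennreal (x t) * ennreal (Z \<omega> (t + h)))"
        unfolding peak_def by (intro SUP_least)
    qed
    also have "\<dots> = (\<Sum>t\<in>F. ennreal (x t))"
      by (subst nn_integral_sum) (auto simp: nn_integral_cmult Z_mean)
    also have "\<dots> < top" using F by simp
    finally show ?thesis .
  qed
  have pfin': "AE \<omega> in M. ?p h \<omega> < top" for h
    using nn_integral_PInf_AE[of "?p h" M] pfin[of h] F by (auto simp: less_top)
  let ?\<phi> = "\<lambda>h c. (\<integral>\<^sup>+\<omega>. max (ennreal (c * Z \<omega> h)) (?p h \<omega>) \<partial>M)"
  have eq: "?\<phi> h c = ?\<phi> h' c" if "0 \<le> c" for c h h'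
  proof -
    \<comment> \<open>the additional site \<open>None\<close> sits at \<open>h\<close> and has weight \<open>c\<close>\<close>
    define x' where "x' u = (case u of None \<Rightarrow> c | Some t \<Rightarrow> x t)" for u
    define \<tau> where "\<tau> u = (case u of None \<Rightarrow> 0 | Some (t :: real ^ 'd) \<Rightarrow> t)" for u
    have "max (ennreal (c * Z \<omega> h)) (?p h \<omega>) = peak (insert None (Some ` F)) x' (\<lambda>t. \<tau> t + h) (Z \<omega>)" for h \<omega>
      by (simp add: peak_def SUP_insert image_image x'_def \<tau>_def sup_max)
    then show ?thesis
      using peak_shift[of "insert None (Some ` F)" x' \<tau> h h'] F x that
      by (simp add: x'_def split: option.split)
  qed
  have fin: "?\<phi> h c < top" if "0 \<le> c" for c h
  proof -
    have "?\<phi> h c \<le> (\<integral>\<^sup>+\<omega>. ennreal c * ennreal (Z \<omega> h) + ?p h \<omega> \<partial>M)"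
      using that by (intro nn_integral_mono) (auto simp: ennreal_mult' add_increasing add_increasing2)
    also have "\<dots> = ennreal c + (\<integral>\<^sup>+\<omega>. ?p h \<omega> \<partial>M)"
      using F by (subst nn_integral_add) (auto simp: nn_integral_cmult Z_mean)
    also have "\<dots> < top" using pfin by (simp add: less_top)
    finally show ?thesis .
  qed
  have "(\<lambda>n. ennreal (real (Suc n)) * (?\<phi> h (1 + 1 / real (Suc n)) - ?\<phi> h 1)) \<longlonglongrightarrow>
     (\<integral>\<^sup>+\<omega>. ennreal (Z \<omega> h) * indicator {..ennreal (Z \<omega> h)} (?p h \<omega>) \<partial>M)" for h
  proof -
    let ?g = "\<lambda>n \<omega>. ennreal (real (Suc n)) * (max (ennreal ((1 + 1 / real (Suc n)) * Z \<omega> h)) (?p h \<omega>) - max (ennreal (Z \<omega> h)) (?p h \<omega>))"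
    have "(\<integral>\<^sup>+\<omega>. ?g n \<omega> \<partial>M) = ennreal (real (Suc n)) * (?\<phi> h (1 + 1 / real (Suc n)) - ?\<phi> h 1)" for n
    proof (subst nn_integral_cmult)
      have "(\<integral>\<^sup>+\<omega>. max (ennreal ((1 + 1 / real (Suc n)) * Z \<omega> h)) (?p h \<omega>) - max (ennreal (1 * Z \<omega> h)) (?p h \<omega>) \<partial>M)
          = ?\<phi> h (1 + 1 / real (Suc n)) - ?\<phi> h 1"
      proof (rule nn_integral_diff)
        show "?\<phi> h 1 \<noteq> \<infinity>" using fin[of 1 h] by simp
        show "AE \<omega> in M. max (ennreal (1 * Z \<omega> h)) (?p h \<omega>) \<le> max (ennreal ((1 + 1 / real (Suc n)) * Z \<omega> h)) (?p h \<omega>)"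
          by (intro AE_I2 max.mono ennreal_leI mult_right_mono) (auto intro: Z_nonneg)
      qed (use F in measurable)
      then show "ennreal (real (Suc n)) * (\<integral>\<^sup>+\<omega>. max (ennreal ((1 + 1 / real (Suc n)) * Z \<omega> h)) (?p h \<omega>) - max (ennreal (Z \<omega> h)) (?p h \<omega>) \<partial>M)
        = ennreal (real (Suc n)) * (?\<phi> h (1 + 1 / real (Suc n)) - ?\<phi> h 1)" by simp
    qed (use F in measurable)
    moreover have "(\<lambda>n. \<integral>\<^sup>+\<omega>. ?g n \<omega> \<partial>M) \<longlonglongrightarrow> (\<integral>\<^sup>+\<omega>. ennreal (Z \<omega> h) * indicator {..ennreal (Z \<omega> h)} (?p h \<omega>) \<partial>M)"
    proof (rule nn_integral_dominated_convergence[where w = "\<lambda>\<omega>. ennreal (Z \<omega> h)"])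
      show "\<And>n. AE \<omega> in M. ?g n \<omega> \<le> ennreal (Z \<omega> h)"
        using pfin'[of h] AE_space by eventually_elim (intro max_slope_le Z_nonneg)
      show "AE \<omega> in M. (\<lambda>n. ?g n \<omega>) \<longlonglongrightarrow> ennreal (Z \<omega> h) * indicator {..ennreal (Z \<omega> h)} (?p h \<omega>)"
        using pfin'[of h] AE_space by eventually_elim (intro max_slope_tendsto Z_nonneg)
    qed (use F in \<open>auto simp: Z_mean indicator_def\<close>)
    ultimately show ?thesis by simp
  qed
  from this[of h] this[of h', unfolded eq[of _ h' h]] show ?thesis
    by (subst (asm) eq[of _ h' h], simp, subst (asm) eq[of 1 h' h], simp) (rule LIMSEQ_unique)
qed

text \<open>
  The law of \<open>Z (\<cdot> + h) / Z h\<close> under the density \<open>Z h\<close>. Where \<open>Z h = 0\<close> the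
  density vanishes; the absolute value puts the normalised path into \<open>D\<close> by its form alone.
\<close>

definition tilted :: "real ^ 'd \<Rightarrow> (real ^ 'd \<Rightarrow> real) measure" where
  "tilted h = distr (density M (\<lambda>\<omega>. ennreal (Z \<omega> h))) D_space (\<lambda>\<omega> t. \<bar>inverse (Z \<omega> h)\<bar> * Z \<omega> (t + h))"

lemma normalised_measurable [measurable]:
  "(\<lambda>\<omega> t. \<bar>inverse (Z \<omega> h)\<bar> * Z \<omega> (t + h)) \<in> measurable M D_space"
  by (rule measurable_into_D) (auto intro!: gcadlag_scale gcadlag_shift Z_gcadlag)

lemma nn_integral_tilted:
  assumes [measurable]: "G \<in> borel_measurable D_space"
  shows "(\<integral>\<^sup>+f. G f \<partial>tilted h) = (\<integral>\<^sup>+\<omega>. ennreal (Z \<omega> h) * G (\<lambda>t. \<bar>inverse (Z \<omega> h)\<bar> * Z \<omega> (t + h)) \<partial>M)"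
  unfolding tilted_def by (subst nn_integral_distr) (simp_all add: nn_integral_density del: abs_inverse)

text \<open>
  The laws agree on the rectangles \<open>x t * f t \<le> 1\<close>, where dividing by \<open>Z h\<close> gives the event of
  \<open>tilted_rectangle\<close>, and these form an intersection-stable generator.
\<close>

lemma tilted_shift: "tilted h = tilted h'"
proof (rule measure_eqI_generator_eq)
  let ?E = "{{f \<in> gcadlag. \<forall>t\<in>F. x t * f t \<le> 1} | F (x :: real ^ 'd \<Rightarrow> real). finite F \<and> (\<forall>t. 0 \<le> x t)}"
  show "Int_stable ?E"
  proof (rule Int_stableI, safe)
    fix F G :: "(real ^ 'd) set" and x y :: "real ^ 'd \<Rightarrow> real"
    assume *: "finite F" "finite G" "\<forall>t. 0 \<le> x t" "\<forall>t. 0 \<le> y t"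
    \<comment> \<open>the two constraints at a common site merge into the one with the larger weight\<close>
    let ?z = "\<lambda>t. max (if t \<in> F then x t else 0) (if t \<in> G then y t else 0)"
    have "max a b * c \<le> 1 \<longleftrightarrow> a * c \<le> 1 \<and> b * c \<le> 1" if "0 \<le> c" for a b c :: real
      using that by (smt (verit) mult_right_mono)
    then have "?z t * f t \<le> 1 \<longleftrightarrow> (t \<in> F \<longrightarrow> x t * f t \<le> 1) \<and> (t \<in> G \<longrightarrow> y t * f t \<le> 1)"
      if "f \<in> gcadlag" for t f
      using gcadlag_nonneg[OF that, of t] by (simp only:) auto
    then have "{f \<in> gcadlag. \<forall>t\<in>F. x t * f t \<le> 1} \<inter> {f \<in> gcadlag. \<forall>t\<in>G. y t * f t \<le> 1} = {f \<in> gcadlag. \<forall>t\<in>F \<union> G. ?z t * f t \<le> 1}"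
      by blast
    then show "\<exists>H z. {f \<in> gcadlag. \<forall>t\<in>F. x t * f t \<le> 1} \<inter> {f \<in> gcadlag. \<forall>t\<in>G. y t * f t \<le> 1} = {f \<in> gcadlag. \<forall>t\<in>H. z t * f t \<le> 1} \<and> finite H \<and> (\<forall>t. 0 \<le> z t)"
      using * by (intro exI[of _ "F \<union> G"] exI[of _ ?z]) (auto simp: max_def)
  qed
  show "?E \<subseteq> Pow gcadlag" by auto
  show "sets (tilted h) = sigma_sets gcadlag ?E" "sets (tilted h') = sigma_sets gcadlag ?E"
    by (simp_all add: tilted_def sets_D_space)
  have gcE: "gcadlag \<in> ?E" by (auto intro!: exI[of _ "{}"] exI[of _ "\<lambda>_. 0"])
  then show "range (\<lambda>_::nat. gcadlag) \<subseteq> ?E" by blast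
  show "(\<Union>i::nat. gcadlag) = (gcadlag :: (real ^ 'd \<Rightarrow> real) set)" by simp
  have "emeasure (tilted h) gcadlag = 1"
    using nn_integral_tilted[of "\<lambda>_. 1" h] Z_mean by (simp add: tilted_def space_D)
  then show "emeasure (tilted h) gcadlag \<noteq> \<infinity>" for i :: nat by simp
  fix X assume "X \<in> ?E"
  then obtain F x where X: "X = {f \<in> gcadlag. \<forall>t\<in>F. x t * f t \<le> 1}" and F: "finite F" and x: "\<And>t. 0 \<le> x t"
    by auto
  have Xs: "X \<in> sets D_space" using \<open>X \<in> ?E\<close> by (subst sets_D_space) (rule sigma_sets.Basic)
  have "emeasure (tilted h) X = (\<integral>\<^sup>+\<omega>. ennreal (Z \<omega> h) * indicator {..ennreal (Z \<omega> h)} (peak F x (\<lambda>t. t + h) (Z \<omega>)) \<partial>M)" for h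
  proof -
    have "emeasure (tilted h) X = (\<integral>\<^sup>+f. indicator X f \<partial>tilted h)"
      using Xs by (simp add: tilted_def)
    also have "\<dots> = (\<integral>\<^sup>+\<omega>. ennreal (Z \<omega> h) * indicator X (\<lambda>t. \<bar>inverse (Z \<omega> h)\<bar> * Z \<omega> (t + h)) \<partial>M)"
      using Xs by (subst nn_integral_tilted) auto
    also have "\<dots> = (\<integral>\<^sup>+\<omega>. ennreal (Z \<omega> h) * indicator {..ennreal (Z \<omega> h)} (peak F x (\<lambda>t. t + h) (Z \<omega>)) \<partial>M)"
    proof (intro nn_integral_cong)
      fix \<omega> assume \<omega>: "\<omega> \<in> space M"
      show "ennreal (Z \<omega> h) * indicator X (\<lambda>t. \<bar>inverse (Z \<omega> h)\<bar> * Z \<omega> (t + h)) = ennreal (Z \<omega> h) * indicator {..ennreal (Z \<omega> h)} (peak F x (\<lambda>t. t + h) (Z \<omega>))"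
      proof (cases "0 < Z \<omega> h")
        case True
        have "(\<lambda>t. \<bar>inverse (Z \<omega> h)\<bar> * Z \<omega> (t + h)) \<in> gcadlag"
          using measurable_space[OF normalised_measurable \<omega>] by (simp add: space_D)
        then have "(\<lambda>t. \<bar>inverse (Z \<omega> h)\<bar> * Z \<omega> (t + h)) \<in> X \<longleftrightarrow> (\<forall>t\<in>F. x t * (\<bar>inverse (Z \<omega> h)\<bar> * Z \<omega> (t + h)) \<le> 1)"
          by (simp only: X mem_Collect_eq simp_thms)
        also have "\<dots> \<longleftrightarrow> (\<forall>t\<in>F. x t * Z \<omega> (t + h) \<le> Z \<omega> h)"
          using True by (simp add: field_simps)
        also have "\<dots> \<longleftrightarrow> peak F x (\<lambda>t. t + h) (Z \<omega>) \<le> ennreal (Z \<omega> h)"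
          using True by (simp add: peak_def SUP_le_iff ennreal_le_iff)
        finally show ?thesis by (simp add: indicator_def)
      next
        case False
        then show ?thesis using Z_nonneg[OF \<omega>, of h] by simp
      qed
    qed
    finally show ?thesis .
  qed
  then show "emeasure (tilted h) X = emeasure (tilted h') X"
    using tilted_rectangle[OF F x] by simp
qed

end

section \<open>The law of the tail field\<close>

text \<open>
  The absolute value makes this an operation on \<open>D\<close> for every real factor.
\<close>

definition rescale :: "real \<Rightarrow> ('t \<Rightarrow> real) \<Rightarrow> 't \<Rightarrow> real" where
  "rescale c f = (\<lambda>t. \<bar>c\<bar> * f t)"

lemma rescale_gcadlag: "f \<in> gcadlag \<Longrightarrow> rescale c f \<in> gcadlag"
  unfolding rescale_def by (rule gcadlag_scale) auto

lemma rescale_measurable [measurable]: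
  "f \<in> borel_measurable N \<Longrightarrow> X \<in> measurable N D_space \<Longrightarrow> (\<lambda>\<omega>. rescale (f \<omega>) (X \<omega>)) \<in> measurable N D_space"
  using measurable_compose[OF measurable_Pair measurable_scale_D] by (simp add: rescale_def)

locale spectral_tail_field = spectral_field M Z
  for M :: "'w measure" and Z :: "'w \<Rightarrow> real ^ 'd::finite \<Rightarrow> real" +
  fixes \<Theta> :: "'w \<Rightarrow> real ^ 'd \<Rightarrow> real" and R :: "'w \<Rightarrow> real"
  assumes \<Theta>_law: "distr M D_space \<Theta> = tilted 0"
    and R_\<Theta>_indep: "indep_elements M borel R D_space \<Theta>"
    and R_tail: "\<And>r. 1 \<le> r \<Longrightarrow> prob {\<omega> \<in> space M. R \<omega> > r} = 1 / r"
begin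

definition Y :: "'w \<Rightarrow> real ^ 'd \<Rightarrow> real" where
  "Y \<omega> = rescale (R \<omega>) (\<Theta> \<omega>)"

lemma \<Theta>_measurable [measurable]: "\<Theta> \<in> measurable M D_space"
  and R_measurable [measurable]: "R \<in> borel_measurable M"
  using R_\<Theta>_indep by (auto simp: indep_elements_def)

lemma Y_measurable [measurable]: "Y \<in> measurable M D_space"
  unfolding Y_def by measurable

text \<open>
  The Pareto law is the law of the reciprocal of a uniform variable, which makes the substitution
  \<open>s = Z h * u\<close> in \<open>nn_integral_Y\<close> linear.
\<close>

lemma R_law: "distr M borel R = distr (density lborel (indicator {0<..<1})) borel inverse"
proof (rule measure_eqI_lessThan)
  fix x :: real
  have *: "emeasure (distr M borel R) {x<..} = ennreal (prob {\<omega> \<in> space M. R \<omega> > x})"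
    by (subst emeasure_distr) (auto simp: emeasure_eq_measure vimage_def Int_def conj_commute)
  then show "emeasure (distr M borel R) {x<..} < \<infinity>" by simp
  have "emeasure (distr (density lborel (indicator {0<..<1})) borel inverse) {x<..}
      = (\<integral>\<^sup>+u. indicator {0<..<1} u * indicator {u. x < inverse u} u \<partial>lborel)"
    by (subst nn_integral_indicator[symmetric], simp, subst nn_integral_distr)
       (simp_all add: nn_integral_density indicator_def)
  also have "\<dots> = (\<integral>\<^sup>+u. indicator {u. 0 < u \<and> u < 1 \<and> x < inverse u} u \<partial>lborel)"
    by (intro nn_integral_cong) (auto simp: indicator_def)
  also have "\<dots> = ennreal (prob {\<omega> \<in> space M. R \<omega> > x})"
  proof (cases "1 \<le> x")
    case True
    have "x < inverse u \<longleftrightarrow> u < 1 / x" if "0 < u" for u using True that by (simp add: field_simps)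
    moreover have "1 / x \<le> 1" using True by simp
    ultimately have "{u. 0 < u \<and> u < 1 \<and> x < inverse u} = {0<..<1/x}" by auto
    then show ?thesis using R_tail[OF True] True by simp
  next
    case False
    have "1 < inverse u" if "0 < u" "u < 1" for u :: real using that by (simp add: field_simps)
    then have "{u. 0 < u \<and> u < 1 \<and> x < inverse u} = {0<..<1}" using False by fastforce
    moreover have "prob {\<omega> \<in> space M. R \<omega> > 1} \<le> prob {\<omega> \<in> space M. R \<omega> > x}"
      using False by (intro finite_measure_mono) auto
    then have "prob {\<omega> \<in> space M. R \<omega> > x} = 1"
      using R_tail[OF order_refl] prob_le_1[of "{\<omega> \<in> space M. R \<omega> > x}"] by linarith
    ultimately show ?thesis by simp
  qed
  finally show "emeasure (distr M borel R) {x<..} = emeasure (distr (density lborel (indicator {0<..<1})) borel inverse) {x<..}"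
    using * by simp
qed auto

lemma nn_integral_R:
  assumes [measurable]: "g \<in> borel_measurable borel"
  shows "(\<integral>\<^sup>+\<omega>. g (R \<omega>) \<partial>M) = (\<integral>\<^sup>+u. indicator {0<..<1} u * g (inverse u) \<partial>lborel)"
proof -
  have "(\<integral>\<^sup>+\<omega>. g (R \<omega>) \<partial>M) = (\<integral>\<^sup>+r. g r \<partial>distr M borel R)"
    by (subst nn_integral_distr) auto
  also have "\<dots> = (\<integral>\<^sup>+u. indicator {0<..<1} u * g (inverse u) \<partial>lborel)"
    unfolding R_law by (subst nn_integral_distr) (auto simp: nn_integral_density)
  finally show ?thesis .
qed

lemma R_pos: "AE \<omega> in M. 0 < R \<omega>"
proof -
  have "prob {\<omega> \<in> space M. R \<omega> > 1} = 1" using R_tail[of 1] by simp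
  then have "AE \<omega> in M. R \<omega> > 1" by (subst (asm) prob_Collect_eq_1) auto
  then show ?thesis by eventually_elim simp
qed

lemma Y_eq: "AE \<omega> in M. Y \<omega> = (\<lambda>t. R \<omega> * \<Theta> \<omega> t)"
  using R_pos by eventually_elim (simp add: Y_def rescale_def)

text \<open>
  Integrate out \<open>1 / R = u\<close> first, pass from \<open>\<Theta>\<close> to the law tilted at \<open>h\<close>, and substitute
  \<open>s = Z h * u\<close>: the density \<open>Z h\<close> is absorbed by the substitution.
\<close>

lemma nn_integral_Y:
  assumes [measurable]: "H \<in> borel_measurable D_space"
  shows "(\<integral>\<^sup>+\<omega>. H (Y \<omega>) \<partial>M) =
    (\<integral>\<^sup>+\<omega>. (\<integral>\<^sup>+s. indicator {0<..<Z \<omega> h} s * H (rescale (inverse s) (\<lambda>t. Z \<omega> (t + h))) \<partial>lborel) \<partial>M)"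
proof -
  define G where "G f = (\<integral>\<^sup>+u. indicator {0<..<1} u * H (rescale (inverse u) f) \<partial>lborel)" for f :: "real ^ 'd \<Rightarrow> real"
  have G [measurable]: "G \<in> borel_measurable D_space" unfolding G_def by measurable
  have "(\<integral>\<^sup>+\<omega>. H (Y \<omega>) \<partial>M) = (\<integral>\<^sup>+\<omega>. (\<lambda>p. H (rescale (fst p) (snd p))) (R \<omega>, \<Theta> \<omega>) \<partial>M)"
    by (simp add: Y_def)
  also have "\<dots> = (\<integral>\<^sup>+\<omega>'. (\<integral>\<^sup>+\<omega>. (\<lambda>p. H (rescale (fst p) (snd p))) (R \<omega>, \<Theta> \<omega>') \<partial>M) \<partial>M)"
    by (rule indep_elements_nn_integral[OF R_\<Theta>_indep]) measurable
  also have "\<dots> = (\<integral>\<^sup>+\<omega>'. G (\<Theta> \<omega>') \<partial>M)"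
  proof (intro nn_integral_cong)
    fix \<omega>' assume "\<omega>' \<in> space M"
    then have [measurable]: "\<Theta> \<omega>' \<in> space D_space" by (rule measurable_space[OF \<Theta>_measurable])
    show "(\<integral>\<^sup>+\<omega>. (\<lambda>p. H (rescale (fst p) (snd p))) (R \<omega>, \<Theta> \<omega>') \<partial>M) = G (\<Theta> \<omega>')"
      unfolding G_def fst_conv snd_conv by (rule nn_integral_R) measurable
  qed
  also have "\<dots> = (\<integral>\<^sup>+f. G f \<partial>distr M D_space \<Theta>)" by (subst nn_integral_distr) auto
  also have "\<dots> = (\<integral>\<^sup>+\<omega>. ennreal (Z \<omega> h) * G (\<lambda>t. \<bar>inverse (Z \<omega> h)\<bar> * Z \<omega> (t + h)) \<partial>M)"
    unfolding \<Theta>_law tilted_shift[of 0 h] by (rule nn_integral_tilted) measurable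
  also have "\<dots> = (\<integral>\<^sup>+\<omega>. (\<integral>\<^sup>+s. indicator {0<..<Z \<omega> h} s * H (rescale (inverse s) (\<lambda>t. Z \<omega> (t + h))) \<partial>lborel) \<partial>M)"
  proof (intro nn_integral_cong)
    fix \<omega> assume \<omega>: "\<omega> \<in> space M"
    show "ennreal (Z \<omega> h) * G (\<lambda>t. \<bar>inverse (Z \<omega> h)\<bar> * Z \<omega> (t + h))
      = (\<integral>\<^sup>+s. indicator {0<..<Z \<omega> h} s * H (rescale (inverse s) (\<lambda>t. Z \<omega> (t + h))) \<partial>lborel)"
    proof (cases "0 < Z \<omega> h")
      case True
      have [measurable]: "(\<lambda>t. Z \<omega> (t + h)) \<in> space D_space"
        using Z_gcadlag[OF \<omega>] by (simp add: space_D gcadlag_shift)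
      have "(\<integral>\<^sup>+s. indicator {0<..<Z \<omega> h} s * H (rescale (inverse s) (\<lambda>t. Z \<omega> (t + h))) \<partial>lborel)
        = ennreal \<bar>Z \<omega> h\<bar> * (\<integral>\<^sup>+u. indicator {0<..<Z \<omega> h} (0 + Z \<omega> h * u) * H (rescale (inverse (0 + Z \<omega> h * u)) (\<lambda>t. Z \<omega> (t + h))) \<partial>lborel)"
      proof (rule nn_integral_real_affine)
        have "(\<lambda>s::real. (\<lambda>t. Z \<omega> (t + h))) \<in> measurable borel D_space" by simp
        then have "(\<lambda>s. H (rescale (inverse s) (\<lambda>t. Z \<omega> (t + h)))) \<in> borel_measurable borel"
          by (intro measurable_compose[OF rescale_measurable assms]) measurable
        then show "(\<lambda>s. indicator {0<..<Z \<omega> h} s * H (rescale (inverse s) (\<lambda>t. Z \<omega> (t + h)))) \<in> borel_measurable borel"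
          by measurable
      qed (use True in simp)
      also have "\<dots> = ennreal (Z \<omega> h) * G (\<lambda>t. \<bar>inverse (Z \<omega> h)\<bar> * Z \<omega> (t + h))"
        unfolding G_def using True
        by (auto intro!: arg_cong2[where f = "(*)"] nn_integral_cong simp: indicator_def rescale_def abs_mult ac_simps zero_less_mult_iff)
      finally show ?thesis by simp
    next
      case False
      then have "Z \<omega> h = 0" using Z_nonneg[OF \<omega>, of h] by simp
      then show ?thesis by simp
    qed
  qed
  finally show ?thesis .
qed

end

section \<open>Lattice measures and exceedance volumes\<close>

text \<open>
  Half-open, so that translates by multiples of the edge tile a larger cube for Lebesgue measure
  and for the lattice alike.
\<close>

definition cube :: "real \<Rightarrow> (real ^ 'd) set" where
  "cube c = {t. \<forall>i. 0 \<le> t $ i \<and> t $ i < c}"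

lemma cube_borel [measurable]: "cube c \<in> sets (borel :: (real ^ 'd::finite) measure)"
proof -
  have "{t :: real ^ 'd \<in> space borel. \<forall>i. 0 \<le> t $ i \<and> t $ i < c} \<in> sets borel" by measurable
  then show ?thesis by (simp add: cube_def)
qed

text \<open>
  The properties shared by Lebesgue measure, with \<open>H\<close> the whole space, and by the scaled counting
  measure on a lattice \<open>H\<close> of mesh \<open>c\<close>. The last assumption lets a right-continuous path that exceeds
  a level have exceedances of positive volume.
\<close>

locale lattice_measure =
  fixes \<nu> :: "(real ^ 'd::finite) measure" and H :: "(real ^ 'd) set" and c :: real
  assumes sets_\<nu>: "sets \<nu> = sets borel"
    and sigma_finite_\<nu>: "sigma_finite_measure \<nu>"
    and \<nu>_shift: "\<And>h f. h \<in> H \<Longrightarrow> f \<in> borel_measurable borel \<Longrightarrow> (\<integral>\<^sup>+t. f (t + h) \<partial>\<nu>) = (\<integral>\<^sup>+t. f t \<partial>\<nu>)"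
    and \<nu>_concentrated: "AE t in \<nu>. t \<in> H"
    and c_pos: "0 < c"
    and multiples_H: "\<And>k. (\<chi> i. c * real (k i)) \<in> H"
    and \<nu>_cube: "emeasure \<nu> (cube c) = ennreal (c ^ CARD('d))"
    and \<nu>_corner: "\<And>\<eta>. 0 < \<eta> \<Longrightarrow> 0 < emeasure \<nu> (cube \<eta>)"

text \<open>
  The same integral as \<open>lam \<delta>\<close>, but on the Borel \<open>\<sigma>\<close>-field for every \<open>\<delta>\<close>.
\<close>

definition lattice_measure_of :: "real \<Rightarrow> (real ^ 'd::finite) measure" where
  "lattice_measure_of \<delta> = distr (lam \<delta>) borel (\<lambda>t. t)"

lemma countable_grid: "countable (grid \<delta> :: (real ^ 'd::finite) set)"
proof -
  have "grid \<delta> \<subseteq> range (\<lambda>k :: int ^ 'd. \<chi> i. \<delta> * of_int (k $ i))"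
  proof
    fix t :: "real ^ 'd" assume "t \<in> grid \<delta>"
    then have "\<forall>i. \<exists>k::int. t $ i = \<delta> * of_int k" by (simp add: grid_def)
    then obtain k where "\<And>i. t $ i = \<delta> * of_int (k i)" by metis
    then show "t \<in> range (\<lambda>k :: int ^ 'd. \<chi> i. \<delta> * of_int (k $ i))"
      by (intro image_eqI[of _ _ "\<chi> i. k i"]) (auto simp: vec_eq_iff)
  qed
  then show ?thesis by (rule countable_subset) auto
qed

lemma sets_lam: "sets (lam \<delta>) = (if \<delta> = 0 then sets borel else Pow (grid \<delta>))"
  by (simp add: lam_def)

lemma space_lam: "space (lam \<delta>) = (if \<delta> = 0 then UNIV else grid \<delta>)"
  by (simp add: lam_def space_scale_measure)

lemma measurable_id_lam: "(\<lambda>t. t) \<in> measurable (lam \<delta>) borel"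
proof (cases "\<delta> = 0")
  case False
  then show ?thesis by (intro measurableI) (auto simp: sets_lam space_lam)
qed (simp add: lam_def)

lemma nn_integral_lattice_measure_of:
  "f \<in> borel_measurable borel \<Longrightarrow> (\<integral>\<^sup>+t. f t \<partial>lattice_measure_of \<delta>) = (\<integral>\<^sup>+t. f t \<partial>lam \<delta>)"
  unfolding lattice_measure_of_def by (subst nn_integral_distr) (auto intro: measurable_id_lam)

lemma emeasure_lattice_measure_of:
  assumes "0 < \<delta>" "A \<in> sets borel"
  shows "emeasure (lattice_measure_of \<delta> :: (real ^ 'd::finite) measure) A
    = ennreal (\<delta> ^ CARD('d)) * emeasure (count_space (grid \<delta>)) (A \<inter> grid \<delta>)"
  using assms unfolding lattice_measure_of_def
  by (simp add: emeasure_distr[OF measurable_id_lam]) (simp add: lam_def space_scale_measure)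

lemma grid_add: "t \<in> grid \<delta> \<Longrightarrow> h \<in> grid \<delta> \<Longrightarrow> t + h \<in> grid \<delta>"
  and grid_diff: "t \<in> grid \<delta> \<Longrightarrow> h \<in> grid \<delta> \<Longrightarrow> t - h \<in> grid \<delta>"
proof -
  assume *: "t \<in> grid \<delta>" "h \<in> grid \<delta>"
  show "t + h \<in> grid \<delta>" unfolding grid_def
  proof (clarify)
    fix i
    from * obtain k l :: int where "t $ i = \<delta> * k" "h $ i = \<delta> * l" unfolding grid_def by auto metis
    then show "\<exists>k::int. (t + h) $ i = \<delta> * of_int k" by (intro exI[of _ "k + l"]) (simp add: distrib_left)
  qed
  show "t - h \<in> grid \<delta>" unfolding grid_def
  proof (clarify)
    fix i
    from * obtain k l :: int where "t $ i = \<delta> * k" "h $ i = \<delta> * l" unfolding grid_def by auto metis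
    then show "\<exists>k::int. (t - h) $ i = \<delta> * of_int k" by (intro exI[of _ "k - l"]) (simp add: right_diff_distrib)
  qed
qed

lemma zero_in_grid: "0 \<in> grid \<delta>"
  by (auto simp: grid_def intro!: exI[of _ "0::int"])

lemma emeasure_lborel_cube:
  assumes "0 < c"
  shows "emeasure lborel (cube c :: (real ^ 'd::finite) set) = ennreal (c ^ CARD('d))"
proof -
  let ?v = "vec c :: real ^ 'd"
  have "?v \<bullet> b = c" if "b \<in> Basis" for b
    using that by (auto simp: Basis_vec_def inner_axis)
  then have p: "(\<Prod>b\<in>Basis. (?v - 0) \<bullet> b) = c ^ CARD('d)" and le: "\<And>b. b \<in> Basis \<Longrightarrow> 0 \<bullet> b \<le> ?v \<bullet> b"
    using assms by auto
  have "box 0 ?v \<subseteq> cube c" "cube c \<subseteq> cbox 0 ?v"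
    by (auto simp: cube_def mem_box_cart less_imp_le)
  then have "emeasure lborel (box 0 ?v) \<le> emeasure lborel (cube c :: (real ^ 'd) set)"
    and "emeasure lborel (cube c :: (real ^ 'd) set) \<le> emeasure lborel (cbox 0 ?v)"
    using emeasure_mono[of "box 0 ?v" "cube c" lborel] emeasure_mono[of "cube c" "cbox 0 ?v" lborel] by simp_all
  then show ?thesis using le p by (simp add: emeasure_lborel_box emeasure_lborel_cbox)
qed

lemma lattice_measure_lborel:
  "lattice_measure (lattice_measure_of 0 :: (real ^ 'd::finite) measure) UNIV 1"
proof -
  have eq: "(lattice_measure_of 0 :: (real ^ 'd) measure) = lborel"
    by (simp add: lattice_measure_of_def lam_def distr_id2)
  show ?thesis unfolding eq
  proof
    fix h :: "real ^ 'd" and f :: "real ^ 'd \<Rightarrow> ennreal" assume [measurable]: "f \<in> borel_measurable borel"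
    have "(\<integral>\<^sup>+t. f t \<partial>lborel) = (\<integral>\<^sup>+t. f t \<partial>distr lborel borel ((+) h))" by (simp add: lborel_distr_plus)
    also have "\<dots> = (\<integral>\<^sup>+t. f (t + h) \<partial>lborel)" by (subst nn_integral_distr) (auto simp: add.commute)
    finally show "(\<integral>\<^sup>+t. f (t + h) \<partial>lborel) = (\<integral>\<^sup>+t. f t \<partial>lborel)" by simp
  qed (auto simp: emeasure_lborel_cube lborel.sigma_finite_measure_axioms
      intro: sigma_finite_measure.sigma_finite_countable lborel.sigma_finite_countable)
qed

lemma lattice_measure_grid:
  assumes \<delta>: "0 < \<delta>"
  shows "lattice_measure (lattice_measure_of \<delta> :: (real ^ 'd::finite) measure) (grid \<delta>) \<delta>"
proof
  let ?\<nu> = "lattice_measure_of \<delta> :: (real ^ 'd) measure"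
  have zero: "(0 :: real ^ 'd) \<in> grid \<delta>" by (rule zero_in_grid)
  show "sets ?\<nu> = sets borel" by (simp add: lattice_measure_of_def)
  have gridm: "grid \<delta> \<in> sets (borel :: (real ^ 'd) measure)"
    by (rule sets.countable[OF _ countable_grid]) auto
  show "\<exists>A. countable A \<and> A \<subseteq> sets ?\<nu> \<and> \<Union>A = space ?\<nu> \<and> (\<forall>a\<in>A. emeasure ?\<nu> a \<noteq> \<infinity>)"
  proof (intro exI conjI ballI)
    let ?A = "insert (- grid \<delta>) ((\<lambda>t. {t}) ` grid \<delta>) :: (real ^ 'd) set set"
    show "countable ?A" using countable_grid by auto
    show "?A \<subseteq> sets ?\<nu>" using gridm by (auto simp: lattice_measure_of_def)
    show "\<Union>?A = space ?\<nu>" by (auto simp: lattice_measure_of_def)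
    fix a assume "a \<in> ?A"
    then show "emeasure ?\<nu> a \<noteq> \<infinity>"
      using gridm \<delta> by (auto simp: emeasure_lattice_measure_of ennreal_mult_eq_top_iff)
  qed
  have "emeasure ?\<nu> (- grid \<delta>) = 0"
    using gridm \<delta> by (simp add: emeasure_lattice_measure_of)
  then show "AE t in ?\<nu>. t \<in> grid \<delta>"
    using gridm by (intro AE_I[of _ _ "- grid \<delta>"]) (auto simp: lattice_measure_of_def)
  show "(\<chi> i. \<delta> * real (k i)) \<in> grid \<delta>" for k
  proof -
    have "\<exists>j::int. \<delta> * real (k i) = \<delta> * of_int j" for i by (intro exI[of _ "int (k i)"]) simp
    then show ?thesis by (simp add: grid_def)
  qed
  have "cube \<delta> \<inter> grid \<delta> = {0 :: real ^ 'd}"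
  proof (rule set_eqI, rule iffI)
    fix t :: "real ^ 'd" assume t: "t \<in> cube \<delta> \<inter> grid \<delta>"
    have "t $ i = 0" for i
    proof -
      from t obtain k :: int where k: "t $ i = \<delta> * k" unfolding grid_def by auto
      have "0 \<le> t $ i" "t $ i < \<delta>" using t by (auto simp: cube_def)
      then have "0 \<le> \<delta> * k" "\<delta> * k < \<delta> * 1" using k by auto
      then have "0 \<le> k" "k < 1" using \<delta> by (simp_all add: zero_le_mult_iff)
      then show ?thesis using k by simp
    qed
    then show "t \<in> {0}" by (simp add: vec_eq_iff)
  qed (use \<delta> zero_in_grid in \<open>auto simp: cube_def\<close>)
  then show "emeasure ?\<nu> (cube \<delta>) = ennreal (\<delta> ^ CARD('d))"
    using \<delta> zero by (simp add: emeasure_lattice_measure_of)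
  fix \<eta> :: real assume "0 < \<eta>"
  then have "{0} \<subseteq> (cube \<eta> :: (real ^ 'd) set)" by (auto simp: cube_def)
  then have "emeasure ?\<nu> {0} \<le> emeasure ?\<nu> (cube \<eta>)"
    by (rule emeasure_mono) (simp add: lattice_measure_of_def)
  moreover have "0 < emeasure ?\<nu> {0}"
    using \<delta> zero by (subst emeasure_lattice_measure_of) (auto simp: ennreal_zero_less_mult_iff)
  ultimately show "0 < emeasure ?\<nu> (cube \<eta>)" by (rule less_le_trans[rotated])
next
  fix h :: "real ^ 'd" and f :: "real ^ 'd \<Rightarrow> ennreal" assume h: "h \<in> grid \<delta>" and f [measurable]: "f \<in> borel_measurable borel"
  have "bij_betw (\<lambda>t. t + h) (grid \<delta>) (grid \<delta>)"
    by (rule bij_betw_byWitness[where f' = "\<lambda>t. t - h"]) (use h in \<open>auto intro: grid_add grid_diff\<close>)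
  then have "(\<integral>\<^sup>+t. f (t + h) \<partial>count_space (grid \<delta>)) = (\<integral>\<^sup>+t. f t \<partial>count_space (grid \<delta>))"
    by (rule nn_integral_bij_count_space)
  then show "(\<integral>\<^sup>+t. f (t + h) \<partial>lattice_measure_of \<delta>) = (\<integral>\<^sup>+t. f t \<partial>lattice_measure_of \<delta>)"
    using \<delta> by (simp add: nn_integral_lattice_measure_of lam_def nn_integral_scale_measure)
qed (rule \<delta>)

lemma sojourn_eq:
  assumes f: "f \<in> gcadlag" and A: "A \<in> sets borel"
  shows "sojourn \<delta> A f s = (\<integral>\<^sup>+t. indicator A t * indicator {s<..} (f t) \<partial>lattice_measure_of \<delta>)"
proof -
  have [measurable]: "f \<in> borel_measurable borel" by (rule measurable_gcadlag[OF f])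
  show ?thesis using A
    by (subst nn_integral_lattice_measure_of) (auto simp: sojourn_def indicator_def intro!: nn_integral_cong)
qed

lemma field_integral_eq:
  "f \<in> gcadlag \<Longrightarrow> field_integral \<delta> f = (\<integral>\<^sup>+t. ennreal (f t) \<partial>lattice_measure_of \<delta>)"
  unfolding field_integral_def
  by (rule nn_integral_lattice_measure_of[symmetric]) (rule measurable_compose[OF measurable_gcadlag measurable_ennreal])

context lattice_measure begin

sublocale \<nu>: sigma_finite_measure \<nu> by (rule sigma_finite_\<nu>)

lemma measurable_\<nu>: "measurable \<nu> N = measurable borel N"
  by (rule measurable_cong_sets) (simp_all add: sets_\<nu>)

lemma measurable_pair_\<nu>: "measurable (M \<Otimes>\<^sub>M \<nu>) N = measurable (M \<Otimes>\<^sub>M borel) N"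
  by (intro measurable_cong_sets sets_pair_measure_cong) (simp_all add: sets_\<nu>)

text \<open>The \<open>\<nu>\<close>-volume of the exceedances of level 1 in the window \<open>B - t\<close>.\<close>

definition occ :: "(real ^ 'd) set \<Rightarrow> real ^ 'd \<Rightarrow> (real ^ 'd \<Rightarrow> real) \<Rightarrow> ennreal" where
  "occ B t f = (\<integral>\<^sup>+v. indicator B (v + t) * indicator {1<..} (f v) \<partial>\<nu>)"

lemma measurable_eval_comp:
  fixes g :: "'w \<Rightarrow> real ^ 'd"
  assumes "X \<in> measurable N D_space" "g \<in> borel_measurable N"
  shows "(\<lambda>\<omega>. X \<omega> (g \<omega>)) \<in> borel_measurable N"
  using measurable_compose[OF measurable_Pair[OF assms] measurable_eval_pair] by simp

lemma occ_measurable [measurable]: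
  assumes [measurable]: "B \<in> sets borel" "X \<in> measurable N D_space" "g \<in> borel_measurable N"
  shows "(\<lambda>\<omega>. occ B (g \<omega>) (X \<omega>)) \<in> borel_measurable N"
  unfolding occ_def
proof (rule \<nu>.borel_measurable_nn_integral)
  have 1: "(\<lambda>p. X (fst p) (snd p)) \<in> borel_measurable (N \<Otimes>\<^sub>M borel)"
    by (rule measurable_eval_comp) measurable
  have 2: "(\<lambda>p. snd p + g (fst p)) \<in> borel_measurable (N \<Otimes>\<^sub>M borel)" by measurable
  have "(\<lambda>p. indicator B (snd p + g (fst p)) * indicator {1<..} (X (fst p) (snd p)) :: ennreal) \<in> borel_measurable (N \<Otimes>\<^sub>M borel)"
    by (rule borel_measurable_times_ennreal[OF measurable_compose[OF 2 borel_measurable_indicator]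
          measurable_compose[OF 1 borel_measurable_indicator]]) (use assms in auto)
  then show "(\<lambda>(\<omega>, v). indicator B (v + g \<omega>) * indicator {1<..} (X \<omega> v) :: ennreal) \<in> borel_measurable (N \<Otimes>\<^sub>M \<nu>)"
    by (simp add: measurable_pair_\<nu> split_beta')
qed

lemma occ_mono: "(\<And>v. v + t \<in> B \<Longrightarrow> v + t' \<in> B') \<Longrightarrow> occ B t f \<le> occ B' t' f"
  unfolding occ_def by (intro nn_integral_mono) (auto simp: indicator_def)

lemma occ_shift:
  assumes "h \<in> H" "B \<in> sets borel" "f \<in> gcadlag"
  shows "occ B 0 f = occ B h (\<lambda>t. f (t + h))"
proof -
  have [measurable]: "f \<in> borel_measurable borel" "B \<in> sets borel" using assms measurable_gcadlag by auto
  show ?thesis unfolding occ_def using \<nu>_shift[OF assms(1), of "\<lambda>v. indicator B (v + 0) * indicator {1<..} (f v)"] by simp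
qed

lemma occ_le: "B \<in> sets borel \<Longrightarrow> occ B 0 f \<le> emeasure \<nu> B"
proof -
  assume "B \<in> sets borel"
  then have "emeasure \<nu> B = (\<integral>\<^sup>+v. indicator B v \<partial>\<nu>)" by (simp add: sets_\<nu>)
  then show ?thesis unfolding occ_def by (auto intro!: nn_integral_mono simp: indicator_def)
qed

text \<open>
  By right continuity the path exceeds 1 on a small cube with corner 0, and the half-open cell
  contains the translate by \<open>a\<close> of a small enough one.
\<close>

lemma occ_pos:
  assumes f: "f \<in> gcadlag" "1 < f 0" and a: "a \<in> cube c"
  shows "0 < occ (cube c) a f"
proof -
  have "(f \<longlongrightarrow> f 0) (at 0 within {s. \<forall>i. 0 \<le> s $ i})" using f(1) unfolding gcadlag_def by (auto dest!: spec[of _ 0])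
  then have "\<forall>\<^sub>F s in at 0 within {s. \<forall>i. 0 \<le> s $ i}. 1 < f s" using f(2) by (rule order_tendstoD)
  then obtain d where d: "0 < d" "\<And>s. (\<forall>i. 0 \<le> s $ i) \<Longrightarrow> s \<noteq> 0 \<Longrightarrow> dist s 0 < d \<Longrightarrow> 1 < f s"
    unfolding eventually_at by auto
  \<comment> \<open>small enough both to stay in the cell and, by the \<open>l1\<close>-norm, within distance \<open>d\<close> of 0\<close>
  define m where "m = Min (insert (d / real CARD('d)) (range (\<lambda>i. c - a $ i)))"
  have m: "0 < m" using a d(1) by (auto simp: m_def cube_def)
  have ml: "m \<le> d / real CARD('d)" "\<And>i. m \<le> c - a $ i"
    unfolding m_def by (rule Min_le; simp)+
  have "v + a \<in> cube c \<and> 1 < f v" if v: "v \<in> cube m" for v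
  proof
    have "0 \<le> v $ i + a $ i \<and> v $ i + a $ i < c" for i
      using v a ml(2)[of i] by (auto simp: cube_def intro: add_nonneg_nonneg) (smt (verit))
    then show "v + a \<in> cube c" by (simp add: cube_def)
    show "1 < f v"
    proof (cases "v = 0")
      case False
      have "norm v \<le> (\<Sum>i\<in>UNIV. \<bar>v $ i\<bar>)" by (rule norm_le_l1_cart)
      also have "\<dots> < (\<Sum>i\<in>(UNIV :: 'd set). m)" using v by (intro sum_strict_mono) (auto simp: cube_def)
      also have "\<dots> \<le> d" using ml(1) by (simp add: field_simps)
      finally show ?thesis using v False by (intro d(2)) (auto simp: cube_def)
    qed (use f in simp)
  qed
  then have "(\<integral>\<^sup>+v. indicator (cube m) v \<partial>\<nu>) \<le> occ (cube c) a f"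
    unfolding occ_def by (intro nn_integral_mono) (auto simp: indicator_def)
  moreover have "(\<integral>\<^sup>+v. indicator (cube m) v \<partial>\<nu>) = emeasure \<nu> (cube m)" by (simp add: sets_\<nu>)
  ultimately show ?thesis using \<nu>_corner[OF m] by simp
qed

end

section \<open>Sojourns over a box through the tail field\<close>

lemma inverse_ennreal_antimono: "u \<le> v \<Longrightarrow> inverse v \<le> inverse (u::ennreal)"
proof (cases u)
  case (real a)
  assume *: "u \<le> v"
  show ?thesis
  proof (cases v)
    case (real b)
    then show ?thesis
      using * \<open>u = ennreal a\<close> \<open>0 \<le> a\<close> by (cases "a = 0") (auto simp: inverse_ennreal intro!: ennreal_leI le_imp_inverse_le)
  qed simp
qed (auto simp: top_unique)

text \<open>
  The tail field together with one of the measures over which sojourns are taken; \<open>c\<close> is the mesh.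
\<close>

locale berman_field = spectral_tail_field M Z \<Theta> R + lattice_measure \<nu> H c
  for M :: "'w measure" and Z :: "'w \<Rightarrow> real ^ 'd::finite \<Rightarrow> real" and \<Theta> R
    and \<nu> :: "(real ^ 'd) measure" and H c +
  assumes sup_cube: "(\<integral>\<^sup>+\<omega>. (SUP t\<in>cube c. ennreal (Z \<omega> t)) \<partial>M) < \<infinity>"
begin

text \<open>
  For a box \<open>B\<close> of edge \<open>T\<close> this is \<open>T ^ d\<close> times the quantity whose limit is the Berman function.
  The path is divided by the level \<open>s\<close>, so that sojourns are always taken above 1, as for \<open>Y\<close>.
\<close>

definition excess :: "ennreal \<Rightarrow> (real ^ 'd) set \<Rightarrow> ennreal" where
  "excess x B = (\<integral>\<^sup>+\<omega>. (\<integral>\<^sup>+s. indicator {0<..} s * indicator {x<..} (occ B 0 (rescale (inverse s) (Z \<omega>))) \<partial>lborel) \<partial>M)"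

lemma rescale_Z: "\<omega> \<in> space M \<Longrightarrow> rescale s (Z \<omega>) \<in> gcadlag"
  by (intro rescale_gcadlag Z_gcadlag)

text \<open>
  On \<open>occ B 0 f > x\<close> the number 1 is the integral over \<open>t \<in> B\<close> of the exceedance indicator at \<open>t\<close>
  divided by the volume. The constraint \<open>s < Z t\<close> is then exactly the one in \<open>nn_integral_Y\<close> with
  \<open>h = t\<close>, and \<open>\<nu>\<close> is invariant under the shift by \<open>t \<in> H\<close>.
\<close>

lemma excess_eq:
  assumes B [measurable]: "B \<in> sets borel" and fin: "emeasure \<nu> B < \<infinity>"
  shows "excess x B = (\<integral>\<^sup>+t. indicator B t * (\<integral>\<^sup>+\<omega>. indicator {x<..} (occ B t (Y \<omega>)) * inverse (occ B t (Y \<omega>)) \<partial>M) \<partial>\<nu>)"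
proof -
  interpret p: pair_sigma_finite lborel \<nu> ..
  interpret q: pair_sigma_finite M \<nu> ..
  define g where "g u = indicator {x<..} u * inverse u" for u :: ennreal
  have [measurable]: "g \<in> borel_measurable borel" unfolding g_def by measurable
  \<comment> \<open>the exceedance indicator at \<open>t\<close> divided by the volume, as a function of path, level and site\<close>
  define k where "k \<omega> s t = (indicator {0<..} s * indicator {1<..} (rescale (inverse s) (Z \<omega>) t) * g (occ B 0 (rescale (inverse s) (Z \<omega>))) :: ennreal)" for \<omega> s t
  have km: "(\<lambda>p. k (fst (fst p)) (snd (fst p)) (snd p)) \<in> borel_measurable ((M \<Otimes>\<^sub>M lborel) \<Otimes>\<^sub>M borel)"
  proof -
    have [measurable]: "(\<lambda>p. rescale (inverse (snd (fst p))) (Z (fst (fst p)))) \<in> measurable ((M \<Otimes>\<^sub>M (lborel :: real measure)) \<Otimes>\<^sub>M (borel :: (real ^ 'd) measure)) D_space"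
      by measurable
    have [measurable]: "(\<lambda>p. rescale (inverse (snd (fst p))) (Z (fst (fst p))) (snd p)) \<in> borel_measurable ((M \<Otimes>\<^sub>M (lborel :: real measure)) \<Otimes>\<^sub>M (borel :: (real ^ 'd) measure))"
      by (rule measurable_eval_comp) measurable
    have 1: "(\<lambda>p. indicator {1<..} (rescale (inverse (snd (fst p))) (Z (fst (fst p))) (snd p)) :: ennreal) \<in> borel_measurable ((M \<Otimes>\<^sub>M (lborel :: real measure)) \<Otimes>\<^sub>M (borel :: (real ^ 'd) measure))"
      by (rule measurable_compose[OF _ borel_measurable_indicator]) measurable
    show ?thesis unfolding k_def by (intro borel_measurable_times_ennreal 1) measurable
  qed
  have eqs: "sets ((M \<Otimes>\<^sub>M lborel) \<Otimes>\<^sub>M \<nu>) = sets ((M \<Otimes>\<^sub>M (lborel :: real measure)) \<Otimes>\<^sub>M (borel :: (real ^ 'd) measure))"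
    by (intro sets_pair_measure_cong) (simp_all add: sets_\<nu>)
  have km\<nu> [measurable]: "(\<lambda>p. k (fst (fst p)) (snd (fst p)) (snd p)) \<in> borel_measurable ((M \<Otimes>\<^sub>M lborel) \<Otimes>\<^sub>M \<nu>)"
    using km by (simp add: measurable_cong_sets[OF eqs refl])
  have km': "(\<lambda>p. k (f p) (g p) (h p)) \<in> borel_measurable N"
    if "f \<in> measurable N M" "g \<in> borel_measurable N" "h \<in> measurable N \<nu>" for f g h and N :: "'z measure"
    using measurable_compose[OF measurable_Pair[OF measurable_Pair[OF that(1), of g lborel] that(3)] km\<nu>] that(2) by simp
  have Bm [measurable]: "indicator B \<in> borel_measurable \<nu>" by (simp add: measurable_\<nu>)
  have "excess x B = (\<integral>\<^sup>+\<omega>. (\<integral>\<^sup>+s. (\<integral>\<^sup>+t. indicator B t * k \<omega> s t \<partial>\<nu>) \<partial>lborel) \<partial>M)"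
    unfolding excess_def
  proof (intro nn_integral_cong)
    fix \<omega> and s :: real assume \<omega>: "\<omega> \<in> space M"
    define f where "f = rescale (inverse s) (Z \<omega>)"
    have f: "f \<in> gcadlag" unfolding f_def by (rule rescale_Z[OF \<omega>])
    then have fm [measurable]: "f \<in> borel_measurable \<nu>" using measurable_gcadlag[OF f] by (simp add: measurable_\<nu>)
    have u: "occ B 0 f < top" using occ_le[OF B, of f] fin by (simp add: order_le_less_trans)
    have "(\<integral>\<^sup>+t. indicator B t * k \<omega> s t \<partial>\<nu>) = (\<integral>\<^sup>+t. indicator B (t + 0) * indicator {1<..} (f t) * (indicator {0<..} s * g (occ B 0 f)) \<partial>\<nu>)"
      by (intro nn_integral_cong) (simp add: k_def f_def ac_simps)
    also have "\<dots> = occ B 0 f * (indicator {0<..} s * g (occ B 0 f))"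
    proof -
      have "(\<lambda>t. indicator B t * indicator {1<..} (f t) :: ennreal) \<in> borel_measurable \<nu>"
        by (rule borel_measurable_times_ennreal[OF Bm measurable_compose[OF fm borel_measurable_indicator]]) simp
      then show ?thesis unfolding occ_def by (intro nn_integral_multc) simp
    qed
    also have "\<dots> = indicator {0<..} s * indicator {x<..} (occ B 0 f)"
      using u ennreal_divide_self[of "occ B 0 f"] gr_implies_not_zero[of x "occ B 0 f"]
      by (cases "x < occ B 0 f") (auto simp: g_def divide_ennreal_def mult.left_commute)
    finally show "indicator {0<..} s * indicator {x<..} (occ B 0 (rescale (inverse s) (Z \<omega>))) = (\<integral>\<^sup>+t. indicator B t * k \<omega> s t \<partial>\<nu>)"
      by (simp add: f_def)
  qed
  also have "\<dots> = (\<integral>\<^sup>+\<omega>. (\<integral>\<^sup>+t. indicator B t * (\<integral>\<^sup>+s. k \<omega> s t \<partial>lborel) \<partial>\<nu>) \<partial>M)"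
  proof (intro nn_integral_cong)
    fix \<omega> assume \<omega>: "\<omega> \<in> space M"
    have [measurable]: "(\<lambda>p. k \<omega> (fst p) (snd p)) \<in> borel_measurable (lborel \<Otimes>\<^sub>M \<nu>)"
      by (rule km') (use \<omega> in auto)
    have [measurable]: "(\<lambda>s. k \<omega> s t) \<in> borel_measurable lborel" if "t \<in> space \<nu>" for t
      by (rule km') (use \<omega> that in auto)
    have "(\<integral>\<^sup>+s. (\<integral>\<^sup>+t. indicator B t * k \<omega> s t \<partial>\<nu>) \<partial>lborel) = (\<integral>\<^sup>+t. (\<integral>\<^sup>+s. indicator B t * k \<omega> s t \<partial>lborel) \<partial>\<nu>)"
      by (rule p.Fubini'[symmetric]) (simp add: split_beta')
    also have "\<dots> = (\<integral>\<^sup>+t. indicator B t * (\<integral>\<^sup>+s. k \<omega> s t \<partial>lborel) \<partial>\<nu>)"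
      by (intro nn_integral_cong nn_integral_cmult) measurable
    finally show "(\<integral>\<^sup>+s. (\<integral>\<^sup>+t. indicator B t * k \<omega> s t \<partial>\<nu>) \<partial>lborel) = (\<integral>\<^sup>+t. indicator B t * (\<integral>\<^sup>+s. k \<omega> s t \<partial>lborel) \<partial>\<nu>)" .
  qed
  also have "\<dots> = (\<integral>\<^sup>+t. indicator B t * (\<integral>\<^sup>+\<omega>. (\<integral>\<^sup>+s. k \<omega> s t \<partial>lborel) \<partial>M) \<partial>\<nu>)"
  proof -
    have "(\<lambda>p. k (fst (fst p)) (snd p) (snd (fst p))) \<in> borel_measurable ((M \<Otimes>\<^sub>M \<nu>) \<Otimes>\<^sub>M lborel)"
      by (rule km') measurable
    then have ks [measurable]: "(\<lambda>p. \<integral>\<^sup>+s. k (fst p) s (snd p) \<partial>lborel) \<in> borel_measurable (M \<Otimes>\<^sub>M \<nu>)"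
      by (intro lborel.borel_measurable_nn_integral) (simp add: split_beta')
    have [measurable]: "(\<lambda>\<omega>. \<integral>\<^sup>+s. k \<omega> s t \<partial>lborel) \<in> borel_measurable M" if "t \<in> space \<nu>" for t
      using measurable_compose[OF measurable_Pair2'[OF that] ks] by simp
    have "(\<integral>\<^sup>+\<omega>. (\<integral>\<^sup>+t. indicator B t * (\<integral>\<^sup>+s. k \<omega> s t \<partial>lborel) \<partial>\<nu>) \<partial>M) = (\<integral>\<^sup>+t. (\<integral>\<^sup>+\<omega>. indicator B t * (\<integral>\<^sup>+s. k \<omega> s t \<partial>lborel) \<partial>M) \<partial>\<nu>)"
      by (rule q.Fubini'[symmetric]) (simp add: split_beta')
    also have "\<dots> = (\<integral>\<^sup>+t. indicator B t * (\<integral>\<^sup>+\<omega>. (\<integral>\<^sup>+s. k \<omega> s t \<partial>lborel) \<partial>M) \<partial>\<nu>)"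
      by (intro nn_integral_cong nn_integral_cmult) measurable
    finally show ?thesis .
  qed
  also have "\<dots> = (\<integral>\<^sup>+t. indicator B t * (\<integral>\<^sup>+\<omega>. g (occ B t (Y \<omega>)) \<partial>M) \<partial>\<nu>)"
  proof (intro nn_integral_cong_AE, use \<nu>_concentrated in eventually_elim)
    case (elim t)
    have "(\<integral>\<^sup>+\<omega>. g (occ B t (Y \<omega>)) \<partial>M)
       = (\<integral>\<^sup>+\<omega>. (\<integral>\<^sup>+s. indicator {0<..<Z \<omega> t} s * g (occ B t (rescale (inverse s) (\<lambda>v. Z \<omega> (v + t)))) \<partial>lborel) \<partial>M)"
      by (rule nn_integral_Y) measurable
    also have "\<dots> = (\<integral>\<^sup>+\<omega>. (\<integral>\<^sup>+s. k \<omega> s t \<partial>lborel) \<partial>M)"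
    proof (intro nn_integral_cong)
      fix \<omega> and s :: real assume \<omega>: "\<omega> \<in> space M"
      have "occ B 0 (rescale (inverse s) (Z \<omega>)) = occ B t (rescale (inverse s) (\<lambda>v. Z \<omega> (v + t)))"
        using occ_shift[OF elim B rescale_Z[OF \<omega>], of "inverse s"] by (simp add: rescale_def)
      moreover have "1 < rescale (inverse s) (Z \<omega>) t \<longleftrightarrow> s < Z \<omega> t" if "0 < s"
        using that by (simp add: rescale_def field_simps)
      ultimately show "indicator {0<..<Z \<omega> t} s * g (occ B t (rescale (inverse s) (\<lambda>v. Z \<omega> (v + t)))) = k \<omega> s t"
        by (auto simp: k_def indicator_def)
    qed
    finally show ?case by simp
  qed
  finally show ?thesis by (simp add: g_def)
qed

lemma Y_occ_pos:
  assumes "a \<in> cube c" shows "AE \<omega> in M. 0 < occ (cube c) a (Y \<omega>)"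
proof -
  have "(\<integral>\<^sup>+\<omega>. indicator {0} (occ (cube c) a (Y \<omega>)) \<partial>M)
     = (\<integral>\<^sup>+\<omega>. (\<integral>\<^sup>+s. indicator {0<..<Z \<omega> 0} s * indicator {0} (occ (cube c) a (rescale (inverse s) (\<lambda>t. Z \<omega> (t + 0)))) \<partial>lborel) \<partial>M)"
    by (rule nn_integral_Y) measurable
  also have "\<dots> = (\<integral>\<^sup>+\<omega>. (\<integral>\<^sup>+s. 0 \<partial>(lborel :: real measure)) \<partial>M)"
  proof (intro nn_integral_cong)
    fix \<omega> and s :: real assume \<omega>: "\<omega> \<in> space M"
    have "0 < occ (cube c) a (rescale (inverse s) (Z \<omega>))" if "0 < s" "s < Z \<omega> 0"
      using that by (intro occ_pos rescale_Z \<omega> assms) (simp add: rescale_def field_simps)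
    then show "indicator {0<..<Z \<omega> 0} s * indicator {0} (occ (cube c) a (rescale (inverse s) (\<lambda>t. Z \<omega> (t + 0)))) = (0 :: ennreal)"
      by (auto simp: indicator_def)
  qed
  finally have "(\<integral>\<^sup>+\<omega>. indicator {0} (occ (cube c) a (Y \<omega>)) \<partial>M) = 0" by simp
  moreover have "(\<lambda>\<omega>. indicator {0} (occ (cube c) a (Y \<omega>)) :: ennreal) \<in> borel_measurable M"
    by measurable
  ultimately have "AE \<omega> in M. indicator {0} (occ (cube c) a (Y \<omega>)) = (0 :: ennreal)"
    using nn_integral_0_iff_AE by blast
  then show ?thesis by eventually_elim (auto simp: indicator_def zero_less_iff_neq_zero split: if_splits)
qed

text \<open>
  The contribution of a cell to \<open>excess\<close> in the worst case, in which no exceedances outside the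
  cell are taken into account.
\<close>

definition cell_bound :: ennreal where
  "cell_bound = (\<integral>\<^sup>+a. indicator (cube c) a * (\<integral>\<^sup>+\<omega>. inverse (occ (cube c) a (Y \<omega>)) \<partial>M) \<partial>\<nu>)"

text \<open>
  By \<open>excess_eq\<close> the bound is the integrated probability that \<open>Z\<close> exceeds the level somewhere in the
  cell in positive volume, hence at most the expected supremum over the cell.
\<close>

lemma cell_bound_finite: "cell_bound < \<infinity>"
proof -
  have "cell_bound = excess 0 (cube c)"
    unfolding cell_bound_def
  proof (subst excess_eq)
    have "(\<integral>\<^sup>+\<omega>. inverse (occ (cube c) a (Y \<omega>)) \<partial>M)
        = (\<integral>\<^sup>+\<omega>. indicator {0<..} (occ (cube c) a (Y \<omega>)) * inverse (occ (cube c) a (Y \<omega>)) \<partial>M)" if "a \<in> cube c" for a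
      by (rule nn_integral_cong_AE) (use Y_occ_pos[OF that] in eventually_elim, simp)
    then show "(\<integral>\<^sup>+a. indicator (cube c) a * (\<integral>\<^sup>+\<omega>. inverse (occ (cube c) a (Y \<omega>)) \<partial>M) \<partial>\<nu>)
      = (\<integral>\<^sup>+a. indicator (cube c) a * (\<integral>\<^sup>+\<omega>. indicator {0<..} (occ (cube c) a (Y \<omega>)) * inverse (occ (cube c) a (Y \<omega>)) \<partial>M) \<partial>\<nu>)"
      by (intro nn_integral_cong) (simp add: indicator_def)
  qed (auto simp: \<nu>_cube)
  also have "\<dots> \<le> (\<integral>\<^sup>+\<omega>. (\<integral>\<^sup>+s. indicator {0..} s * indicator {s. ennreal s < (SUP t\<in>cube c. ennreal (Z \<omega> t))} s \<partial>lborel) \<partial>M)"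
    unfolding excess_def
  proof (intro nn_integral_mono)
    fix \<omega> and s :: real
    have "ennreal s < (SUP t\<in>cube c. ennreal (Z \<omega> t))" if s: "0 < s" and pos: "0 < occ (cube c) 0 (rescale (inverse s) (Z \<omega>))"
    proof (rule ccontr)
      assume "\<not> ?thesis"
      then have "ennreal (Z \<omega> t) \<le> ennreal s" if "t \<in> cube c" for t
        using that by (auto simp: not_less SUP_le_iff)
      then have "Z \<omega> t \<le> s" if "t \<in> cube c" for t
        using that s by (simp add: ennreal_le_iff)
      then have "occ (cube c) 0 (rescale (inverse s) (Z \<omega>)) = (\<integral>\<^sup>+t. 0 \<partial>\<nu>)"
        unfolding occ_def using s by (intro nn_integral_cong) (auto simp: indicator_def rescale_def field_simps not_less)
      with pos show False by simp
    qed
    then show "indicator {0<..} s * indicator {0<..} (occ (cube c) 0 (rescale (inverse s) (Z \<omega>)))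
       \<le> (indicator {0..} s * indicator {s. ennreal s < (SUP t\<in>cube c. ennreal (Z \<omega> t))} s :: ennreal)"
      by (auto simp: indicator_def)
  qed
  also have "\<dots> = (\<integral>\<^sup>+\<omega>. (SUP t\<in>cube c. ennreal (Z \<omega> t)) \<partial>M)" by (simp add: nn_integral_layer)
  also note sup_cube
  finally show ?thesis .
qed

end

section \<open>Decomposition of a box into cells\<close>

context lattice_measure begin

definition corner :: "('d \<Rightarrow> nat) \<Rightarrow> real ^ 'd" where
  "corner k = (\<chi> i. c * real (k i))"

lemma cell_index:
  "t - corner k \<in> cube c \<longleftrightarrow> (\<forall>i. 0 \<le> t $ i) \<and> k = (\<lambda>i. nat \<lfloor>t $ i / c\<rfloor>)"
proof -
  have "0 \<le> t $ i - c * real (k i) \<and> t $ i - c * real (k i) < c \<longleftrightarrow> 0 \<le> t $ i \<and> k i = nat \<lfloor>t $ i / c\<rfloor>" for i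
  proof -
    have "0 \<le> t $ i - c * real (k i) \<and> t $ i - c * real (k i) < c \<longleftrightarrow> real (k i) \<le> t $ i / c \<and> t $ i / c < real (k i) + 1"
      using c_pos by (simp add: field_simps)
    also have "\<dots> \<longleftrightarrow> \<lfloor>t $ i / c\<rfloor> = int (k i)" by (simp add: floor_eq_iff)
    also have "\<dots> \<longleftrightarrow> 0 \<le> t $ i \<and> k i = nat \<lfloor>t $ i / c\<rfloor>"
      using c_pos by (auto simp: zero_le_divide_iff) (metis floor_less_zero divide_less_0_iff int_nat_eq not_less of_nat_less_0_iff zero_le_divide_iff)
    finally show ?thesis .
  qed
  then show ?thesis by (auto simp: cube_def corner_def fun_eq_iff)
qed

lemma indicator_cube_cells:
  "indicator (cube (c * real n)) t = (\<Sum>k\<in>PiE UNIV (\<lambda>_. {..<n}). indicator (cube c) (t - corner k) :: ennreal)"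
proof -
  let ?k = "\<lambda>i. nat \<lfloor>t $ i / c\<rfloor>"
  have "(\<Sum>k\<in>PiE UNIV (\<lambda>_. {..<n}). indicator (cube c) (t - corner k) :: ennreal)
      = (\<Sum>k\<in>PiE UNIV (\<lambda>_. {..<n}). if k = ?k then (if \<forall>i. 0 \<le> t $ i then 1 else 0) else 0)"
    by (intro sum.cong) (auto simp: indicator_def cell_index)
  also have "\<dots> = (if (\<forall>i. 0 \<le> t $ i) \<and> ?k \<in> PiE UNIV (\<lambda>_. {..<n}) then 1 else 0)"
    by (subst sum.delta) (auto intro!: finite_PiE)
  also have "\<dots> = indicator (cube (c * real n)) t"
  proof -
    have "nat \<lfloor>t $ i / c\<rfloor> < n \<longleftrightarrow> t $ i < c * real n" if "0 \<le> t $ i" for i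
    proof -
      have "nat \<lfloor>t $ i / c\<rfloor> < n \<longleftrightarrow> \<lfloor>t $ i / c\<rfloor> < int n"
        using that c_pos by (simp add: nat_less_iff)
      also have "\<dots> \<longleftrightarrow> t $ i / c < real n" by (simp add: floor_less_iff)
      finally show ?thesis using c_pos by (simp add: field_simps)
    qed
    then show ?thesis by (auto simp: indicator_def cube_def PiE_iff)
  qed
  finally show ?thesis by simp
qed

lemma nn_integral_cube_cells:
  assumes [measurable]: "G \<in> borel_measurable borel"
  shows "(\<integral>\<^sup>+t. indicator (cube (c * real n)) t * G t \<partial>\<nu>)
    = (\<Sum>k\<in>PiE UNIV (\<lambda>_. {..<n}). \<integral>\<^sup>+a. indicator (cube c) a * G (a + corner k) \<partial>\<nu>)"
proof -
  have [measurable]: "(\<lambda>t. indicator (cube c) (t - corner k) * G t) \<in> borel_measurable borel" for k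
    by measurable
  have "(\<integral>\<^sup>+t. indicator (cube (c * real n)) t * G t \<partial>\<nu>)
    = (\<integral>\<^sup>+t. (\<Sum>k\<in>PiE UNIV (\<lambda>_. {..<n}). indicator (cube c) (t - corner k) * G t) \<partial>\<nu>)"
    by (simp add: indicator_cube_cells sum_distrib_right)
  also have "\<dots> = (\<Sum>k\<in>PiE UNIV (\<lambda>_. {..<n}). \<integral>\<^sup>+t. indicator (cube c) (t - corner k) * G t \<partial>\<nu>)"
    by (intro nn_integral_sum) (simp add: measurable_\<nu>)
  also have "\<dots> = (\<Sum>k\<in>PiE UNIV (\<lambda>_. {..<n}). \<integral>\<^sup>+a. indicator (cube c) a * G (a + corner k) \<partial>\<nu>)"
  proof (intro sum.cong refl)
    fix k
    have "corner k \<in> H" unfolding corner_def by (rule multiples_H)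
    from \<nu>_shift[OF this, of "\<lambda>t. indicator (cube c) (t - corner k) * G t"]
    show "(\<integral>\<^sup>+t. indicator (cube c) (t - corner k) * G t \<partial>\<nu>) = (\<integral>\<^sup>+a. indicator (cube c) a * G (a + corner k) \<partial>\<nu>)"
      by simp
  qed
  finally show ?thesis .
qed

lemma emeasure_cubes: "emeasure \<nu> (cube (c * real n)) < \<infinity>"
proof -
  have "emeasure \<nu> (cube (c * real n)) = (\<integral>\<^sup>+t. indicator (cube (c * real n)) t * 1 \<partial>\<nu>)"
    by (simp add: sets_\<nu>)
  also have "\<dots> = (\<Sum>k\<in>PiE (UNIV :: 'd set) (\<lambda>_. {..<n}). \<integral>\<^sup>+a. indicator (cube c) a * 1 \<partial>\<nu>)"
    by (rule nn_integral_cube_cells[of "\<lambda>_. 1"]) auto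
  also have "\<dots> < \<infinity>" by (simp add: sets_\<nu> \<nu>_cube ennreal_mult_less_top of_nat_less_top)
  finally show ?thesis .
qed

text \<open>
  A centred window that is contained in the box seen from any point of a cell at least \<open>m\<close> cells away
  from the boundary.
\<close>

definition core :: "nat \<Rightarrow> (real ^ 'd) set" where
  "core m = {v. \<forall>i. - (c * real m) \<le> v $ i \<and> v $ i < c * real m}"

lemma core_borel [measurable]: "core m \<in> sets borel"
proof -
  have "{v :: real ^ 'd \<in> space borel. \<forall>i. - (c * real m) \<le> v $ i \<and> v $ i < c * real m} \<in> sets borel" by measurable
  then show ?thesis by (simp add: core_def)
qed

lemma core_in_cube:
  assumes "a \<in> cube c" "v \<in> core m" "\<And>i. m \<le> k i" "\<And>i. k i < n - m"
  shows "v + (a + corner k) \<in> cube (c * real n)"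
  unfolding cube_def
proof (clarsimp, intro conjI)
  fix i
  have "c * real m \<le> c * real (k i)" using assms(3)[of i] c_pos by simp
  then show "0 \<le> v $ i + (a $ i + corner k $ i)"
    using assms(1,2) by (auto simp: cube_def core_def corner_def) (smt (verit))
  have "real (k i) + 1 + real m \<le> real n" using assms(4)[of i] by linarith
  then have "c * (real (k i) + 1 + real m) \<le> c * real n" using c_pos by simp
  then show "v $ i + (a $ i + corner k $ i) < c * real n"
    using assms(1,2) by (auto simp: cube_def core_def corner_def distrib_left) (smt (verit))
qed

lemma cell_in_cube:
  assumes "v + a \<in> cube c" "k \<in> PiE UNIV (\<lambda>_. {..<n})"
  shows "v + (a + corner k) \<in> cube (c * real n)"
  unfolding cube_def
proof (clarsimp, intro conjI)
  fix i
  have va: "0 \<le> v $ i + a $ i" "v $ i + a $ i < c" using assms(1) by (auto simp: cube_def)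
  then show "0 \<le> v $ i + (a $ i + corner k $ i)"
    using c_pos by (simp add: corner_def add.assoc[symmetric])
  have "real (k i) + 1 \<le> real n" using assms(2) by (auto simp: PiE_iff) (metis Suc_leI of_nat_Suc of_nat_le_iff add.commute)
  then have "c * (real (k i) + 1) \<le> c * real n" using c_pos by simp
  then show "v $ i + (a $ i + corner k $ i) < c * real n"
    using va by (simp add: corner_def distrib_left)
qed

lemma cell_in_core:
  assumes "a \<in> cube c" "v + a \<in> cube c" shows "v \<in> core (Suc m)"
  unfolding core_def
proof (clarsimp)
  fix i
  have "0 \<le> a $ i" "a $ i < c" "0 \<le> v $ i + a $ i" "v $ i + a $ i < c" "0 \<le> c * real m"
    using assms c_pos by (auto simp: cube_def)
  moreover have "c * (1 + real m) = c + c * real m" by (simp add: distrib_left)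
  ultimately show "- (c * (1 + real m)) \<le> v $ i \<and> v $ i < c * (1 + real m)"
    by linarith
qed

lemma occ_core_tendsto:
  assumes [measurable]: "f \<in> gcadlag"
  shows "incseq (\<lambda>m. occ (core m) 0 f)" "(\<lambda>m. occ (core m) 0 f) \<longlonglongrightarrow> occ UNIV 0 f"
proof -
  have mono: "core m \<subseteq> core n" if "m \<le> n" for m n
  proof -
    have "c * real m \<le> c * real n" using that c_pos by simp
    then show ?thesis unfolding core_def by (auto intro: order_trans less_le_trans) (smt (verit))
  qed
  then show "incseq (\<lambda>m. occ (core m) 0 f)"
    by (auto simp: incseq_def intro!: occ_mono)
  have fm: "f \<in> borel_measurable \<nu>" using measurable_gcadlag[OF assms] by (simp add: measurable_\<nu>)
  show "(\<lambda>m. occ (core m) 0 f) \<longlonglongrightarrow> occ UNIV 0 f"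
    unfolding occ_def
  proof (rule nn_integral_LIMSEQ)
    show "incseq (\<lambda>m v. indicator (core m) (v + 0) * indicator {1<..} (f v) :: ennreal)"
      using mono by (auto simp: incseq_def le_fun_def indicator_def)
    show "(\<lambda>v. indicator (core m) (v + 0) * indicator {1<..} (f v) :: ennreal) \<in> borel_measurable \<nu>" for m
      by (intro borel_measurable_times_ennreal measurable_compose[OF fm borel_measurable_indicator]) (simp_all add: measurable_\<nu>)
    fix v :: "real ^ 'd"
    obtain N where N: "(\<Sum>i\<in>UNIV. \<bar>v $ i\<bar>) / c < real N" using reals_Archimedean2 by blast
    have "v \<in> core m" if "N \<le> m" for m
    proof -
      have "\<bar>v $ i\<bar> < c * real m" for i
      proof -
        have "\<bar>v $ i\<bar> \<le> (\<Sum>i\<in>UNIV. \<bar>v $ i\<bar>)" by (intro member_le_sum) auto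
        also have "\<dots> < c * real N" using N c_pos by (simp add: field_simps)
        also have "\<dots> \<le> c * real m" using that c_pos by simp
        finally show ?thesis .
      qed
      then show ?thesis unfolding core_def by (auto simp: abs_less_iff) (smt (verit))
    qed
    then have "\<forall>\<^sub>F m in sequentially. indicator (core m) (v + 0) * indicator {1<..} (f v) = (indicator UNIV (v + 0) * indicator {1<..} (f v) :: ennreal)"
      by (auto simp: eventually_sequentially indicator_def)
    then show "(\<lambda>m. indicator (core m) (v + 0) * indicator {1<..} (f v) :: ennreal) \<longlonglongrightarrow> indicator UNIV (v + 0) * indicator {1<..} (f v)"
      by (rule tendsto_eventually)
  qed
qed

end

lemma card_box: "card (PiE (UNIV :: 'd::finite set) (\<lambda>_. {..<n})) = n ^ CARD('d)"
  and card_inner_box: "card (PiE (UNIV :: 'd::finite set) (\<lambda>_. {m..<n - m})) = (n - 2 * m) ^ CARD('d)"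
  by (simp_all add: card_PiE mult_2)

lemma inner_box_subset: "PiE (UNIV :: 'd set) (\<lambda>_. {m..<n - m}) \<subseteq> PiE UNIV (\<lambda>_. {..<n :: nat})"
  by (rule PiE_mono) auto

context berman_field begin

text \<open>
  Bounds for the contribution per unit volume of a point at distance at least \<open>m\<close> cells from the
  boundary: its window lies between \<open>core m\<close> and the whole space.
\<close>

definition lower :: "ennreal \<Rightarrow> nat \<Rightarrow> ennreal" where
  "lower x m = (\<integral>\<^sup>+\<omega>. indicator {x<..} (occ (core m) 0 (Y \<omega>)) * inverse (occ UNIV 0 (Y \<omega>)) \<partial>M)"

definition upper :: "ennreal \<Rightarrow> nat \<Rightarrow> ennreal" where
  "upper x m = (\<integral>\<^sup>+\<omega>. indicator {x<..} (occ UNIV 0 (Y \<omega>)) * inverse (occ (core m) 0 (Y \<omega>)) \<partial>M)"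

text \<open>
  The value of the Berman function; realisations of infinite exceedance volume contribute 0.
\<close>

definition berman_constant :: "ennreal \<Rightarrow> ennreal" where
  "berman_constant x = (\<integral>\<^sup>+\<omega>. indicator {x<..} (occ UNIV 0 (Y \<omega>)) * inverse (occ UNIV 0 (Y \<omega>)) \<partial>M)"

definition cell :: "ennreal \<Rightarrow> nat \<Rightarrow> ('d \<Rightarrow> nat) \<Rightarrow> ennreal" where
  "cell x n k = (\<integral>\<^sup>+a. indicator (cube c) a * (\<integral>\<^sup>+\<omega>. indicator {x<..} (occ (cube (c * real n)) (a + corner k) (Y \<omega>))
      * inverse (occ (cube (c * real n)) (a + corner k) (Y \<omega>)) \<partial>M) \<partial>\<nu>)"

lemma indicator_le_1: "indicator A x \<le> (1::ennreal)"
  by (simp add: indicator_def)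

lemma excess_cells: "excess x (cube (c * real n)) = (\<Sum>k\<in>PiE UNIV (\<lambda>_. {..<n}). cell x n k)"
proof -
  have "(\<lambda>p. indicator {x<..} (occ (cube (c * real n)) (snd p) (Y (fst p))) * inverse (occ (cube (c * real n)) (snd p) (Y (fst p))))
     \<in> borel_measurable (M \<Otimes>\<^sub>M borel)" by measurable
  then have "(\<lambda>p. indicator {x<..} (occ (cube (c * real n)) (fst p) (Y (snd p))) * inverse (occ (cube (c * real n)) (fst p) (Y (snd p))))
     \<in> borel_measurable (borel \<Otimes>\<^sub>M M)" by measurable
  then have "(\<lambda>t. \<integral>\<^sup>+\<omega>. indicator {x<..} (occ (cube (c * real n)) t (Y \<omega>)) * inverse (occ (cube (c * real n)) t (Y \<omega>)) \<partial>M)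
     \<in> borel_measurable borel"
    by (intro borel_measurable_nn_integral) (simp add: split_beta')
  from nn_integral_cube_cells[OF this, of n] show ?thesis
    by (subst excess_eq) (auto simp: emeasure_cubes[simplified] cell_def)
qed

lemma const_cell: "(\<integral>\<^sup>+a. indicator (cube c) a * C \<partial>\<nu>) = ennreal (c ^ CARD('d)) * C"
  by (subst nn_integral_multc) (simp_all add: sets_\<nu> \<nu>_cube measurable_\<nu>)

lemma cell_le_bound:
  assumes "k \<in> PiE UNIV (\<lambda>_. {..<n})" shows "cell x n k \<le> cell_bound"
  unfolding cell_def cell_bound_def
proof (intro nn_integral_mono mult_left_mono)
  fix a \<omega>
  have "occ (cube c) a (Y \<omega>) \<le> occ (cube (c * real n)) (a + corner k) (Y \<omega>)"
    by (rule occ_mono) (rule cell_in_cube[OF _ assms])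
  then show "indicator {x<..} (occ (cube (c * real n)) (a + corner k) (Y \<omega>)) * inverse (occ (cube (c * real n)) (a + corner k) (Y \<omega>))
      \<le> inverse (occ (cube c) a (Y \<omega>))"
    using mult_mono[OF indicator_le_1 inverse_ennreal_antimono] by (metis mult_1 zero_le)
qed simp

lemma cell_ge_lower:
  assumes "k \<in> PiE UNIV (\<lambda>_. {m..<n - m})" shows "ennreal (c ^ CARD('d)) * lower x m \<le> cell x n k"
  unfolding const_cell[symmetric] cell_def
proof (intro nn_integral_mono)
  fix a
  show "indicator (cube c) a * lower x m \<le> indicator (cube c) a * (\<integral>\<^sup>+\<omega>. indicator {x<..} (occ (cube (c * real n)) (a + corner k) (Y \<omega>))
      * inverse (occ (cube (c * real n)) (a + corner k) (Y \<omega>)) \<partial>M)"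
  proof (cases "a \<in> cube c")
    case True
    have "indicator {x<..} (occ (core m) 0 (Y \<omega>)) * inverse (occ UNIV 0 (Y \<omega>))
       \<le> indicator {x<..} (occ (cube (c * real n)) (a + corner k) (Y \<omega>)) * inverse (occ (cube (c * real n)) (a + corner k) (Y \<omega>))" for \<omega>
    proof -
      have 1: "occ (core m) 0 (Y \<omega>) \<le> occ (cube (c * real n)) (a + corner k) (Y \<omega>)"
        by (rule occ_mono) (rule core_in_cube[OF True], use assms in \<open>auto simp: PiE_iff\<close>)
      have 2: "occ (cube (c * real n)) (a + corner k) (Y \<omega>) \<le> occ UNIV 0 (Y \<omega>)" by (rule occ_mono) simp
      show ?thesis
        using 1 inverse_ennreal_antimono[OF 2] by (auto simp: indicator_def dest: less_le_trans)
    qed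
    then show ?thesis using True by (auto simp: lower_def intro!: nn_integral_mono)
  qed simp
qed

lemma cell_le_upper:
  assumes "k \<in> PiE UNIV (\<lambda>_. {m..<n - m})" shows "cell x n k \<le> ennreal (c ^ CARD('d)) * upper x m"
  unfolding const_cell[symmetric] cell_def
proof (intro nn_integral_mono)
  fix a
  show "indicator (cube c) a * (\<integral>\<^sup>+\<omega>. indicator {x<..} (occ (cube (c * real n)) (a + corner k) (Y \<omega>))
      * inverse (occ (cube (c * real n)) (a + corner k) (Y \<omega>)) \<partial>M) \<le> indicator (cube c) a * upper x m"
  proof (cases "a \<in> cube c")
    case True
    have "indicator {x<..} (occ (cube (c * real n)) (a + corner k) (Y \<omega>)) * inverse (occ (cube (c * real n)) (a + corner k) (Y \<omega>))
       \<le> indicator {x<..} (occ UNIV 0 (Y \<omega>)) * inverse (occ (core m) 0 (Y \<omega>))" for \<omega>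
    proof -
      have 1: "occ (core m) 0 (Y \<omega>) \<le> occ (cube (c * real n)) (a + corner k) (Y \<omega>)"
        by (rule occ_mono) (rule core_in_cube[OF True], use assms in \<open>auto simp: PiE_iff\<close>)
      have 2: "occ (cube (c * real n)) (a + corner k) (Y \<omega>) \<le> occ UNIV 0 (Y \<omega>)" by (rule occ_mono) simp
      show ?thesis
        using 2 inverse_ennreal_antimono[OF 1] by (auto simp: indicator_def dest: less_le_trans)
    qed
    then show ?thesis using True by (auto simp: upper_def intro!: nn_integral_mono)
  qed simp
qed

lemma excess_ge_lower:
  "of_nat ((n - 2 * m) ^ CARD('d)) * (ennreal (c ^ CARD('d)) * lower x m) \<le> excess x (cube (c * real n))"
proof -
  let ?I = "PiE UNIV (\<lambda>_ :: 'd. {m..<n - m})"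
  have "of_nat ((n - 2 * m) ^ CARD('d)) * (ennreal (c ^ CARD('d)) * lower x m) = (\<Sum>k\<in>?I. ennreal (c ^ CARD('d)) * lower x m)"
    by (simp add: card_inner_box)
  also have "\<dots> \<le> (\<Sum>k\<in>?I. cell x n k)" by (intro sum_mono cell_ge_lower)
  also have "\<dots> \<le> (\<Sum>k\<in>PiE UNIV (\<lambda>_. {..<n}). cell x n k)"
    using inner_box_subset by (intro sum_mono2) (auto intro!: finite_PiE)
  finally show ?thesis by (simp add: excess_cells)
qed

text \<open>
  Inner cells are bounded through \<open>core m\<close>, the others by \<open>cell_bound\<close>; for fixed \<open>m\<close> the latter are
  of smaller order.
\<close>

lemma excess_le_upper:
  "excess x (cube (c * real n)) \<le> of_nat ((n - 2 * m) ^ CARD('d)) * (ennreal (c ^ CARD('d)) * upper x m)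
    + of_nat (n ^ CARD('d) - (n - 2 * m) ^ CARD('d)) * cell_bound"
proof -
  let ?I = "PiE UNIV (\<lambda>_ :: 'd. {m..<n - m})" and ?J = "PiE UNIV (\<lambda>_ :: 'd. {..<n})"
  have fin: "finite ?J" by (intro finite_PiE) auto
  have sub: "?I \<subseteq> ?J" by (rule inner_box_subset)
  have "excess x (cube (c * real n)) = (\<Sum>k\<in>?I. cell x n k) + (\<Sum>k\<in>?J - ?I. cell x n k)"
    unfolding excess_cells by (metis add.commute sum.subset_diff[OF sub fin])
  also have "\<dots> \<le> (\<Sum>k\<in>?I. ennreal (c ^ CARD('d)) * upper x m) + (\<Sum>k\<in>?J - ?I. cell_bound)"
    by (intro add_mono sum_mono cell_le_upper cell_le_bound) auto
  also have "\<dots> = of_nat ((n - 2 * m) ^ CARD('d)) * (ennreal (c ^ CARD('d)) * upper x m)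
    + of_nat (n ^ CARD('d) - (n - 2 * m) ^ CARD('d)) * cell_bound"
    using card_Diff_subset[OF finite_subset[OF sub fin] sub] by (simp add: card_inner_box card_box)
  finally show ?thesis .
qed

text \<open>
  From each of its points a cell is seen within \<open>core 1\<close>, so averaging over the cell bounds the
  expectation by \<open>cell_bound\<close>. This provides the dominating function for both limits in \<open>m\<close>.
\<close>

lemma expectation_inverse_core: "(\<integral>\<^sup>+\<omega>. inverse (occ (core (Suc m)) 0 (Y \<omega>)) \<partial>M) < \<infinity>"
proof -
  have "ennreal (c ^ CARD('d)) * (\<integral>\<^sup>+\<omega>. inverse (occ (core (Suc m)) 0 (Y \<omega>)) \<partial>M) \<le> cell_bound"
    unfolding const_cell[symmetric] cell_bound_def
  proof (intro nn_integral_mono)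
    fix a
    show "indicator (cube c) a * (\<integral>\<^sup>+\<omega>. inverse (occ (core (Suc m)) 0 (Y \<omega>)) \<partial>M)
      \<le> indicator (cube c) a * (\<integral>\<^sup>+\<omega>. inverse (occ (cube c) a (Y \<omega>)) \<partial>M)"
      by (cases "a \<in> cube c")
        (auto intro!: nn_integral_mono inverse_ennreal_antimono occ_mono cell_in_core)
  qed
  also note cell_bound_finite
  finally show ?thesis using c_pos by (auto simp: ennreal_mult_less_top)
qed

lemma upper_tendsto: "(\<lambda>m. upper x (Suc m)) \<longlonglongrightarrow> berman_constant x"
  unfolding upper_def berman_constant_def
proof (rule nn_integral_dominated_convergence[where w = "\<lambda>\<omega>. inverse (occ (core (Suc 0)) 0 (Y \<omega>))"])
  show "AE \<omega> in M. indicator {x<..} (occ UNIV 0 (Y \<omega>)) * inverse (occ (core (Suc m)) 0 (Y \<omega>)) \<le> inverse (occ (core (Suc 0)) 0 (Y \<omega>))" for m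
  proof (intro AE_I2)
    fix \<omega> assume "\<omega> \<in> space M"
    then have "Y \<omega> \<in> gcadlag" using measurable_space[OF Y_measurable] by (simp add: space_D)
    from incseqD[OF occ_core_tendsto(1)[OF this], of "Suc 0" "Suc m"]
    show "indicator {x<..} (occ UNIV 0 (Y \<omega>)) * inverse (occ (core (Suc m)) 0 (Y \<omega>)) \<le> inverse (occ (core (Suc 0)) 0 (Y \<omega>))"
      using mult_mono[OF indicator_le_1 inverse_ennreal_antimono] by (metis Suc_le_mono mult_1 zero_le)
  qed
  show "AE \<omega> in M. (\<lambda>m. indicator {x<..} (occ UNIV 0 (Y \<omega>)) * inverse (occ (core (Suc m)) 0 (Y \<omega>)))
     \<longlonglongrightarrow> indicator {x<..} (occ UNIV 0 (Y \<omega>)) * inverse (occ UNIV 0 (Y \<omega>))"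
  proof (intro AE_I2)
    fix \<omega> assume "\<omega> \<in> space M"
    then have "Y \<omega> \<in> gcadlag" using measurable_space[OF Y_measurable] by (simp add: space_D)
    note lim = occ_core_tendsto(2)[OF this]
    have "continuous_on UNIV (\<lambda>u :: ennreal. inverse u)"
      by (intro continuous_on_inverse_ennreal continuous_on_id)
    from continuous_on_tendsto_compose[OF this lim]
    have "(\<lambda>m. inverse (occ (core m) 0 (Y \<omega>))) \<longlonglongrightarrow> inverse (occ UNIV 0 (Y \<omega>))"
      by simp
    from LIMSEQ_Suc[OF this]
    show "(\<lambda>m. indicator {x<..} (occ UNIV 0 (Y \<omega>)) * inverse (occ (core (Suc m)) 0 (Y \<omega>)))
     \<longlonglongrightarrow> indicator {x<..} (occ UNIV 0 (Y \<omega>)) * inverse (occ UNIV 0 (Y \<omega>))"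
      by (intro ennreal_tendsto_cmult) (auto simp: indicator_def)
  qed
qed (use expectation_inverse_core[of 0] in \<open>auto\<close>)

lemma lower_tendsto: "(\<lambda>m. lower x m) \<longlonglongrightarrow> berman_constant x"
proof -
  have "(\<lambda>m. \<integral>\<^sup>+\<omega>. indicator {x<..} (occ (core m) 0 (Y \<omega>)) * inverse (occ UNIV 0 (Y \<omega>)) \<partial>M) \<longlonglongrightarrow>
    (\<integral>\<^sup>+\<omega>. indicator {x<..} (occ UNIV 0 (Y \<omega>)) * inverse (occ UNIV 0 (Y \<omega>)) \<partial>M)"
  proof (rule nn_integral_dominated_convergence[where w = "\<lambda>\<omega>. inverse (occ (core (Suc 0)) 0 (Y \<omega>))"])
    have "indicator {x<..} (occ (core m) 0 (Y \<omega>)) * inverse (occ UNIV 0 (Y \<omega>)) \<le> inverse (occ (core (Suc 0)) 0 (Y \<omega>))" for m \<omega>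
      using mult_mono[OF indicator_le_1 inverse_ennreal_antimono[OF occ_mono]] by (metis UNIV_I mult_1 zero_le)
    then show "AE \<omega> in M. indicator {x<..} (occ (core m) 0 (Y \<omega>)) * inverse (occ UNIV 0 (Y \<omega>)) \<le> inverse (occ (core (Suc 0)) 0 (Y \<omega>))" for m
      by simp
    show "AE \<omega> in M. (\<lambda>m. indicator {x<..} (occ (core m) 0 (Y \<omega>)) * inverse (occ UNIV 0 (Y \<omega>)))
       \<longlonglongrightarrow> indicator {x<..} (occ UNIV 0 (Y \<omega>)) * inverse (occ UNIV 0 (Y \<omega>))"
    proof (intro AE_I2 tendsto_eventually)
      fix \<omega> assume "\<omega> \<in> space M"
      then have "Y \<omega> \<in> gcadlag" using measurable_space[OF Y_measurable] by (simp add: space_D)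
      note lim = occ_core_tendsto(2)[OF this]
      show "\<forall>\<^sub>F m in sequentially. indicator {x<..} (occ (core m) 0 (Y \<omega>)) * inverse (occ UNIV 0 (Y \<omega>))
         = indicator {x<..} (occ UNIV 0 (Y \<omega>)) * inverse (occ UNIV 0 (Y \<omega>))"
      proof (cases "x < occ UNIV 0 (Y \<omega>)")
        case True
        from order_tendstoD(1)[OF lim this] show ?thesis
          by eventually_elim (use True in \<open>simp add: indicator_def\<close>)
      next
        case False
        have "occ (core m) 0 (Y \<omega>) \<le> occ UNIV 0 (Y \<omega>)" for m by (rule occ_mono) simp
        then have "\<not> x < occ (core m) 0 (Y \<omega>)" for m using False by (meson less_le_trans)
        with False show ?thesis by (simp add: indicator_def)
      qed
    qed
  qed (use expectation_inverse_core[of 0] in \<open>auto\<close>)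
  then show ?thesis by (simp add: lower_def berman_constant_def)
qed

end

section \<open>Existence and value of the Berman function\<close>

context berman_field begin

text \<open>
  For fixed \<open>m\<close> the proportion \<open>\<rho> m n\<close> of inner cells tends to one, so that the limit points lie
  between \<open>lower x m\<close> and \<open>upper x m\<close>; then \<open>m\<close> tends to infinity.
\<close>

lemma excess_cubes_tendsto:
  "(\<lambda>n. ennreal (1 / (c * real n) ^ CARD('d)) * excess x (cube (c * real n))) \<longlonglongrightarrow> berman_constant x"
    (is "?b \<longlonglongrightarrow> _")
proof -
  let ?d = "CARD('d)"
  define \<rho> where "\<rho> m n = (real (n - 2 * m) / real n) ^ ?d" for m n
  have \<rho>: "\<rho> m \<longlonglongrightarrow> 1" for m
  proof -
    have "(\<lambda>n. 1 - real (2 * m) * (1 / real n)) \<longlonglongrightarrow> 1 - real (2 * m) * 0"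
      by (intro tendsto_intros lim_1_over_n)
    then have "(\<lambda>n. 1 - real (2 * m) * (1 / real n)) \<longlonglongrightarrow> 1" by simp
    moreover have "\<forall>\<^sub>F n in sequentially. 1 - real (2 * m) * (1 / real n) = real (n - 2 * m) / real n"
      using eventually_ge_at_top[of "2 * m"] eventually_gt_at_top[of 0]
      by eventually_elim (simp add: of_nat_diff field_simps)
    ultimately have "(\<lambda>n. real (n - 2 * m) / real n) \<longlonglongrightarrow> 1" by (rule Lim_transform_eventually)
    then have "(\<lambda>n. (real (n - 2 * m) / real n) ^ ?d) \<longlonglongrightarrow> 1 ^ ?d" by (rule tendsto_power)
    moreover have "\<rho> m = (\<lambda>n. (real (n - 2 * m) / real n) ^ ?d)" by (rule ext) (simp add: \<rho>_def)
    ultimately show ?thesis by simp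
  qed
  have \<rho>_le: "\<rho> m n \<le> 1" for m n unfolding \<rho>_def by (intro power_le_one) (auto simp: divide_le_eq_1)
  have cd: "0 < c ^ ?d" using c_pos by simp
  have scale: "ennreal (1 / (c * real n) ^ ?d) * (of_nat ((n - 2 * m) ^ ?d) * (ennreal (c ^ ?d) * w)) = ennreal (\<rho> m n) * w"
    if "0 < n" for n m w
  proof -
    have "1 / (c * real n) ^ ?d * (real ((n - 2 * m) ^ ?d) * c ^ ?d) = \<rho> m n"
      using that c_pos by (simp add: \<rho>_def power_mult_distrib power_divide)
    then have "ennreal (1 / (c * real n) ^ ?d) * (ennreal (real ((n - 2 * m) ^ ?d)) * ennreal (c ^ ?d)) = ennreal (\<rho> m n)"
      using c_pos by (simp add: ennreal_mult'[symmetric] ennreal_mult[symmetric] del: of_nat_power)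
    then show ?thesis by (simp only: ennreal_of_nat_eq_real_of_nat mult.assoc[symmetric])
  qed
  have scale': "ennreal (1 / (c * real n) ^ ?d) * (of_nat (n ^ ?d - (n - 2 * m) ^ ?d) * w) = ennreal (1 - \<rho> m n) * (ennreal (1 / c ^ ?d) * w)"
    if "0 < n" for n m w
  proof -
    have "(n - 2 * m) ^ ?d \<le> n ^ ?d" by (intro power_mono) auto
    then have "1 / (c * real n) ^ ?d * real (n ^ ?d - (n - 2 * m) ^ ?d) = (1 - \<rho> m n) * (1 / c ^ ?d)"
      using that c_pos by (simp add: \<rho>_def power_mult_distrib power_divide of_nat_diff field_simps)
    then have "ennreal (1 / (c * real n) ^ ?d) * ennreal (real (n ^ ?d - (n - 2 * m) ^ ?d)) = ennreal (1 - \<rho> m n) * ennreal (1 / c ^ ?d)"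
      using c_pos \<rho>_le[of m n] by (simp add: ennreal_mult[symmetric])
    then show ?thesis by (simp only: ennreal_of_nat_eq_real_of_nat mult.assoc[symmetric])
  qed
  have lo: "ennreal (\<rho> m n) * lower x m \<le> ?b n" if "0 < n" for m n
    unfolding scale[OF that, symmetric] by (intro mult_left_mono excess_ge_lower) simp
  have up: "?b n \<le> ennreal (\<rho> m n) * upper x m + ennreal (1 - \<rho> m n) * (ennreal (1 / c ^ ?d) * cell_bound)" if "0 < n" for m n
    unfolding scale[OF that, symmetric] scale'[OF that, symmetric] distrib_left[symmetric]
    by (intro mult_left_mono excess_le_upper) simp
  show ?thesis
  proof (rule order_tendstoI)
    fix y assume "y < berman_constant x"
    from order_tendstoD(1)[OF lower_tendsto this] obtain m where m: "y < lower x m"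
      by (auto simp: eventually_sequentially)
    have "(\<lambda>n. ennreal (\<rho> m n) * lower x m) \<longlonglongrightarrow> ennreal 1 * lower x m"
      by (intro tendsto_mult_ennreal tendsto_ennrealI \<rho> tendsto_const) auto
    then have "\<forall>\<^sub>F n in sequentially. y < ennreal (\<rho> m n) * lower x m"
      using m by (intro order_tendstoD(1)) auto
    with eventually_gt_at_top[of 0] show "\<forall>\<^sub>F n in sequentially. y < ?b n"
      by eventually_elim (use lo less_le_trans in blast)
  next
    fix y assume "berman_constant x < y"
    from order_tendstoD(2)[OF upper_tendsto this] obtain m where m: "upper x (Suc m) < y"
      by (auto simp: eventually_sequentially)
    have "(\<lambda>n. ennreal (\<rho> (Suc m) n) * upper x (Suc m) + ennreal (1 - \<rho> (Suc m) n) * (ennreal (1 / c ^ ?d) * cell_bound))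
      \<longlonglongrightarrow> ennreal 1 * upper x (Suc m) + ennreal (1 - 1) * (ennreal (1 / c ^ ?d) * cell_bound)"
      using cell_bound_finite
      by (intro tendsto_add tendsto_mult_ennreal tendsto_ennrealI tendsto_diff \<rho> tendsto_const)
        (auto simp: ennreal_mult_eq_top_iff)
    then have "\<forall>\<^sub>F n in sequentially. ennreal (\<rho> (Suc m) n) * upper x (Suc m) + ennreal (1 - \<rho> (Suc m) n) * (ennreal (1 / c ^ ?d) * cell_bound) < y"
      using m by (intro order_tendstoD(2)) auto
    with eventually_gt_at_top[of 0] show "\<forall>\<^sub>F n in sequentially. ?b n < y"
      by eventually_elim (use up le_less_trans in blast)
  qed
qed

lemma excess_mono: "A \<subseteq> B \<Longrightarrow> excess x A \<le> excess x B"
proof -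
  assume AB: "A \<subseteq> B"
  have "occ A 0 f \<le> occ B 0 f" for f by (rule occ_mono) (use AB in auto)
  then show ?thesis unfolding excess_def
    by (intro nn_integral_mono mult_left_mono) (auto simp: indicator_def dest: less_le_trans)
qed

text \<open>
  A box of real edge \<open>T\<close> lies between two cubes whose edges are consecutive multiples of \<open>c\<close>.
\<close>

lemma excess_cbox_tendsto:
  "((\<lambda>T::real. ennreal (1 / T ^ CARD('d)) * excess x (cbox 0 (vec T))) \<longlongrightarrow> berman_constant x) at_top"
proof -
  let ?d = "CARD('d)"
  let ?b = "\<lambda>n. ennreal (1 / (c * real n) ^ ?d) * excess x (cube (c * real n))"
  let ?n = "\<lambda>T. nat \<lfloor>T / c\<rfloor>"
  have n: "c * real (?n T) \<le> T" "T < c * real (Suc (?n T))" if "0 < T" for T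
  proof -
    have "0 \<le> T / c" using that c_pos by simp
    then have "real (?n T) \<le> T / c" "T / c < real (Suc (?n T))" by (auto intro: of_nat_floor) linarith
    then show "c * real (?n T) \<le> T" "T < c * real (Suc (?n T))" using c_pos by (simp_all add: field_simps)
  qed
  have nlim: "filterlim ?n sequentially at_top"
  proof -
    have "filterlim (\<lambda>T. T * inverse c) at_top at_top"
      by (rule filterlim_at_top_mult_tendsto_pos[OF tendsto_const _ filterlim_ident]) (use c_pos in simp)
    then have "filterlim (\<lambda>T. T / c) at_top at_top" by (simp add: divide_inverse)
    then show ?thesis
      by (intro filterlim_compose[OF filterlim_nat_sequentially] filterlim_compose[OF filterlim_floor_sequentially])
  qed
  have r0: "((\<lambda>T. c / T) \<longlongrightarrow> 0) at_top"
    by (rule real_tendsto_divide_at_top[OF tendsto_const filterlim_ident])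
  have r1: "((\<lambda>T. c * real (?n T) / T) \<longlongrightarrow> 1) at_top"
  proof (rule tendsto_sandwich[where f = "\<lambda>T. 1 - c / T" and h = "\<lambda>_. 1"])
    show "\<forall>\<^sub>F T in at_top. 1 - c / T \<le> c * real (?n T) / T"
      using eventually_gt_at_top[of 0]
    proof eventually_elim
      case (elim T)
      have "T - c \<le> c * real (?n T)" using n(2)[OF elim] by (simp add: distrib_left)
      then have "(T - c) / T \<le> c * real (?n T) / T" using elim by (intro divide_right_mono) auto
      then show ?case using elim by (simp add: diff_divide_distrib)
    qed
    show "\<forall>\<^sub>F T in at_top. c * real (?n T) / T \<le> 1"
      using eventually_gt_at_top[of 0] by eventually_elim (use n(1) in simp)
    show "((\<lambda>T. 1 - c / T) \<longlongrightarrow> 1) at_top" using tendsto_diff[OF tendsto_const r0, of 1] by simp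
  qed simp
  have r2: "((\<lambda>T. c * real (Suc (?n T)) / T) \<longlongrightarrow> 1) at_top"
  proof -
    have "c * real (Suc (?n T)) / T = c * real (?n T) / T + c / T" for T by (simp add: field_simps add_divide_distrib)
    then show ?thesis using tendsto_add[OF r1 r0] by simp
  qed
  show ?thesis
  proof (rule tendsto_sandwich)
    have "((\<lambda>T. ennreal ((c * real (?n T) / T) ^ ?d) * ?b (?n T)) \<longlongrightarrow> ennreal (1 ^ ?d) * berman_constant x) at_top"
      by (intro tendsto_mult_ennreal tendsto_ennrealI tendsto_power r1 filterlim_compose[OF excess_cubes_tendsto nlim]) auto
    then show "((\<lambda>T. ennreal ((c * real (?n T) / T) ^ ?d) * ?b (?n T)) \<longlongrightarrow> berman_constant x) at_top" by simp
    have "((\<lambda>T. ennreal ((c * real (Suc (?n T)) / T) ^ ?d) * ?b (Suc (?n T))) \<longlongrightarrow> ennreal (1 ^ ?d) * berman_constant x) at_top"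
      by (intro tendsto_mult_ennreal tendsto_ennrealI tendsto_power r2
          filterlim_compose[OF excess_cubes_tendsto filterlim_compose[OF filterlim_Suc nlim]]) auto
    then show "((\<lambda>T. ennreal ((c * real (Suc (?n T)) / T) ^ ?d) * ?b (Suc (?n T))) \<longlongrightarrow> berman_constant x) at_top" by simp
    have resc: "ennreal ((c * real k / T) ^ ?d) * ?b k = ennreal (1 / T ^ ?d) * excess x (cube (c * real k))" if "0 < T" "0 < k" for T k
    proof -
      have "(c * real k / T) ^ ?d * (1 / (c * real k) ^ ?d) = 1 / T ^ ?d"
        using that c_pos by (simp add: power_divide)
      then have "ennreal ((c * real k / T) ^ ?d) * ennreal (1 / (c * real k) ^ ?d) = ennreal (1 / T ^ ?d)"
        using that c_pos by (simp add: ennreal_mult[symmetric])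
      then show ?thesis by (simp only: mult.assoc[symmetric])
    qed
    have npos: "\<forall>\<^sub>F T in at_top. 0 < ?n T"
      using nlim eventually_gt_at_top[of "0::nat"] unfolding filterlim_iff by blast
    show "\<forall>\<^sub>F T in at_top. ennreal ((c * real (?n T) / T) ^ ?d) * ?b (?n T) \<le> ennreal (1 / T ^ ?d) * excess x (cbox 0 (vec T))"
      using eventually_gt_at_top[of "0::real"] npos
    proof eventually_elim
      case (elim T)
      have "cube (c * real (?n T)) \<subseteq> (cbox 0 (vec T) :: (real ^ 'd) set)"
        by (auto simp: cube_def mem_box_cart intro!: order_trans[OF less_imp_le n(1)[OF elim(1)]])
      then show ?case unfolding resc[OF elim] by (intro mult_left_mono excess_mono) auto
    qed
    show "\<forall>\<^sub>F T in at_top. ennreal (1 / T ^ ?d) * excess x (cbox 0 (vec T)) \<le> ennreal ((c * real (Suc (?n T)) / T) ^ ?d) * ?b (Suc (?n T))"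
      using eventually_gt_at_top[of "0::real"]
    proof eventually_elim
      case (elim T)
      have "cbox 0 (vec T) \<subseteq> (cube (c * real (Suc (?n T))) :: (real ^ 'd) set)"
        by (auto simp: cube_def mem_box_cart simp del: of_nat_Suc intro!: le_less_trans[OF _ n(2)[OF elim]])
      then show ?case unfolding resc[OF elim zero_less_Suc] by (intro mult_left_mono excess_mono) auto
    qed
  qed
qed

text \<open>
  The field \<open>Z'\<close> may have paths outside \<open>D\<close> on a null set; completeness of the space keeps the events
  measurable. The level \<open>s = 0\<close> is a null set.
\<close>

lemma excess_sojourn:
  assumes \<nu>: "\<nu> = lattice_measure_of \<delta>" and compl: "complete_measure M"
    and Z': "AE \<omega> in M. Z' \<omega> = Z \<omega>" and B [measurable]: "B \<in> sets borel"
  shows "(\<integral>\<^sup>+s\<in>{0..}. emeasure M {\<omega> \<in> space M. sojourn \<delta> B (Z' \<omega>) s > x} \<partial>lborel) = excess x B"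
proof -
  interpret cm: complete_measure M by (rule compl)
  interpret p: pair_sigma_finite M "lborel :: real measure" ..
  let ?o = "\<lambda>\<omega> s. occ B 0 (rescale (inverse s) (Z \<omega>))"
  have om [measurable]: "(\<lambda>p. ?o (fst p) (snd p)) \<in> borel_measurable (M \<Otimes>\<^sub>M lborel)"
    by measurable
  have soj: "sojourn \<delta> B (Z \<omega>) s = ?o \<omega> s" if "\<omega> \<in> space M" "0 < s" for \<omega> s
    unfolding sojourn_eq[OF Z_gcadlag[OF that(1)] B] occ_def \<nu>[symmetric]
    using that(2) by (intro nn_integral_cong) (auto simp: indicator_def rescale_def field_simps)
  have em: "emeasure M {\<omega> \<in> space M. sojourn \<delta> B (Z' \<omega>) s > x} = (\<integral>\<^sup>+\<omega>. indicator {x<..} (?o \<omega> s) \<partial>M)" if s: "0 < s" for s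
  proof -
    have [measurable]: "(\<lambda>\<omega>. ?o \<omega> s) \<in> borel_measurable M" by measurable
    have m: "{\<omega> \<in> space M. ?o \<omega> s > x} \<in> sets M" by measurable
    have ae: "AE \<omega> in M. \<omega> \<in> {\<omega> \<in> space M. ?o \<omega> s > x} \<longleftrightarrow> \<omega> \<in> {\<omega> \<in> space M. sojourn \<delta> B (Z' \<omega>) s > x}"
      using Z' AE_space by eventually_elim (simp add: soj s)
    have m': "{\<omega> \<in> space M. sojourn \<delta> B (Z' \<omega>) s > x} \<in> sets M"
      by (rule cm.in_sets_AE[OF ae m]) auto
    have "emeasure M {\<omega> \<in> space M. sojourn \<delta> B (Z' \<omega>) s > x} = emeasure M {\<omega> \<in> space M. ?o \<omega> s > x}"
      by (rule emeasure_eq_AE[OF _ m' m]) (use ae in eventually_elim, blast)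
    also have "\<dots> = (\<integral>\<^sup>+\<omega>. indicator {\<omega> \<in> space M. ?o \<omega> s > x} \<omega> \<partial>M)" using m by simp
    also have "\<dots> = (\<integral>\<^sup>+\<omega>. indicator {x<..} (?o \<omega> s) \<partial>M)" by (intro nn_integral_cong) (auto simp: indicator_def)
    finally show ?thesis .
  qed
  have "(\<integral>\<^sup>+s\<in>{0..}. emeasure M {\<omega> \<in> space M. sojourn \<delta> B (Z' \<omega>) s > x} \<partial>lborel)
      = (\<integral>\<^sup>+s. (\<integral>\<^sup>+\<omega>. indicator {0<..} s * indicator {x<..} (?o \<omega> s) \<partial>M) \<partial>lborel)"
  proof (rule nn_integral_cong_AE, use AE_lborel_singleton[of "0::real"] in eventually_elim)
    case (elim s)
    show ?case
    proof (cases "0 < s")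
      case True
      then show ?thesis by (simp add: em)
    qed (use elim in \<open>simp add: indicator_def\<close>)
  qed
  also have "\<dots> = excess x B"
    unfolding excess_def
    by (rule p.Fubini') (simp add: split_beta')
  finally show ?thesis .
qed

lemma berman_eq:
  assumes "\<nu> = lattice_measure_of \<delta>" "complete_measure M" "AE \<omega> in M. Z' \<omega> = Z \<omega>"
  shows "berman M Z' \<delta> x = berman_constant (ennreal x)"
  unfolding berman_def
  by (rule tendsto_Lim) (simp_all add: excess_sojourn[OF assms] excess_cbox_tendsto)

end

section \<open>Atoms and finiteness of the exceedance volume\<close>

text \<open>
  If the volumes above \<open>s\<close> and \<open>s'\<close> agree and are finite, the open set \<open>{s < f < s'}\<close> is null, hence
  empty. But \<open>f\<close> exceeds \<open>s'\<close> somewhere and, the volume being finite, is at most \<open>s\<close> somewhere, so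
  that \<open>f\<close> takes a value in between.
\<close>

lemma exceedance_volume_strict:
  fixes f :: "real ^ 'd::finite \<Rightarrow> real"
  assumes f: "continuous_on UNIV f" and s: "s < s'" "s' < f t"
    and eq: "emeasure lborel {v. s < f v} = ennreal u" "emeasure lborel {v. s' < f v} = ennreal u"
  shows False
proof -
  have op: "open {v. a < f v}" "open {v. f v < a}" for a
    using f by (auto intro!: open_Collect_less continuous_intros simp: continuous_on_eq_continuous_at)
  have m: "{v. a < f v} \<in> sets lborel" for a using op by simp
  have "emeasure lborel ({v. s < f v} - {v. s' < f v}) = emeasure lborel {v. s < f v} - emeasure lborel {v. s' < f v}"
    using s eq m by (intro emeasure_Diff) auto
  then have zero: "emeasure lborel ({v. s < f v} - {v. s' < f v}) = 0" using eq by simp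
  have "\<exists>v. f v \<le> s"
  proof (rule ccontr)
    assume "\<not> ?thesis"
    then have "{v. s < f v} = UNIV" by (auto simp: not_le)
    then show False using eq(1) by simp
  qed
  then obtain v where v: "f v \<le> s" by blast
  have "connected (range f)" using f by (intro connected_continuous_image) auto
  then have "(s + s') / 2 \<in> range f"
    unfolding connected_iff_interval using v s
    by (elim ballE[of _ _ "f v"] ballE[of _ _ "f t"]) auto
  then obtain w where w: "f w = (s + s') / 2" by auto
  have "open ({v. s < f v} \<inter> {v. f v < s'})" using op by auto
  moreover have "w \<in> {v. s < f v} \<inter> {v. f v < s'}" using w s by auto
  ultimately obtain e where e: "0 < e" "ball w e \<subseteq> {v. s < f v} \<inter> {v. f v < s'}"
    by (meson open_contains_ball)
  have "ball w e \<subseteq> {v. s < f v} - {v. s' < f v}" using e(2) by auto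
  then have "emeasure lborel (ball w e) \<le> emeasure lborel ({v. s < f v} - {v. s' < f v})"
    using m by (intro emeasure_mono) auto
  with zero e(1) emeasure_lborel_ball_finite[of w e] content_ball_pos[of e w] show False
    by (simp add: measure_def)
qed

text \<open>
  The distribution function on the real line is the one of the finite measure obtained by
  discarding the event that \<open>W\<close> is infinite.
\<close>

lemma continuous_distributionI:
  fixes W :: "'w \<Rightarrow> ennreal"
  assumes "prob_space M" and W [measurable]: "W \<in> borel_measurable M"
    and atom: "\<And>u::real. 0 \<le> u \<Longrightarrow> measure M {\<omega> \<in> space M. W \<omega> = ennreal u} = 0"
  shows "continuous_distribution M W"
proof -
  interpret prob_space M by fact
  \<comment> \<open>the infinite values must be removed, as \<open>enn2real\<close> sends them to 0\<close>
  define \<mu> where "\<mu> = distr (density M (\<lambda>\<omega>. indicator {..<\<infinity>} (W \<omega>))) borel (\<lambda>\<omega>. enn2real (W \<omega>))"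
  have em: "emeasure \<mu> A = emeasure M {\<omega> \<in> space M. W \<omega> < \<infinity> \<and> enn2real (W \<omega>) \<in> A}" if A [measurable]: "A \<in> sets borel" for A
  proof -
    have "emeasure \<mu> A = (\<integral>\<^sup>+\<omega>. indicator {..<\<infinity>} (W \<omega>) * indicator ((\<lambda>\<omega>. enn2real (W \<omega>)) -` A \<inter> space M) \<omega> \<partial>M)"
      unfolding \<mu>_def using A by (subst emeasure_distr) (auto simp: emeasure_density)
    also have "\<dots> = (\<integral>\<^sup>+\<omega>. indicator {\<omega> \<in> space M. W \<omega> < \<infinity> \<and> enn2real (W \<omega>) \<in> A} \<omega> \<partial>M)"
      by (intro nn_integral_cong) (auto simp: indicator_def)
    finally show ?thesis by simp
  qed
  interpret \<mu>: finite_borel_measure \<mu>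
  proof (intro finite_borel_measure.intro finite_measureI finite_borel_measure_axioms.intro)
    show "emeasure \<mu> (space \<mu>) \<noteq> \<infinity>"
      using em[of UNIV] by (simp add: \<mu>_def)
  qed (simp add: \<mu>_def)
  have "cdf \<mu> u = measure M {\<omega> \<in> space M. enn2ereal (W \<omega>) \<le> ereal u}" for u
  proof -
    have "W \<omega> < \<infinity> \<and> enn2real (W \<omega>) \<le> u \<longleftrightarrow> enn2ereal (W \<omega>) \<le> ereal u" for \<omega>
      by (cases "W \<omega>") (auto simp: enn2ereal_ennreal)
    then show ?thesis unfolding cdf_def measure_def by (simp add: em)
  qed
  then have cdf: "cdf \<mu> = (\<lambda>u. measure M {\<omega> \<in> space M. enn2ereal (W \<omega>) \<le> ereal u})" by blast
  have "isCont (cdf \<mu>) u" for u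
  proof -
    have "measure \<mu> {u} = 0"
    proof (cases "0 \<le> u")
      case True
      have "W \<omega> < \<infinity> \<and> enn2real (W \<omega>) = u \<longleftrightarrow> W \<omega> = ennreal u" for \<omega>
        using True by (cases "W \<omega>") auto
      then show ?thesis using atom[OF True] by (simp add: measure_def em)
    next
      case False
      then have none: "{\<omega> \<in> space M. W \<omega> < \<infinity> \<and> enn2real (W \<omega>) \<in> {u}} = {}"
        using enn2real_nonneg by auto
      have "emeasure \<mu> {u} = 0" by (subst em) (simp, simp only: none emeasure_empty)
      then show ?thesis by (simp add: measure_def)
    qed
    then show ?thesis by (simp add: \<mu>.isCont_cdf)
  qed
  then have "continuous_on UNIV (cdf \<mu>)" by (intro continuous_at_imp_continuous_on) blast
  then show ?thesis unfolding continuous_distribution_def cdf .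
qed

text \<open>
  Integrating the lattice sums over all shifts in one cell gives at most the full integral, because
  a translate of the reflected cell contains at most one lattice point.
\<close>

lemma shifted_grid_integral_finite:
  fixes f :: "real ^ 'd::finite \<Rightarrow> real"
  assumes f: "f \<in> gcadlag" and \<delta>: "0 < \<delta>" and fin: "(\<integral>\<^sup>+t. ennreal (f t) \<partial>lborel) < \<infinity>"
  shows "AE u in lborel. u \<in> cube \<delta> \<longrightarrow> (\<integral>\<^sup>+v. ennreal (f (v + u)) \<partial>lattice_measure_of \<delta>) < \<infinity>"
proof -
  let ?\<nu> = "lattice_measure_of \<delta> :: (real ^ 'd) measure"
  interpret lattice_measure ?\<nu> "grid \<delta>" \<delta> by (rule lattice_measure_grid[OF \<delta>])
  interpret p: pair_sigma_finite "lborel :: (real ^ 'd) measure" ?\<nu> ..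
  interpret l: lattice_measure "lattice_measure_of 0 :: (real ^ 'd) measure" UNIV 1
    by (rule lattice_measure_lborel)
  have lb: "(lattice_measure_of 0 :: (real ^ 'd) measure) = lborel"
    by (simp add: lattice_measure_of_def lam_def distr_id2)
  have fm [measurable]: "f \<in> borel_measurable borel" by (rule measurable_gcadlag[OF f])
  have eqs: "sets (lborel \<Otimes>\<^sub>M ?\<nu>) = sets ((borel :: (real ^ 'd) measure) \<Otimes>\<^sub>M (borel :: (real ^ 'd) measure))"
    by (intro sets_pair_measure_cong) (simp_all add: sets_\<nu>)
  have pm: "g \<in> borel_measurable (lborel \<Otimes>\<^sub>M ?\<nu>)" if "g \<in> borel_measurable (borel \<Otimes>\<^sub>M borel)" for g :: "(real ^ 'd) \<times> (real ^ 'd) \<Rightarrow> ennreal"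
    using that unfolding measurable_cong_sets[OF eqs refl] .
  have m1: "(\<lambda>(u, v). indicator (cube \<delta>) u * ennreal (f (v + u))) \<in> borel_measurable (lborel \<Otimes>\<^sub>M ?\<nu>)"
    by (rule pm) measurable
  have m2: "(\<lambda>(u, v). indicator (cube \<delta>) (u - v) * ennreal (f u)) \<in> borel_measurable (lborel \<Otimes>\<^sub>M ?\<nu>)"
    by (rule pm) measurable
  have "(\<integral>\<^sup>+u. (\<integral>\<^sup>+v. indicator (cube \<delta>) u * ennreal (f (v + u)) \<partial>?\<nu>) \<partial>lborel)
      = (\<integral>\<^sup>+v. (\<integral>\<^sup>+u. indicator (cube \<delta>) u * ennreal (f (v + u)) \<partial>lborel) \<partial>?\<nu>)"
    by (rule p.Fubini'[symmetric]) (rule m1)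
  also have "\<dots> = (\<integral>\<^sup>+v. (\<integral>\<^sup>+u. indicator (cube \<delta>) (u - v) * ennreal (f u) \<partial>lborel) \<partial>?\<nu>)"
  proof (rule nn_integral_cong)
    fix v :: "real ^ 'd"
    have [measurable]: "(\<lambda>u. indicator (cube \<delta>) (u - v) * ennreal (f u)) \<in> borel_measurable borel" by measurable
    show "(\<integral>\<^sup>+u. indicator (cube \<delta>) u * ennreal (f (v + u)) \<partial>lborel) = (\<integral>\<^sup>+u. indicator (cube \<delta>) (u - v) * ennreal (f u) \<partial>(lborel :: (real ^ 'd) measure))"
      using l.\<nu>_shift[of v "\<lambda>u. indicator (cube \<delta>) (u - v) * ennreal (f u)"] by (simp add: lb add.commute)
  qed
  also have "\<dots> = (\<integral>\<^sup>+u. (\<integral>\<^sup>+v. indicator (cube \<delta>) (u - v) * ennreal (f u) \<partial>?\<nu>) \<partial>lborel)"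
    by (rule p.Fubini') (rule m2)
  also have "\<dots> \<le> (\<integral>\<^sup>+u. ennreal (\<delta> ^ CARD('d)) * ennreal (f u) \<partial>lborel)"
  proof (intro nn_integral_mono)
    fix u :: "real ^ 'd"
    let ?C = "{v. u - v \<in> cube \<delta>}"
    have [measurable]: "(\<lambda>v. u - v) \<in> borel_measurable borel" by measurable
    have Cm: "?C \<in> sets borel"
      using measurable_sets[OF \<open>(\<lambda>v. u - v) \<in> borel_measurable borel\<close> cube_borel] by (simp add: vimage_def)
    have uniq: "v = w" if vw: "v \<in> ?C \<inter> grid \<delta>" "w \<in> ?C \<inter> grid \<delta>" for v w
    proof -
      have "v $ i = w $ i" for i
      proof -
        obtain k l :: int where kl: "v $ i = \<delta> * k" "w $ i = \<delta> * l" using vw unfolding grid_def by auto metis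
        have "0 \<le> u $ i - v $ i" "u $ i - v $ i < \<delta>" "0 \<le> u $ i - w $ i" "u $ i - w $ i < \<delta>"
          using vw by (auto simp: cube_def)
        then have "\<delta> * k < \<delta> * (l + 1)" "\<delta> * l < \<delta> * (k + 1)" unfolding kl by (simp_all add: distrib_left)
        then have "real_of_int k < l + 1" "real_of_int l < k + 1" using \<delta> by simp_all
        then have "k = l" by linarith
        then show ?thesis using kl by simp
      qed
      then show ?thesis by (simp add: vec_eq_iff)
    qed
    have "emeasure (count_space (grid \<delta>)) (?C \<inter> grid \<delta>) \<le> 1"
    proof (cases "?C \<inter> grid \<delta> = {}")
      case False
      then obtain v where "v \<in> ?C \<inter> grid \<delta>" by blast
      with uniq have "?C \<inter> grid \<delta> = {v}" by blast
      moreover have "emeasure (count_space (grid \<delta>)) {v} = 1"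
        using \<open>v \<in> ?C \<inter> grid \<delta>\<close> by (subst emeasure_count_space_finite) auto
      ultimately show ?thesis by simp
    next
      case True
      then show ?thesis by (simp only: emeasure_empty) simp
    qed
    then have C: "emeasure ?\<nu> ?C \<le> ennreal (\<delta> ^ CARD('d))"
      unfolding emeasure_lattice_measure_of[OF \<delta> Cm] using mult_left_mono[of _ 1 "ennreal (\<delta> ^ CARD('d))"] by simp
    have "(\<integral>\<^sup>+v. indicator (cube \<delta>) (u - v) * ennreal (f u) \<partial>?\<nu>) = (\<integral>\<^sup>+v. indicator ?C v * ennreal (f u) \<partial>?\<nu>)"
      by (intro nn_integral_cong) (simp add: indicator_def)
    also have "\<dots> = emeasure ?\<nu> ?C * ennreal (f u)"
      using Cm by (subst nn_integral_multc) (auto simp: sets_\<nu> measurable_\<nu>)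
    also have "\<dots> \<le> ennreal (\<delta> ^ CARD('d)) * ennreal (f u)" by (intro mult_right_mono C) simp
    finally show "(\<integral>\<^sup>+v. indicator (cube \<delta>) (u - v) * ennreal (f u) \<partial>?\<nu>) \<le> ennreal (\<delta> ^ CARD('d)) * ennreal (f u)" .
  qed
  also have "\<dots> = ennreal (\<delta> ^ CARD('d)) * (\<integral>\<^sup>+u. ennreal (f u) \<partial>lborel)" by (rule nn_integral_cmult) simp
  also have "\<dots> < \<infinity>" using fin by (simp add: ennreal_mult_less_top)
  finally have "(\<integral>\<^sup>+u. (\<integral>\<^sup>+v. indicator (cube \<delta>) u * ennreal (f (v + u)) \<partial>?\<nu>) \<partial>lborel) \<noteq> \<infinity>" by simp
  then have "AE u in lborel. (\<integral>\<^sup>+v. indicator (cube \<delta>) u * ennreal (f (v + u)) \<partial>?\<nu>) \<noteq> \<infinity>"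
    by (intro nn_integral_PInf_AE \<nu>.borel_measurable_nn_integral m1)
  then show ?thesis by eventually_elim (auto simp: less_top)
qed

context spectral_tail_field begin

text \<open>
  For almost every path at most one level below \<open>Z 0\<close> has exceedance volume \<open>u\<close>, and a single level
  has length zero.
\<close>

lemma exceedance_volume_no_atom:
  assumes cont: "AE \<omega> in M. continuous_on UNIV (Z \<omega>)"
  shows "measure M {\<omega> \<in> space M. lattice_measure.occ (lattice_measure_of 0) UNIV 0 (Y \<omega>) = ennreal u} = 0"
proof -
  interpret lattice_measure "lattice_measure_of 0 :: (real ^ 'd) measure" UNIV 1
    by (rule lattice_measure_lborel)
  have lb: "(lattice_measure_of 0 :: (real ^ 'd) measure) = lborel"
    by (simp add: lattice_measure_of_def lam_def distr_id2)
  have occ: "occ UNIV 0 (rescale (inverse s) f) = emeasure lborel {v. s < f v}"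
    if "f \<in> gcadlag" "0 < s" for f :: "real ^ 'd \<Rightarrow> real" and s
  proof -
    have [measurable]: "f \<in> borel_measurable borel" by (rule measurable_gcadlag[OF that(1)])
    have "occ UNIV 0 (rescale (inverse s) f) = (\<integral>\<^sup>+v. indicator {v. s < f v} v \<partial>lborel)"
      unfolding occ_def unfolding lb using that(2) by (intro nn_integral_cong) (auto simp: indicator_def rescale_def field_simps)
    then show ?thesis by simp
  qed
  have "(\<integral>\<^sup>+\<omega>. indicator {ennreal u} (occ UNIV 0 (Y \<omega>)) \<partial>M)
    = (\<integral>\<^sup>+\<omega>. (\<integral>\<^sup>+s. indicator {0<..<Z \<omega> 0} s * indicator {ennreal u} (occ UNIV 0 (rescale (inverse s) (\<lambda>t. Z \<omega> (t + 0)))) \<partial>lborel) \<partial>M)"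
    by (rule nn_integral_Y) measurable
  also have "\<dots> = (\<integral>\<^sup>+\<omega>. 0 \<partial>M)"
  proof (rule nn_integral_cong_AE, use cont AE_space in eventually_elim)
    case (elim \<omega>)
    let ?A = "{s. 0 < s \<and> s < Z \<omega> 0 \<and> occ UNIV 0 (rescale (inverse s) (Z \<omega>)) = ennreal u}"
    have uniq: "s = s'" if "s \<in> ?A" "s' \<in> ?A" for s s'
    proof (rule ccontr)
      assume "s \<noteq> s'"
      then consider "s < s'" | "s' < s" by linarith
      then show False
      proof cases
        case 1
        show ?thesis by (rule exceedance_volume_strict[OF elim(1) 1, of 0 u])
          (use that occ[OF Z_gcadlag[OF elim(2)]] in auto)
      next
        case 2
        show ?thesis by (rule exceedance_volume_strict[OF elim(1) 2, of 0 u])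
          (use that occ[OF Z_gcadlag[OF elim(2)]] in auto)
      qed
    qed
    obtain s0 where s0: "?A \<subseteq> {s0}"
    proof (cases "?A = {}")
      case False
      then obtain s1 where "s1 \<in> ?A" by blast
      with uniq show ?thesis using that[of s1] by blast
    qed (use that in blast)
    have "(\<integral>\<^sup>+s. indicator {0<..<Z \<omega> 0} s * indicator {ennreal u} (occ UNIV 0 (rescale (inverse s) (\<lambda>t. Z \<omega> (t + 0)))) \<partial>lborel)
      = (\<integral>\<^sup>+s. 0 \<partial>(lborel :: real measure))"
      by (rule nn_integral_cong_AE, use AE_lborel_singleton[of s0] in eventually_elim)
        (use s0 in \<open>auto simp: indicator_def\<close>)
    then show ?case by simp
  qed
  finally have "(\<integral>\<^sup>+\<omega>. indicator {\<omega> \<in> space M. occ UNIV 0 (Y \<omega>) = ennreal u} \<omega> \<partial>M) = 0"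
    by (subst nn_integral_cong[where v = "\<lambda>\<omega>. indicator {ennreal u} (occ UNIV 0 (Y \<omega>))"]) (auto simp: indicator_def)
  then show ?thesis by (simp add: measure_def)
qed

text \<open>
  The probability that the lattice sum of \<open>\<Theta>\<close> diverges equals, for every \<open>u\<close>, the probability under
  the density \<open>Z u\<close> that the sum of \<open>Z\<close> over the lattice shifted by \<open>u\<close> diverges. The average of
  the latter over a cell vanishes, although nothing is known for a given \<open>u\<close>.
\<close>

lemma \<Theta>_summable:
  assumes \<delta>: "0 \<le> \<delta>" and fin: "AE \<omega> in M. (\<integral>\<^sup>+t. ennreal (Z \<omega> t) \<partial>lborel) < \<infinity>"
  shows "AE \<omega> in M. (\<integral>\<^sup>+t. ennreal (\<Theta> \<omega> t) \<partial>lattice_measure_of \<delta>) < \<infinity>"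
proof -
  define c where "c = (if \<delta> = 0 then 1 else \<delta>)"
  define H :: "(real ^ 'd) set" where "H = (if \<delta> = 0 then UNIV else grid \<delta>)"
  let ?\<nu> = "lattice_measure_of \<delta> :: (real ^ 'd) measure"
  interpret lattice_measure ?\<nu> H c
    using lattice_measure_lborel lattice_measure_grid[of \<delta>] \<delta> by (cases "\<delta> = 0") (simp_all add: c_def H_def)
  interpret l: lattice_measure "lattice_measure_of 0 :: (real ^ 'd) measure" UNIV 1
    by (rule lattice_measure_lborel)
  interpret p: pair_sigma_finite M "lborel :: (real ^ 'd) measure" ..
  have lb: "(lattice_measure_of 0 :: (real ^ 'd) measure) = lborel"
    by (simp add: lattice_measure_of_def lam_def distr_id2)
  define I where "I f = (\<integral>\<^sup>+t. ennreal (f t) \<partial>?\<nu>)" for f :: "real ^ 'd \<Rightarrow> real"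
  have Im [measurable]: "(\<lambda>\<omega>. I (X \<omega>)) \<in> borel_measurable N" if [measurable]: "X \<in> measurable N D_space" for X and N :: "'z measure"
    unfolding I_def
  proof (rule \<nu>.borel_measurable_nn_integral)
    have "(\<lambda>p. X (fst p) (snd p)) \<in> borel_measurable (N \<Otimes>\<^sub>M borel)"
      by (rule measurable_eval_comp) measurable
    then show "(\<lambda>(\<omega>, v). ennreal (X \<omega> v)) \<in> borel_measurable (N \<Otimes>\<^sub>M ?\<nu>)"
      by (simp add: measurable_pair_\<nu> split_beta')
  qed
  have ae: "AE u in lborel. u \<in> cube c \<longrightarrow> I (\<lambda>t. f (t + u)) < \<infinity>" if "f \<in> gcadlag" "(\<integral>\<^sup>+t. ennreal (f t) \<partial>lborel) < \<infinity>" for f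
  proof (cases "\<delta> = 0")
    case True
    have [measurable]: "f \<in> borel_measurable borel" by (rule measurable_gcadlag[OF that(1)])
    have "I (\<lambda>t. f (t + u)) < \<infinity>" for u
      using l.\<nu>_shift[of u "\<lambda>t. ennreal (f t)"] that(2) by (simp add: I_def True lb)
    then show ?thesis by simp
  next
    case False
    then show ?thesis using shifted_grid_integral_finite[OF that(1) _ that(2), of \<delta>] \<delta> by (simp add: I_def c_def)
  qed
  define F where "F f = (indicator {\<infinity>} (I f) :: ennreal)" for f :: "real ^ 'd \<Rightarrow> real"
  have Fm [measurable]: "(\<lambda>\<omega>. F (X \<omega>)) \<in> borel_measurable N" if [measurable]: "X \<in> measurable N D_space" for X and N :: "'z measure"
    unfolding F_def by measurable
  have shift: "(\<integral>\<^sup>+\<omega>. F (\<Theta> \<omega>) \<partial>M) = (\<integral>\<^sup>+\<omega>. ennreal (Z \<omega> u) * F (\<lambda>t. Z \<omega> (t + u)) \<partial>M)" for u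
  proof -
    have "(\<integral>\<^sup>+\<omega>. F (\<Theta> \<omega>) \<partial>M) = (\<integral>\<^sup>+f. F f \<partial>tilted u)"
      unfolding tilted_shift[of u 0] \<Theta>_law[symmetric] by (subst nn_integral_distr) measurable
    also have "\<dots> = (\<integral>\<^sup>+\<omega>. ennreal (Z \<omega> u) * F (\<lambda>t. \<bar>inverse (Z \<omega> u)\<bar> * Z \<omega> (t + u)) \<partial>M)"
      by (rule nn_integral_tilted) measurable
    also have "\<dots> = (\<integral>\<^sup>+\<omega>. ennreal (Z \<omega> u) * F (\<lambda>t. Z \<omega> (t + u)) \<partial>M)"
    proof (intro nn_integral_cong)
      fix \<omega> assume \<omega>: "\<omega> \<in> space M"
      show "ennreal (Z \<omega> u) * F (\<lambda>t. \<bar>inverse (Z \<omega> u)\<bar> * Z \<omega> (t + u)) = ennreal (Z \<omega> u) * F (\<lambda>t. Z \<omega> (t + u))"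
      proof (cases "0 < Z \<omega> u")
        case True
        have "(\<lambda>t. Z \<omega> (t + u)) \<in> borel_measurable borel"
          by (rule measurable_gcadlag[OF gcadlag_shift[OF Z_gcadlag[OF \<omega>]]])
        then have "I (\<lambda>t. \<bar>inverse (Z \<omega> u)\<bar> * Z \<omega> (t + u)) = ennreal \<bar>inverse (Z \<omega> u)\<bar> * I (\<lambda>t. Z \<omega> (t + u))"
          unfolding I_def by (simp add: ennreal_mult' nn_integral_cmult measurable_\<nu> del: abs_inverse)
        then show ?thesis using True by (simp add: F_def indicator_def ennreal_mult_eq_top_iff)
      next
        case False
        then show ?thesis using Z_nonneg[OF \<omega>, of u] by simp
      qed
    qed
    finally show ?thesis .
  qed
  have Zu: "(\<lambda>p. \<lambda>t. Z (fst p) (t + snd p)) \<in> measurable (M \<Otimes>\<^sub>M lborel) D_space"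
  proof (rule measurable_into_D)
    show "(\<lambda>p. Z (fst p) (t + snd p)) \<in> borel_measurable (M \<Otimes>\<^sub>M lborel)" for t
      by (rule measurable_eval_comp) measurable
    show "(\<lambda>t. Z (fst p) (t + snd p)) \<in> gcadlag" if "p \<in> space (M \<Otimes>\<^sub>M lborel)" for p
      by (rule gcadlag_shift[OF Z_gcadlag]) (use that in \<open>auto simp: space_pair_measure\<close>)
  qed
  have Zu': "(\<lambda>p. Z (fst p) (snd p)) \<in> borel_measurable (M \<Otimes>\<^sub>M lborel)"
    by (rule measurable_eval_comp) measurable
  have "ennreal (c ^ CARD('d)) * (\<integral>\<^sup>+\<omega>. F (\<Theta> \<omega>) \<partial>M)
      = (\<integral>\<^sup>+u. indicator (cube c) u * (\<integral>\<^sup>+\<omega>. F (\<Theta> \<omega>) \<partial>M) \<partial>(lborel :: (real ^ 'd) measure))"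
    by (subst nn_integral_multc) (simp_all add: emeasure_lborel_cube[OF c_pos])
  also have "\<dots> = (\<integral>\<^sup>+u. (\<integral>\<^sup>+\<omega>. indicator (cube c) u * (ennreal (Z \<omega> u) * F (\<lambda>t. Z \<omega> (t + u))) \<partial>M) \<partial>lborel)"
  proof (intro nn_integral_cong)
    fix u
    have [measurable]: "(\<lambda>\<omega> t. Z \<omega> (t + u)) \<in> measurable M D_space"
      by (rule measurable_compose[OF Z_measurable measurable_shift_D])
    show "indicator (cube c) u * (\<integral>\<^sup>+\<omega>. F (\<Theta> \<omega>) \<partial>M) = (\<integral>\<^sup>+\<omega>. indicator (cube c) u * (ennreal (Z \<omega> u) * F (\<lambda>t. Z \<omega> (t + u))) \<partial>M)"
      unfolding shift[of u] by (rule nn_integral_cmult[symmetric]) measurable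
  qed
  also have "\<dots> = (\<integral>\<^sup>+\<omega>. (\<integral>\<^sup>+u. indicator (cube c) u * (ennreal (Z \<omega> u) * F (\<lambda>t. Z \<omega> (t + u))) \<partial>lborel) \<partial>M)"
    by (rule p.Fubini') (use Zu' Fm[OF Zu] in \<open>auto simp: split_beta' intro!: borel_measurable_times_ennreal\<close>)
  also have "\<dots> = (\<integral>\<^sup>+\<omega>. 0 \<partial>M)"
  proof (rule nn_integral_cong_AE, use fin AE_space in eventually_elim)
    case (elim \<omega>)
    have "(\<integral>\<^sup>+u. indicator (cube c) u * (ennreal (Z \<omega> u) * F (\<lambda>t. Z \<omega> (t + u))) \<partial>lborel) = (\<integral>\<^sup>+u. 0 \<partial>(lborel :: (real ^ 'd) measure))"
      by (rule nn_integral_cong_AE, use ae[OF Z_gcadlag[OF elim(2)] elim(1)] in eventually_elim)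
        (auto simp: F_def indicator_def)
    then show ?case by simp
  qed
  finally have "(\<integral>\<^sup>+\<omega>. F (\<Theta> \<omega>) \<partial>M) = 0" using c_pos by simp
  then have "AE \<omega> in M. F (\<Theta> \<omega>) = 0" by (subst (asm) nn_integral_0_iff_AE) measurable
  then show ?thesis by eventually_elim (auto simp: F_def I_def indicator_def less_top split: if_splits)
qed

text \<open>
  The exceedance volume of level 1 is at most the integral of the path.
\<close>

lemma exceedances_finite:
  assumes \<delta>: "0 \<le> \<delta>" and fin: "AE \<omega> in M. (\<integral>\<^sup>+t. ennreal (Z \<omega> t) \<partial>lborel) < \<infinity>"
  shows "AE \<omega> in M. lattice_measure.occ (lattice_measure_of \<delta>) UNIV 0 (Y \<omega>) < \<infinity>"
proof -
  let ?\<nu> = "lattice_measure_of \<delta> :: (real ^ 'd) measure"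
  have "\<exists>H c. lattice_measure ?\<nu> H c"
    using lattice_measure_lborel lattice_measure_grid[of \<delta>] \<delta> by (cases "\<delta> = 0") auto
  then obtain H c where "lattice_measure ?\<nu> H c" by blast
  then interpret lattice_measure ?\<nu> H c .
  show ?thesis
    using \<Theta>_summable[OF assms] AE_space
  proof eventually_elim
    case (elim \<omega>)
    have \<Theta>: "\<Theta> \<omega> \<in> gcadlag" using measurable_space[OF \<Theta>_measurable elim(2)] by (simp add: space_D)
    then have [measurable]: "\<Theta> \<omega> \<in> borel_measurable borel" by (rule measurable_gcadlag)
    have "occ UNIV 0 (Y \<omega>) \<le> (\<integral>\<^sup>+t. ennreal \<bar>R \<omega>\<bar> * ennreal (\<Theta> \<omega> t) \<partial>?\<nu>)"
      unfolding occ_def Y_def rescale_def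
      by (intro nn_integral_mono) (auto simp: indicator_def ennreal_mult'[symmetric])
    also have "\<dots> = ennreal \<bar>R \<omega>\<bar> * (\<integral>\<^sup>+t. ennreal (\<Theta> \<omega> t) \<partial>?\<nu>)"
      by (rule nn_integral_cmult) (simp add: measurable_\<nu>)
    also have "\<dots> < \<infinity>" using elim(1) by (simp add: ennreal_mult_less_top)
    finally show ?case .
  qed
qed

end

section \<open>Continuity and positivity\<close>

theorem corollary2p6:
  fixes M :: "'w measure"
    and Z :: "'w \<Rightarrow> real ^ 'd::finite \<Rightarrow> real"
    and V :: "nat \<Rightarrow> 'w \<Rightarrow> real"
    and Zs :: "nat \<Rightarrow> 'w \<Rightarrow> real ^ 'd \<Rightarrow> real"
    and \<Theta> :: "'w \<Rightarrow> real ^ 'd \<Rightarrow> real"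
    and R :: "'w \<Rightarrow> real"
    and Y :: "'w \<Rightarrow> real ^ 'd \<Rightarrow> real"
  assumes "prob_space M" and "complete_measure M" and "nonatomic M"
    and "cadlag_field M Z"
    and "\<forall>t. (\<integral>\<^sup>+ \<omega>. ennreal (Z \<omega> t) \<partial>M) = 1"
    and "\<forall>T>0. (\<integral>\<^sup>+ \<omega>. (SUP t\<in>cbox 0 (vec T). ennreal (Z \<omega> t)) \<partial>M) < \<infinity>"
    and "AE \<omega> in M. 0 < (SUP t. ennreal (Z \<omega> t))"
    and "spectral_sequence M Z V Zs"
    and "stationary_field M (max_stable V Zs)"
    and "\<Theta> \<in> measurable M D_space"
    and "\<forall>A\<in>sets D_space. emeasure M (\<Theta> -` A \<inter> space M) =
           (\<integral>\<^sup>+ \<omega>. ennreal (Z \<omega> 0) * indicator A (\<lambda>t. Z \<omega> t / Z \<omega> 0) \<partial>M)"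
    and "indep_elements M borel R D_space \<Theta>"
    and "\<forall>r\<ge>1. measure M {\<omega> \<in> space M. R \<omega> > r} = 1 / r"
    and "Y = (\<lambda>\<omega> t. R \<omega> * \<Theta> \<omega> t)"
    and "measure M {\<omega> \<in> space M. field_integral 0 (Z \<omega>) = \<infinity>} < 1"
  shows "((AE \<omega> in M. continuous_on UNIV (Z \<omega>)) \<longrightarrow>
            continuous_distribution M (\<lambda>\<omega>. epsilon 0 (Y \<omega>))) \<and>
         (\<forall>\<delta>\<ge>0. (AE \<omega> in M. 0 < field_integral \<delta> (Z \<omega>)) \<longrightarrow>
            (\<forall>x\<ge>0. measure M {\<omega> \<in> space M. epsilon \<delta> (Y \<omega>) > ennreal x} > 0 \<longrightarrow>
               measure M {\<omega> \<in> space M. field_integral 0 (Z \<omega>) = \<infinity>} = 0 \<or>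
               measure M {\<omega> \<in> space M. ennreal x < epsilon \<delta> (Y \<omega>) \<and> epsilon \<delta> (Y \<omega>) < \<infinity>} > 0
               \<longrightarrow> berman M Z \<delta> x > 0))"
proof -
  interpret prob_space M by (rule assms(1))
  interpret cm: complete_measure M by (rule assms(2))
  have Zc: "AE \<omega> in M. Z \<omega> \<in> gcadlag" and Zm [measurable]: "\<And>t. (\<lambda>\<omega>. Z \<omega> t) \<in> borel_measurable M"
    using assms(4) by (auto simp: cadlag_field_def)
  \<comment> \<open>a version with all paths in \<open>D\<close>; completeness makes it measurable\<close>
  define Z' where "Z' \<omega> = (if Z \<omega> \<in> gcadlag then Z \<omega> else (\<lambda>_. 0))" for \<omega>
  have ZZ: "AE \<omega> in M. Z' \<omega> = Z \<omega>" using Zc by eventually_elim (simp add: Z'_def)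
  have Z'm: "Z' \<in> measurable M D_space"
  proof (rule measurable_into_D)
    show "Z' \<omega> \<in> gcadlag" for \<omega> by (simp add: Z'_def gcadlag_zero)
    have [measurable]: "{\<omega> \<in> space M. Z \<omega> \<in> gcadlag} \<in> sets M"
      by (rule cm.in_sets_AE[of "space M"]) (use Zc in \<open>eventually_elim, auto\<close>)
    fix t
    have "(\<lambda>\<omega>. if \<omega> \<in> {\<omega> \<in> space M. Z \<omega> \<in> gcadlag} then Z \<omega> t else 0) \<in> borel_measurable M"
      by measurable
    also have "?this \<longleftrightarrow> (\<lambda>\<omega>. Z' \<omega> t) \<in> borel_measurable M"
      by (rule measurable_cong) (simp add: Z'_def)
    finally show "(\<lambda>\<omega>. Z' \<omega> t) \<in> borel_measurable M" .
  qed
  have peak_eq: "(\<integral>\<^sup>+\<omega>. peak F x \<tau> (Z' \<omega>) \<partial>M) = (\<integral>\<^sup>+\<omega>. peak F x \<tau> (Z \<omega>) \<partial>M)"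
    for F :: "(real ^ 'd) option set" and x \<tau>
    by (rule nn_integral_cong_AE) (use ZZ in eventually_elim, simp)
  interpret spectral_field M Z'
  proof
    show "Z' \<in> measurable M D_space" by (rule Z'm)
    fix t
    have "(\<integral>\<^sup>+\<omega>. ennreal (Z' \<omega> t) \<partial>M) = (\<integral>\<^sup>+\<omega>. ennreal (Z \<omega> t) \<partial>M)"
      by (rule nn_integral_cong_AE) (use ZZ in eventually_elim, simp)
    then show "(\<integral>\<^sup>+\<omega>. ennreal (Z' \<omega> t) \<partial>M) = 1" using assms(5) by simp
  next
    fix F :: "(real ^ 'd) option set" and x :: "(real ^ 'd) option \<Rightarrow> real"
      and \<tau> :: "(real ^ 'd) option \<Rightarrow> real ^ 'd" and h h' :: "real ^ 'd"
    assume F: "finite F" "\<And>t. 0 \<le> x t"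
    show "(\<integral>\<^sup>+\<omega>. peak F x (\<lambda>t. \<tau> t + h) (Z' \<omega>) \<partial>M) = (\<integral>\<^sup>+\<omega>. peak F x (\<lambda>t. \<tau> t + h') (Z' \<omega>) \<partial>M)"
      unfolding peak_eq by (intro antisym expectation_peak_shift_le[OF assms(4,8,9) F])
  qed
  interpret spectral_tail_field M Z' \<Theta> R
  proof
    show "distr M D_space \<Theta> = tilted 0"
    proof (rule measure_eqI)
      fix A assume "A \<in> sets (distr M D_space \<Theta>)"
      then have A: "A \<in> sets D_space" by simp
      have "emeasure (distr M D_space \<Theta>) A = (\<integral>\<^sup>+ \<omega>. ennreal (Z \<omega> 0) * indicator A (\<lambda>t. Z \<omega> t / Z \<omega> 0) \<partial>M)"
        using assms(10,11) A by (simp add: emeasure_distr)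
      also have "\<dots> = (\<integral>\<^sup>+ \<omega>. ennreal (Z' \<omega> 0) * indicator A (\<lambda>t. \<bar>inverse (Z' \<omega> 0)\<bar> * Z' \<omega> (t + 0)) \<partial>M)"
      proof (rule nn_integral_cong_AE, use ZZ AE_space in eventually_elim)
        case (elim \<omega>)
        have "\<bar>inverse (Z' \<omega> 0)\<bar> = inverse (Z' \<omega> 0)" using Z_nonneg[OF elim(2), of 0] by simp
        then show ?case using elim(1) by (simp add: divide_inverse mult.commute del: abs_inverse)
      qed
      also have "\<dots> = (\<integral>\<^sup>+f. indicator A f \<partial>tilted 0)" using A by (subst nn_integral_tilted) auto
      also have "\<dots> = emeasure (tilted 0) A" using A by (simp add: tilted_def)
      finally show "emeasure (distr M D_space \<Theta>) A = emeasure (tilted 0) A" .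
    qed (simp add: tilted_def)
    show "indep_elements M borel R D_space \<Theta>" by (rule assms(12))
    show "prob {\<omega> \<in> space M. R \<omega> > r} = 1 / r" if "1 \<le> r" for r using assms(13) that by blast
  qed
  let ?\<nu> = "\<lambda>\<delta>. lattice_measure_of \<delta> :: (real ^ 'd) measure"
  let ?occ = "\<lambda>\<delta> \<omega>. lattice_measure.occ (?\<nu> \<delta>) UNIV 0 (spectral_tail_field.Y \<Theta> R \<omega>)"
  have lat: "\<exists>H. lattice_measure (?\<nu> \<delta>) H (if \<delta> = 0 then 1 else \<delta>)" if "0 \<le> \<delta>" for \<delta>
    using lattice_measure_lborel lattice_measure_grid[of \<delta>] that by (cases "\<delta> = 0") auto
  have occ_eps: "AE \<omega> in M. epsilon \<delta> (Y \<omega>) = ?occ \<delta> \<omega>" if \<delta>: "0 \<le> \<delta>" for \<delta>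
  proof -
    obtain H where "lattice_measure (?\<nu> \<delta>) H (if \<delta> = 0 then 1 else \<delta>)" using lat[OF \<delta>] by blast
    then interpret lattice_measure "?\<nu> \<delta>" H "if \<delta> = 0 then 1 else \<delta>" .
    show ?thesis
      using Y_eq AE_space
    proof eventually_elim
      case (elim \<omega>)
      have "spectral_tail_field.Y \<Theta> R \<omega> \<in> gcadlag" using measurable_space[OF Y_measurable elim(2)] by (simp add: space_D)
      from sojourn_eq[OF this, of UNIV \<delta> 1] show ?case
        using elim(1) by (simp add: assms(14) occ_def)
    qed
  qed
  have occ_meas: "?occ \<delta> \<in> borel_measurable M" if \<delta>: "0 \<le> \<delta>" for \<delta>
  proof -
    obtain H where "lattice_measure (?\<nu> \<delta>) H (if \<delta> = 0 then 1 else \<delta>)" using lat[OF \<delta>] by blast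
    then interpret lattice_measure "?\<nu> \<delta>" H "if \<delta> = 0 then 1 else \<delta>" .
    show ?thesis by measurable
  qed
  have transfer: "measure M {\<omega> \<in> space M. P (epsilon \<delta> (Y \<omega>))} = measure M {\<omega> \<in> space M. P (?occ \<delta> \<omega>)}"
    if \<delta>: "0 \<le> \<delta>" and P: "{\<omega> \<in> space M. P (?occ \<delta> \<omega>)} \<in> sets M" for \<delta> P
  proof (rule measure_eq_AE)
    have ae: "AE \<omega> in M. \<omega> \<in> {\<omega> \<in> space M. P (?occ \<delta> \<omega>)} \<longleftrightarrow> \<omega> \<in> {\<omega> \<in> space M. P (epsilon \<delta> (Y \<omega>))}"
      using occ_eps[OF \<delta>] by eventually_elim simp
    then show "AE \<omega> in M. \<omega> \<in> {\<omega> \<in> space M. P (epsilon \<delta> (Y \<omega>))} \<longleftrightarrow> \<omega> \<in> {\<omega> \<in> space M. P (?occ \<delta> \<omega>)}"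
      by eventually_elim blast
    show "{\<omega> \<in> space M. P (epsilon \<delta> (Y \<omega>))} \<in> sets M"
      by (rule cm.in_sets_AE[OF ae P]) auto
  qed (rule P)
  show ?thesis
  proof (intro conjI impI allI)
    assume "AE \<omega> in M. continuous_on UNIV (Z \<omega>)"
    with ZZ have "AE \<omega> in M. continuous_on UNIV (Z' \<omega>)" by eventually_elim simp
    from exceedance_volume_no_atom[OF this]
    have "continuous_distribution M (?occ 0)"
      by (intro continuous_distributionI assms(1) occ_meas) auto
    moreover have "measure M {\<omega> \<in> space M. enn2ereal (epsilon 0 (Y \<omega>)) \<le> ereal u} = measure M {\<omega> \<in> space M. enn2ereal (?occ 0 \<omega>) \<le> ereal u}" for u
    proof (rule transfer[OF order_refl])
      note [measurable] = occ_meas[OF order_refl]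
      show "{\<omega> \<in> space M. enn2ereal (?occ 0 \<omega>) \<le> ereal u} \<in> sets M" by measurable
    qed
    ultimately show "continuous_distribution M (\<lambda>\<omega>. epsilon 0 (Y \<omega>))"
      unfolding continuous_distribution_def by simp
  next
    fix \<delta> x :: real
    assume \<delta>: "0 \<le> \<delta>" and x: "0 \<le> x" and px: "0 < measure M {\<omega> \<in> space M. epsilon \<delta> (Y \<omega>) > ennreal x}"
      and cond: "measure M {\<omega> \<in> space M. field_integral 0 (Z \<omega>) = \<infinity>} = 0 \<or>
        measure M {\<omega> \<in> space M. ennreal x < epsilon \<delta> (Y \<omega>) \<and> epsilon \<delta> (Y \<omega>) < \<infinity>} > 0"
    define c where "c = (if \<delta> = 0 then 1 else \<delta>)"
    have c: "0 < c" using \<delta> by (simp add: c_def)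
    obtain H where "lattice_measure (?\<nu> \<delta>) H c" using lat[OF \<delta>] unfolding c_def by blast
    then interpret lattice_measure "?\<nu> \<delta>" H c .
    interpret berman_field M Z' \<Theta> R "?\<nu> \<delta>" H c
    proof
      have "(\<integral>\<^sup>+\<omega>. (SUP t\<in>cube c. ennreal (Z' \<omega> t)) \<partial>M) \<le> (\<integral>\<^sup>+\<omega>. (SUP t\<in>cbox 0 (vec c). ennreal (Z \<omega> t)) \<partial>M)"
      proof (rule nn_integral_mono_AE, use ZZ in eventually_elim)
        case (elim \<omega>)
        have "cube c \<subseteq> (cbox 0 (vec c) :: (real ^ 'd) set)" by (auto simp: cube_def mem_box_cart less_imp_le)
        then show ?case unfolding elim by (rule SUP_subset_mono) simp
      qed
      also have "\<dots> < \<infinity>" using assms(6) c by blast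
      finally show "(\<integral>\<^sup>+\<omega>. (SUP t\<in>cube c. ennreal (Z' \<omega> t)) \<partial>M) < \<infinity>" .
    qed
    note [measurable] = occ_meas[OF \<delta>]
    have pos: "0 < measure M {\<omega> \<in> space M. ennreal x < ?occ \<delta> \<omega> \<and> ?occ \<delta> \<omega> < \<infinity>}"
      using cond
    proof
      assume null: "measure M {\<omega> \<in> space M. field_integral 0 (Z \<omega>) = \<infinity>} = 0"
      have lb: "?\<nu> 0 = lborel" by (simp add: lattice_measure_of_def lam_def distr_id2)
      have I: "AE \<omega> in M. field_integral 0 (Z \<omega>) = (\<integral>\<^sup>+t. ennreal (Z' \<omega> t) \<partial>lborel)"
        using ZZ AE_space by eventually_elim (metis Z_gcadlag field_integral_eq lb)
      have [measurable]: "(\<lambda>\<omega>. \<integral>\<^sup>+t. ennreal (Z' \<omega> t) \<partial>lborel) \<in> borel_measurable M"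
      proof (rule lborel.borel_measurable_nn_integral)
        have "(\<lambda>p. Z' (fst p) (snd p)) \<in> borel_measurable (M \<Otimes>\<^sub>M lborel)"
          by (rule measurable_eval_comp) measurable
        then show "(\<lambda>(\<omega>, t). ennreal (Z' \<omega> t)) \<in> borel_measurable (M \<Otimes>\<^sub>M lborel)"
          by (simp add: split_beta')
      qed
      let ?A = "{\<omega> \<in> space M. (\<integral>\<^sup>+t. ennreal (Z' \<omega> t) \<partial>lborel) = \<infinity>}"
      let ?B = "{\<omega> \<in> space M. field_integral 0 (Z \<omega>) = \<infinity>}"
      have A: "?A \<in> sets M" by measurable
      have ae: "AE \<omega> in M. \<omega> \<in> ?A \<longleftrightarrow> \<omega> \<in> ?B" using I by eventually_elim simp
      have B: "?B \<in> sets M" by (rule cm.in_sets_AE[OF ae A]) auto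
      have "measure M ?A = measure M ?B" by (rule measure_eq_AE[OF ae A B])
      then have "emeasure M ?A = 0" using null by (simp add: emeasure_eq_measure)
      then have "AE \<omega> in M. (\<integral>\<^sup>+t. ennreal (Z' \<omega> t) \<partial>lborel) < \<infinity>"
        by (intro AE_I[OF _ _ A]) (auto simp: less_top[symmetric])
      from exceedances_finite[OF \<delta> this]
      have "measure M {\<omega> \<in> space M. ennreal x < ?occ \<delta> \<omega> \<and> ?occ \<delta> \<omega> < \<infinity>} = measure M {\<omega> \<in> space M. ennreal x < ?occ \<delta> \<omega>}"
        by (intro measure_eq_AE, eventually_elim) (auto, measurable)
      moreover have "measure M {\<omega> \<in> space M. epsilon \<delta> (Y \<omega>) > ennreal x} = measure M {\<omega> \<in> space M. ?occ \<delta> \<omega> > ennreal x}"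
        by (rule transfer[OF \<delta>]) measurable
      ultimately show ?thesis using px by simp
    next
      assume "0 < measure M {\<omega> \<in> space M. ennreal x < epsilon \<delta> (Y \<omega>) \<and> epsilon \<delta> (Y \<omega>) < \<infinity>}"
      moreover have "measure M {\<omega> \<in> space M. ennreal x < epsilon \<delta> (Y \<omega>) \<and> epsilon \<delta> (Y \<omega>) < \<infinity>}
          = measure M {\<omega> \<in> space M. ennreal x < ?occ \<delta> \<omega> \<and> ?occ \<delta> \<omega> < \<infinity>}"
        by (rule transfer[OF \<delta>]) measurable
      ultimately show ?thesis by simp
    qed
    have "AE \<omega> in M. Z \<omega> = Z' \<omega>" using ZZ by eventually_elim simp
    then have "berman M Z \<delta> x = berman_constant (ennreal x)"
      by (intro berman_eq assms(2)) auto
    moreover have "berman_constant (ennreal x) \<noteq> 0"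
    proof
      assume "berman_constant (ennreal x) = 0"
      then have "AE \<omega> in M. indicator {ennreal x<..} (?occ \<delta> \<omega>) * inverse (?occ \<delta> \<omega>) = 0"
        unfolding berman_constant_def by (subst (asm) nn_integral_0_iff_AE) measurable
      then have "AE \<omega> in M. \<not> (ennreal x < ?occ \<delta> \<omega> \<and> ?occ \<delta> \<omega> < \<infinity>)"
        by eventually_elim (auto simp: indicator_def)
      then have "measure M {\<omega> \<in> space M. ennreal x < ?occ \<delta> \<omega> \<and> ?occ \<delta> \<omega> < \<infinity>} = measure M {}"
        by (intro measure_eq_AE, eventually_elim) (auto, measurable)
      with pos show False by simp
    qed
    ultimately show "berman M Z \<delta> x > 0" by (simp add: zero_less_iff_neq_zero)
  qed
qed

end
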